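(* Let $k \ge 2$ be an integer, $n = 2^k-1$, and $d \ge 1$. Choose $s_1,\dots,s_d$ independently and uniformly at random in $\mathit{GL}_k(\mathbb{F}_2)$ and let $G$ be the bipartite Schreier graph whose left and right parts are two copies of $(\mathbb{F}_2^k)^* = \mathbb{F}_2^k\setminus\{0\}$, where for every nonzero $x$ and every $j$ the left copy of $x$ is joined to the right copy of $s_j x$ (a $d$-regular bipartite multigraph with $2n$ vertices). Let $\mu_2$ be the second largest eigenvalue of its normalized adjacency matrix (adjacency matrix divided by $d$), in the sense of the context below. For integers $p \ge 1$, $c\ge 0$, $l \ge 0$, $d'\ge 0$ define recursively $$ Y_p(c,l, d') = \begin{cases} 1 & \text{if } c = 0 \text{ and } l = 0;\\ 0 & \text{if } p > l;\\ \displaystyle\sum_{i = c}^{\lfloor l/p\rfloor} \binom{d'}{i}(p!)^{-i}\frac{l!}{(l-pi)!}\,Y_{p+1}(0,l-pi, d'-i) & \text{otherwise,} \end{cases} $$ (with $\binom{d'}{i}=0$ for $i>d'$), and set $y_3(i) = Y_3(1,2m-2i, d-i)$, $y_4(i) = Y_4(0,2m-2i, d-i)$. Then for every positive integer $m$, \begin{multline*} \mathbf{E}(|\mu_2|) \le \Bigg(\Big(\frac{1}{d}\Big)^{2m}n\bigg[ \sum_{i = 1}^m \bigg[\binom{d}{i} \Big(\frac{1}{2}\Big)^i \frac{(2m)!}{(2m-2i)!} \frac{2^i}{(i+1)!}\Big(y_3(i)\frac{5}{n} + y_4(i) \Big)\bigg] \\ + Y_1(1, 2m, d)\frac{1}{n}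 + Y_2(1, 2m, d)\frac{2}{n} + y_3(0)\frac{5}{n} + y_4(0)\bigg] - 1 \Bigg)^{\frac{1}{2m}}. \end{multline*}
   Context: For a bipartite biregular graph the eigenvalues of the normalized adjacency matrix come in pairs $\pm\lambda$; the largest pair is $\pm 1$. The "second largest eigenvalue" $\mu_2$ is the nonnegative member of the next pair, i.e. the largest absolute value among the eigenvalues after removing one copy of $1$ and one copy of $-1$. The expectation is over the random choice of $s_1,\dots,s_d$. *)

theory Defs
  imports "Jordan_Normal_Form.Char_Poly" "HOL-Computational_Algebra.Polynomial" "HOL-Library.Z2"
begin

definition GL2 :: "nat \<Rightarrow> bit mat set" where
  "GL2 k = {A \<in> carrier_mat k k. invertible_mat A}"

(* enumeration of F_2^k: the number a corresponds to the vector of its binary digits;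
   a \<in> {1..2^k-1} enumerates exactly the nonzero vectors *)
definition vec_of_nat :: "nat \<Rightarrow> nat \<Rightarrow> bit vec" where
  "vec_of_nat k a = vec k (\<lambda>i. if bit a i then 1 else 0)"

(* adjacency matrix of the bipartite Schreier graph: vertices 0..n-1 are the left copies
   of the nonzero vectors vec_of_nat k (i+1), vertices n..2n-1 the right copies;
   entry = number of j with s_j x = y (multigraph) *)
definition schreier_adj :: "nat \<Rightarrow> nat \<Rightarrow> (nat \<Rightarrow> bit mat) \<Rightarrow> real mat" where
  "schreier_adj k d s = (let n = 2^k - 1 in
     mat (2*n) (2*n) (\<lambda>(a,b).
       if a < n \<and> n \<le> b then
         real (card {j \<in> {..<d}. s j *\<^sub>v vec_of_nat k (a+1) = vec_of_nat k (b-n+1)})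
       else if n \<le> a \<and> b < n then
         real (card {j \<in> {..<d}. s j *\<^sub>v vec_of_nat k (b+1) = vec_of_nat k (a-n+1)})
       else 0))"

definition normalized_adj :: "nat \<Rightarrow> nat \<Rightarrow> (nat \<Rightarrow> bit mat) \<Rightarrow> real mat" where
  "normalized_adj k d s = (1 / real d) \<cdot>\<^sub>m schreier_adj k d s"

definition eigenvalues_mset :: "real mat \<Rightarrow> real multiset" where
  "eigenvalues_mset A = proots (char_poly A)"

definition mu2 :: "nat \<Rightarrow> nat \<Rightarrow> (nat \<Rightarrow> bit mat) \<Rightarrow> real" where
  "mu2 k d s = Max (abs ` set_mset (eigenvalues_mset (normalized_adj k d s) - {#1, -1#}))"

definition expected_abs_mu2 :: "nat \<Rightarrow> nat \<Rightarrow> real" where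
  "expected_abs_mu2 k d =
     (\<Sum>s \<in> PiE {..<d} (\<lambda>_. GL2 k). \<bar>mu2 k d s\<bar>) / real (card (PiE {..<d} (\<lambda>_. GL2 k)))"

function Y :: "nat \<Rightarrow> nat \<Rightarrow> nat \<Rightarrow> nat \<Rightarrow> real" where
  "Y p c l d' =
     (if c = 0 \<and> l = 0 then 1
      else if p > l then 0
      else (\<Sum>i = c..l div p. real (d' choose i) / (fact p) ^ i * (fact l / fact (l - p * i))
              * Y (p + 1) 0 (l - p * i) (d' - i)))"
  by pat_completeness auto
termination
  by (relation "measure (\<lambda>(p, c, l, d'). Suc l - p)") auto

end

theory Submission
  imports Defs "Jordan_Normal_Form.Schur_Decomposition" "HOL-Combinatorics.Multiset_Permutations"
    "HOL-Analysis.Convex"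
begin

text \<open>The normalized adjacency matrix is real symmetric with spectrum symmetric about \<open>0\<close>, so
  \<open>2 * \<mu>\<^sub>2 ^ (2 * m) + 2\<close> is at most the trace of its \<open>2 * m\<close>-th power, and by Jensen's inequality it suffices to
  bound the expected trace. Up to the factor \<open>d ^ (2 * m)\<close> this trace counts, over all words of length \<open>2 * m\<close>
  in the \<open>d\<close> generators, the fixed points of the alternating product of generators and inverses.
  Conditioning on all other letters, a letter occurring once gives one expected fixed point, a
  letter occurring twice with equal signs, or two crossing letters occurring twice, give at most
  two, and a letter occurring three times gives at most five. The remaining words have
  noncrossing pairs of doubled letters, and are counted by Catalan numbers.\<close>

section \<open>Counting words\<close>

text \<open>Once the other generators are fixed, the stretches between the occurrences of the letter
  under study are treated as arbitrary permutations of the nonzero vectors; only the random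
  generator itself is known to be additive. The bounds 2 and 5 come from revealing that generator
  point by point: each newly queried point is either independent of the earlier ones, where the
  axioms of \<open>sampler\<close> apply, or lies in their span, and the degenerate cases raise the
  bound above 1. The constant 5 rests on n/(n-3) being at most 2, that is on n being at least 6; for
  smaller n it is trivial, since a permutation of n points has at most n fixed points. Words in
  which all letters outside noncrossing pairs occur at least four times get only the trivial bound
  n, so \<open>Y 4 0\<close> enters the claim without a factor 1/n. In general
  \<open>Y p c l d'\<close> bounds the number of words of length l over d' letters in which every
  letter present occurs at least p times and at least c letters occur exactly p times. Two factors 2
  cancel in the end: closed walks start on either side of the graph, and the second eigenvalue comes
  with its negative.\<close>

declare Y.simps [simp del]

definition words :: "nat \<Rightarrow> nat \<Rightarrow> 'a set \<Rightarrow> nat \<Rightarrow> 'a list set" where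
  "words p c A l = {w. set w \<subseteq> A \<and> length w = l \<and> (\<forall>a\<in>set w. p \<le> count_list w a)
     \<and> c \<le> card {a \<in> set w. count_list w a = p}}"

lemma finite_words: "finite A \<Longrightarrow> finite (words p c A l)"
  by (rule finite_subset[OF _ finite_lists_length_eq[of A l]]) (auto simp: words_def)

lemma words_disjoint: "w \<in> words p c (A - I) l \<Longrightarrow> set w \<inter> I = {} \<and> length w = l"
  by (auto simp: words_def)

lemma count_list_filter: "count_list (filter P w) a = (if P a then count_list w a else 0)"
  by (induction w) auto

lemma length_eq_sum_count_list:
  assumes "finite I" "set w \<subseteq> I"
  shows "length w = (\<Sum>a\<in>I. count_list w a)"
  using assms by (metis sum_count_set)

lemma length_uniform_word:
  assumes "finite I" "set w \<subseteq> I" "\<And>a. a \<in> I \<Longrightarrow> count_list w a = p"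
  shows "length w = p * card I"
  using assms length_eq_sum_count_list[of I w] by simp

text \<open>These words are the orderings of the multiset with \<open>p\<close> copies of each
  letter of \<open>I\<close>, so their number is a multinomial coefficient.\<close>

lemma card_uniform_words:
  assumes I: "finite I" and p: "p \<ge> 1"
  shows "real (card {w. set w \<subseteq> I \<and> (\<forall>a\<in>I. count_list w a = p)}) = fact (p * card I) / fact p ^ card I"
proof -
  define M where "M = repeat_mset p (mset_set I)"
  have cnt: "count M a = (if a \<in> I then p else 0)" for a
    unfolding M_def using I by (simp add: count_mset_set)
  have "{w. set w \<subseteq> I \<and> (\<forall>a\<in>I. count_list w a = p)} = permutations_of_multiset M"
    unfolding permutations_of_multiset_def multiset_eq_iff cnt count_mset
    using count_list_0_iff by fastforce
  moreover have "set_mset M = I"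
    using p by (auto simp: set_eq_iff cnt simp flip: count_greater_zero_iff split: if_splits)
  moreover have "size M = p * card I" by (simp add: M_def)
  ultimately have eq: "card {w. set w \<subseteq> I \<and> (\<forall>a\<in>I. count_list w a = p)} * fact p ^ card I
      = fact (p * card I)"
    using card_permutations_of_multiset_aux[of M] by (simp add: cnt)
  have "real (card {w. set w \<subseteq> I \<and> (\<forall>a\<in>I. count_list w a = p)}) * fact p ^ card I
      = fact (p * card I)"
    using arg_cong[OF eq, of real] by simp
  then show ?thesis by (simp add: field_simps)
qed

text \<open>A word is a shuffle of its restriction to a letter set \<open>I\<close> and its
  restriction to the complement. The choices of \<open>I\<close>, of the positions of the first
  restriction and of the two restrictions give the four factors. The same count serves the recursion
  of \<open>Y\<close> and the splitting off of noncrossing pairs; only the classes put in for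
  \<open>E\<close> and \<open>F\<close> differ.\<close>

lemma card_split_words_le:
  assumes A: "finite A"
    and split: "\<And>w. w \<in> S \<Longrightarrow> \<exists>I\<subseteq>A. card I = i \<and> filter (\<lambda>a. a \<in> I) w \<in> E I
      \<and> filter (\<lambda>a. a \<notin> I) w \<in> F I"
    and E: "\<And>I. I \<subseteq> A \<Longrightarrow> card I = i \<Longrightarrow> finite (E I) \<and> real (card (E I)) \<le> x
      \<and> (\<forall>w\<in>E I. set w \<subseteq> I \<and> length w = q)"
    and F: "\<And>I. I \<subseteq> A \<Longrightarrow> card I = i \<Longrightarrow> finite (F I) \<and> real (card (F I)) \<le> y
      \<and> (\<forall>w\<in>F I. set w \<inter> I = {} \<and> length w = r)"
    and x: "x \<ge> 0"
  shows "real (card S) \<le> real (card A choose i) * real ((q + r) choose q) * x * y"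
proof -
  define \<I> where "\<I> = {I. I \<subseteq> A \<and> card I = i}"
  have \<I>: "finite \<I>" "card \<I> = card A choose i"
    unfolding \<I>_def using A by (auto simp: n_subsets)
  define T where "T I = (\<Union>u\<in>E I. \<Union>v\<in>F I. shuffles u v)" for I
  have finT: "finite (T I)" if "I \<in> \<I>" for I
    using that E F unfolding T_def \<I>_def by auto
  have "S \<subseteq> (\<Union>I\<in>\<I>. T I)"
  proof
    fix w assume "w \<in> S"
    then obtain I where I: "I \<subseteq> A" "card I = i" "filter (\<lambda>a. a \<in> I) w \<in> E I"
      "filter (\<lambda>a. a \<notin> I) w \<in> F I" using split by blast
    have "w \<in> shuffles (filter (\<lambda>a. a \<in> I) w) (filter (\<lambda>a. a \<notin> I) w)"
      by (rule partition_in_shuffles)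
    then show "w \<in> (\<Union>I\<in>\<I>. T I)" using I unfolding T_def \<I>_def by blast
  qed
  then have "real (card S) \<le> real (card (\<Union>I\<in>\<I>. T I))"
    using \<I> finT by (intro of_nat_mono card_mono) auto
  also have "\<dots> \<le> (\<Sum>I\<in>\<I>. real (card (T I)))"
    using card_UN_le[OF \<I>(1), of T] by (metis of_nat_le_iff of_nat_sum)
  also have "\<dots> \<le> (\<Sum>I\<in>\<I>. real ((q + r) choose q) * x * y)"
  proof (rule sum_mono)
    fix I assume "I \<in> \<I>"
    then have EI: "finite (E I)" "real (card (E I)) \<le> x" "\<And>w. w \<in> E I \<Longrightarrow> set w \<subseteq> I \<and> length w = q"
      and FI: "finite (F I)" "real (card (F I)) \<le> y" "\<And>w. w \<in> F I \<Longrightarrow> set w \<inter> I = {} \<and> length w = r"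
      using E F unfolding \<I>_def by auto
    have sh: "card (shuffles u v) = (q + r) choose q" if "u \<in> E I" "v \<in> F I" for u v
      using that EI(3) FI(3) by (subst card_disjoint_shuffles) blast+
    have "card (T I) \<le> (\<Sum>u\<in>E I. card (\<Union>v\<in>F I. shuffles u v))"
      unfolding T_def by (rule card_UN_le[OF EI(1)])
    also have "\<dots> \<le> (\<Sum>u\<in>E I. \<Sum>v\<in>F I. card (shuffles u v))"
      by (intro sum_mono card_UN_le[OF FI(1)])
    also have "\<dots> = card (E I) * (card (F I) * ((q + r) choose q))"
      using sh by simp
    finally have "real (card (T I)) \<le> real (card (E I)) * (real (card (F I)) * real ((q + r) choose q))"
      by (metis of_nat_le_iff of_nat_mult)
    also have "\<dots> \<le> x * (y * real ((q + r) choose q))"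
      using EI(2) FI(2) x by (intro mult_mono) auto
    finally show "real (card (T I)) \<le> real ((q + r) choose q) * x * y"
      by (simp add: mult_ac)
  qed
  also have "\<dots> = real (card A choose i) * real ((q + r) choose q) * x * y"
    using \<I> by (simp add: mult_ac)
  finally show ?thesis .
qed

lemma split_exact_count:
  assumes w: "w \<in> words p c A l" and A: "finite A"
  defines "I \<equiv> {a \<in> set w. count_list w a = p}"
  shows "I \<subseteq> A" "c \<le> card I" "p * card I \<le> l"
    "filter (\<lambda>a. a \<in> I) w \<in> {u. set u \<subseteq> I \<and> (\<forall>a\<in>I. count_list u a = p)}"
    "filter (\<lambda>a. a \<notin> I) w \<in> words (p + 1) 0 (A - I) (l - p * card I)"
proof -
  show sub: "I \<subseteq> A" using w unfolding words_def I_def by blast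
  show "c \<le> card I" using w unfolding words_def I_def by blast
  show mem: "filter (\<lambda>a. a \<in> I) w \<in> {u. set u \<subseteq> I \<and> (\<forall>a\<in>I. count_list u a = p)}"
    unfolding I_def by (auto simp: count_list_filter)
  have finI: "finite I" unfolding I_def by simp
  have len: "length (filter (\<lambda>a. a \<in> I) w) = p * card I"
    using mem by (intro length_uniform_word[OF finI]) auto
  have l: "length w = l" using w by (simp add: words_def)
  then show "p * card I \<le> l" using len length_filter_le[of "\<lambda>a. a \<in> I" w] by simp
  have "length (filter (\<lambda>a. a \<notin> I) w) = l - p * card I"
    using len l sum_length_filter_compl[of "\<lambda>a. a \<in> I" w] by simp
  moreover have "p + 1 \<le> count_list w a" if "a \<in> set w" "a \<notin> I" for a
  proof -
    have "p \<le> count_list w a" "count_list w a \<noteq> p" using that w unfolding words_def I_def by blast+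
    then show ?thesis by simp
  qed
  ultimately show "filter (\<lambda>a. a \<notin> I) w \<in> words (p + 1) 0 (A - I) (l - p * card I)"
    using w unfolding words_def by (auto simp: count_list_filter)
qed

text \<open>Sorting words by the number i of letters that occur exactly \<open>p\<close> times and
  deleting these letters leaves words over the other letters in which each occurs at least
  \<open>p + 1\<close> times. This is one unfolding of \<open>Y\<close>: the number of positions
  times the multinomial coefficient is \<open>l! / ((l - p i)! (p!)^i)\<close>.\<close>

lemma card_words_le_Y:
  assumes "finite A" "p \<ge> 1"
  shows "real (card (words p c A l)) \<le> Y p c l (card A)"
  using assms
proof (induction "Suc l - p" arbitrary: p c A l rule: less_induct)
  case less
  show ?case
  proof (cases "c = 0 \<and> l = 0")
    case True
    then have "words p c A l \<subseteq> {[]}" by (auto simp: words_def)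
    then have "card (words p c A l) \<le> 1" using card_mono[of "{[]}" "words p c A l"] by simp
    then show ?thesis using True by (subst Y.simps) simp
  next
    case c_l: False
    show ?thesis
    proof (cases "p > l")
      case True
      have "words p c A l = {}"
      proof (rule ccontr)
        assume "words p c A l \<noteq> {}"
        then obtain w where w: "w \<in> words p c A l" by blast
        then have "w \<noteq> []" using c_l unfolding words_def by auto
        then obtain a where "a \<in> set w" by fastforce
        then have "p \<le> count_list w a" "count_list w a \<le> length w"
          using w count_le_length[of w a] unfolding words_def by auto
        then show False using True w unfolding words_def by auto
      qed
      then show ?thesis using True c_l by (subst Y.simps) simp
    next
      case False
      define S where "S i = {w \<in> words p c A l. card {a \<in> set w. count_list w a = p} = i}" for i
      have "words p c A l \<subseteq> (\<Union>i\<in>{c..l div p}. S i)"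
      proof
        fix w assume w: "w \<in> words p c A l"
        have "card {a \<in> set w. count_list w a = p} \<le> l div p"
          using split_exact_count(3)[OF w] less.prems
          by (simp add: less_eq_div_iff_mult_less_eq mult.commute)
        then show "w \<in> (\<Union>i\<in>{c..l div p}. S i)"
          using w split_exact_count(2)[OF w] less.prems unfolding S_def by auto
      qed
      moreover have "finite (\<Union>i\<in>{c..l div p}. S i)"
        using finite_words[OF less.prems(1)] unfolding S_def by auto
      ultimately have "real (card (words p c A l)) \<le> real (card (\<Union>i\<in>{c..l div p}. S i))"
        by (intro of_nat_mono card_mono)
      also have "\<dots> \<le> (\<Sum>i=c..l div p. real (card (S i)))"
        using card_UN_le[of "{c..l div p}" S] by (metis finite_atLeastAtMost of_nat_le_iff of_nat_sum)
      also have "\<dots> \<le> (\<Sum>i=c..l div p. real (card A choose i) / (fact p) ^ i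
          * (fact l / fact (l - p * i)) * Y (p + 1) 0 (l - p * i) (card A - i))"
      proof (rule sum_mono)
        fix i assume i: "i \<in> {c..l div p}"
        then have pil: "p * i \<le> l"
          using less.prems by (simp add: less_eq_div_iff_mult_less_eq mult.commute)
        have "real (card (S i)) \<le> real (card A choose i) * real ((p * i + (l - p * i)) choose (p * i))
          * (fact (p * i) / fact p ^ i) * Y (p + 1) 0 (l - p * i) (card A - i)"
        proof (rule card_split_words_le[where
              E = "\<lambda>I. {u. set u \<subseteq> I \<and> (\<forall>a\<in>I. count_list u a = p)}" and
              F = "\<lambda>I. words (p + 1) 0 (A - I) (l - p * i)"])
          fix w assume w: "w \<in> S i"
          show "\<exists>I\<subseteq>A. card I = i \<and> filter (\<lambda>a. a \<in> I) w \<in> {u. set u \<subseteq> I \<and> (\<forall>a\<in>I. count_list u a = p)}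
            \<and> filter (\<lambda>a. a \<notin> I) w \<in> words (p + 1) 0 (A - I) (l - p * i)"
            using w split_exact_count[of w p c A l] less.prems unfolding S_def
            by (intro exI[of _ "{a \<in> set w. count_list w a = p}"]) auto
        next
          fix I assume I: "I \<subseteq> A" "card I = i"
          then have finI: "finite I" using less.prems finite_subset by blast
          let ?E = "{u. set u \<subseteq> I \<and> (\<forall>a\<in>I. count_list u a = p)}"
          have len: "length u = p * i" if "u \<in> ?E" for u
            using that I finI length_uniform_word[of I u p] by auto
          then have "?E \<subseteq> {u. set u \<subseteq> I \<and> length u = p * i}" by auto
          then have "finite ?E" using finite_lists_length_eq[OF finI] finite_subset by blast
          then show "finite ?E \<and> real (card ?E) \<le> fact (p * i) / fact p ^ i
            \<and> (\<forall>w\<in>?E. set w \<subseteq> I \<and> length w = p * i)"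
            using card_uniform_words[OF finI less.prems(2)] I len by auto
          have "card (A - I) = card A - i" using I finI by (simp add: card_Diff_subset)
          \<comment> \<open>For i = 0 the length does not shrink, so the measure decreases through
            the growth of \<open>p\<close> alone; \<open>p \<le> l\<close> keeps the truncated
            subtraction strict.\<close>
          moreover have "Suc (l - p * i) - (p + 1) < Suc l - p"
            using False by auto
          ultimately show "finite (words (p + 1) 0 (A - I) (l - p * i))
            \<and> real (card (words (p + 1) 0 (A - I) (l - p * i))) \<le> Y (p + 1) 0 (l - p * i) (card A - i)
            \<and> (\<forall>w\<in>words (p + 1) 0 (A - I) (l - p * i). set w \<inter> I = {} \<and> length w = l - p * i)"
            using less.hyps[of "l - p * i" "p + 1" "A - I" 0] less.prems finite_words[of "A - I"]
              words_disjoint[of _ "p + 1" 0 A I "l - p * i"] by auto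
        qed (use less.prems in auto)
        also have "\<dots> = real (card A choose i) / (fact p) ^ i
          * (fact l / fact (l - p * i)) * Y (p + 1) 0 (l - p * i) (card A - i)"
          using pil by (simp add: binomial_fact)
        finally show "real (card (S i)) \<le> real (card A choose i) / (fact p) ^ i
          * (fact l / fact (l - p * i)) * Y (p + 1) 0 (l - p * i) (card A - i)" .
      qed
      also have "\<dots> = Y p c l (card A)"
        using c_l False by (subst (2) Y.simps) auto
      finally show ?thesis .
    qed
  qed
qed


section \<open>Words of double letters without crossings\<close>

definition crossing :: "'a list \<Rightarrow> 'a \<Rightarrow> 'a \<Rightarrow> bool" where
  "crossing w a b \<longleftrightarrow> a \<noteq> b \<and> filter (\<lambda>c. c = a \<or> c = b) w = [a, b, a, b]"

text \<open>The list \<open>st\<close> is the stack of letters seen once so far, most recent first: a continuation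
  that creates no crossing must at each step either open a new letter or close the top of the stack.\<close>

definition noncrossing_words :: "'a list \<Rightarrow> 'a set \<Rightarrow> 'a list set" where
  "noncrossing_words st U = {w. set w \<subseteq> set st \<union> U \<and> (\<forall>a\<in>set st. count_list w a = 1)
     \<and> (\<forall>a\<in>U. count_list w a = 2) \<and> (\<forall>a b. \<not> crossing (rev st @ w) a b)}"

lemma count_list_distinct: "distinct xs \<Longrightarrow> x \<in> set xs \<Longrightarrow> count_list xs x = 1"
  by (induction xs) auto

text \<open>Closing an entry x below the top y of the stack is impossible: x was opened before y and
  y is still to be closed, so the pattern x y x y appears. As \<open>crossing\<close> compares the
  whole filtered word with \<open>[a, b, a, b]\<close>, it concerns only letters with exactly two
  occurrences.\<close>

lemma noncrossing_words_Cons: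
  assumes st: "distinct st" "set st \<inter> U = {}" and w: "x # w \<in> noncrossing_words st U"
  shows "(x \<in> U \<and> w \<in> noncrossing_words (x # st) (U - {x}))
    \<or> (st \<noteq> [] \<and> x = hd st \<and> w \<in> noncrossing_words (tl st) U)"
proof (cases "x \<in> U")
  case True
  then have "x \<notin> set st" using st by auto
  have w': "set (x # w) \<subseteq> set st \<union> U" "\<And>a. a \<in> set st \<Longrightarrow> count_list (x # w) a = 1"
    "\<And>a. a \<in> U \<Longrightarrow> count_list (x # w) a = 2" "\<And>a b. \<not> crossing (rev st @ x # w) a b"
    using w unfolding noncrossing_words_def by blast+
  have "set w \<subseteq> set (x # st) \<union> (U - {x})" using w'(1) by auto
  moreover have "count_list w a = 1" if "a \<in> set (x # st)" for a
    using that w'(2)[of a] w'(3)[OF True] \<open>x \<notin> set st\<close> by (auto split: if_splits)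
  moreover have "count_list w a = 2" if "a \<in> U - {x}" for a
    using that w'(3)[of a] by auto
  ultimately have "w \<in> noncrossing_words (x # st) (U - {x})"
    using w'(4) unfolding noncrossing_words_def by simp
  then show ?thesis using True by blast
next
  case False
  then have xst: "x \<in> set st" using w unfolding noncrossing_words_def by auto
  then obtain y st' where st': "st = y # st'" by (cases st) auto
  have w0: "x \<notin> set w" 
    using w xst unfolding noncrossing_words_def by (auto simp: count_list_0_iff[symmetric])
  have nc: "\<not> crossing (rev st @ x # w) a b" for a b
    using w unfolding noncrossing_words_def by blast
  have once: "filter (\<lambda>c. c = a) zs = [a]" if "count_list zs a = 1" for a and zs :: "'a list"
    using that by (induction zs) (auto split: if_splits simp: count_list_0_iff filter_empty_conv)
  have "x = y"
  proof (rule ccontr)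
    assume "x \<noteq> y"
    then have "x \<in> set st'" using xst st' by auto
    have "filter (\<lambda>c. c = x \<or> c = y) w = filter (\<lambda>c. c = y) w"
      using w0 by (auto intro!: filter_cong)
    moreover have "count_list w y = 1"
      using w st' \<open>x \<noteq> y\<close> unfolding noncrossing_words_def by auto
    moreover have "filter (\<lambda>c. c = x \<or> c = y) (rev st') = filter (\<lambda>c. c = x) (rev st')"
      using st st' by (auto intro!: filter_cong)
    moreover have "count_list (rev st') x = 1"
      using st st' \<open>x \<in> set st'\<close> by (simp add: count_list_distinct)
    ultimately have "crossing (rev st @ x # w) x y"
      using \<open>x \<noteq> y\<close> once[of w y] once[of "rev st'" x] unfolding crossing_def st' by simp
    then show False using nc by blast
  qed
  \<comment> \<open>Both copies of the closed letter are gone from this word. A crossing in it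
    avoids that letter, so it would already be a crossing of the longer word.\<close>
  have "\<not> crossing (rev st' @ w) a b" for a b
  proof
    assume cr: "crossing (rev st' @ w) a b"
    have y: "y \<notin> set (rev st' @ w)" using w0 \<open>x = y\<close> st st' by auto
    have "{a, b} \<subseteq> set (filter (\<lambda>c. c = a \<or> c = b) (rev st' @ w))"
      using cr unfolding crossing_def by simp
    then have "y \<noteq> a" "y \<noteq> b" using y by auto
    then have "crossing (rev st @ x # w) a b"
      using cr \<open>x = y\<close> unfolding crossing_def st' by simp
    then show False using nc by blast
  qed
  moreover have "set w \<subseteq> set st' \<union> U"
    using w w0 \<open>x = y\<close> unfolding noncrossing_words_def st' by auto
  moreover have "\<forall>a\<in>set st'. count_list w a = 1" "\<forall>a\<in>U. count_list w a = 2"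
    using w w0 \<open>x = y\<close> st False unfolding noncrossing_words_def st' by (auto split: if_splits)
  ultimately have "w \<in> noncrossing_words st' U" unfolding noncrossing_words_def by blast
  then show ?thesis using st' \<open>x = y\<close> by simp
qed

lemma length_noncrossing_words:
  assumes "finite U" "distinct st" "set st \<inter> U = {}" "w \<in> noncrossing_words st U"
  shows "length w = length st + 2 * card U"
proof -
  have "length w = (\<Sum>a\<in>set st \<union> U. count_list w a)"
    using assms by (intro length_eq_sum_count_list) (auto simp: noncrossing_words_def)
  also have "\<dots> = (\<Sum>a\<in>set st. count_list w a) + (\<Sum>a\<in>U. count_list w a)"
    using assms by (intro sum.union_disjoint) auto
  also have "\<dots> = length st + 2 * card U"
    using assms by (simp add: noncrossing_words_def distinct_card)
  finally show ?thesis .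
qed

lemma finite_noncrossing_words:
  assumes "finite U" "distinct st" "set st \<inter> U = {}"
  shows "finite (noncrossing_words st U)"
  by (rule finite_subset[OF _ finite_lists_length_eq[of "set st \<union> U" "length st + 2 * card U"]])
    (use assms length_noncrossing_words in \<open>auto simp: noncrossing_words_def\<close>)

text \<open>The bound is the number of ways to complete a ballot sequence of height \<open>h\<close> with \<open>a\<close> more
  up-steps, times the \<open>a!\<close> orders in which the new letters are opened.\<close>

lemma card_noncrossing_words_stack:
  assumes "finite U" "distinct st" "set st \<inter> U = {}"
  shows "real (card (noncrossing_words st U))
    \<le> real (length st + 1) * fact (length st + 2 * card U) / fact (length st + card U + 1)"
  using assms
proof (induction "length st + 2 * card U" arbitrary: st U)
  case 0
  then have "noncrossing_words st U \<subseteq> {[]}" using length_noncrossing_words[of U st] by fastforce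
  then have "card (noncrossing_words st U) \<le> 1"
    using card_mono[of "{[]}" "noncrossing_words st U"] by simp
  then show ?case using 0 by simp
next
  case (Suc L)
  define h where "h = length st"
  define a where "a = card U"
  \<comment> \<open>In closed form, \<open>a!\<close> times the ballot number
    \<open>(h+1)/(h+a+1)\<close> times \<open>binomial(h+2a, a)\<close>; at h = 0 the ballot number
    is the Catalan number of \<open>a\<close>.\<close>
  let ?N = "\<lambda>h a. real (h + 1) * fact (h + 2 * a) / fact (h + a + 1)"
  define S1 where "S1 = (\<Union>x\<in>U. (#) x ` noncrossing_words (x # st) (U - {x}))"
  define S2 where "S2 = (if st = [] then {} else (#) (hd st) ` noncrossing_words (tl st) U)"
  have fin1: "finite (noncrossing_words (x # st) (U - {x}))" if "x \<in> U" for x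
    using Suc.prems that by (intro finite_noncrossing_words) auto
  have tl: "distinct (tl st)" "set (tl st) \<inter> U = {}"
    using Suc.prems by (cases st; auto)+
  have fin2: "finite (noncrossing_words (tl st) U)"
    using Suc.prems tl by (intro finite_noncrossing_words)
  have "noncrossing_words st U \<subseteq> S1 \<union> S2"
  proof
    fix w assume w: "w \<in> noncrossing_words st U"
    have "length w = Suc L" using length_noncrossing_words[OF Suc.prems w] Suc.hyps(2) by simp
    then obtain x v where xv: "w = x # v" by (cases w) auto
    show "w \<in> S1 \<union> S2"
      using noncrossing_words_Cons[OF Suc.prems(2,3), of x v] w unfolding S1_def S2_def xv by auto
  qed
  then have "card (noncrossing_words st U) \<le> card (S1 \<union> S2)"
    using Suc.prems(1) fin1 fin2 by (intro card_mono) (auto simp: S1_def S2_def)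
  also have "\<dots> \<le> card S1 + card S2" by (rule card_Un_le)
  finally have le: "real (card (noncrossing_words st U)) \<le> real (card S1) + real (card S2)"
    by (simp flip: of_nat_add)
  have "card S1 \<le> (\<Sum>x\<in>U. card ((#) x ` noncrossing_words (x # st) (U - {x})))"
    unfolding S1_def by (rule card_UN_le[OF Suc.prems(1)])
  then have "real (card S1) \<le> (\<Sum>x\<in>U. real (card ((#) x ` noncrossing_words (x # st) (U - {x}))))"
    by (simp flip: of_nat_sum)
  also have "\<dots> \<le> (\<Sum>x\<in>U. ?N (h + 1) (a - 1))"
  proof (rule sum_mono)
    fix x assume x: "x \<in> U"
    then have a: "a \<ge> 1" "card (U - {x}) = a - 1"
      using Suc.prems(1) unfolding a_def by (auto simp: Suc_le_eq card_gt_0_iff)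
    have "real (card ((#) x ` noncrossing_words (x # st) (U - {x})))
        = real (card (noncrossing_words (x # st) (U - {x})))"
      by (simp add: card_image)
    also have "\<dots> \<le> ?N (length (x # st)) (card (U - {x}))"
      using Suc.prems Suc.hyps(2) x a by (intro Suc.hyps(1)) (auto simp: a_def)
    finally show "real (card ((#) x ` noncrossing_words (x # st) (U - {x}))) \<le> ?N (h + 1) (a - 1)"
      using a by (simp add: h_def)
  qed
  finally have S1: "real (card S1) \<le> real a * ?N (h + 1) (a - 1)"
    unfolding a_def by simp
  have S2: "real (card S2) \<le> (if h = 0 then 0 else ?N (h - 1) a)"
  proof (cases "st = []")
    case True
    then show ?thesis by (simp add: S2_def h_def)
  next
    case False
    then have "real (card S2) = real (card (noncrossing_words (tl st) U))"
      by (simp add: S2_def card_image)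
    also have "\<dots> \<le> ?N (length (tl st)) (card U)"
      using Suc.prems(1) Suc.hyps(2) tl False by (intro Suc.hyps(1)) (auto simp: Suc_le_eq)
    finally show ?thesis using False by (simp add: h_def a_def)
  qed
  have ha: "h + 2 * a > 0" using Suc.hyps(2) unfolding h_def a_def by linarith
  \<comment> \<open>The factor common to the three terms of the ballot recurrence: dividing N(h,a) =
    a N(h+1,a-1) + N(h-1,a) by it leaves (h+1)(h+2a) = a(h+2) + h(h+a+1). At the boundaries a = 0
    and h = 0, where the subtractions are truncated, the factors \<open>real a\<close> and
    \<open>real h\<close> vanish.\<close>
  define F :: real where "F = fact (h + 2 * a - 1) / fact (h + a + 1)"
  have 1: "real a * ?N (h + 1) (a - 1) = real a * real (h + 2) * F"
  proof (cases "a = 0")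
    case False
    then have "h + 1 + 2 * (a - 1) = h + 2 * a - 1" "h + 1 + (a - 1) + 1 = h + a + 1" by auto
    then show ?thesis unfolding F_def by simp
  qed simp
  have 2: "(if h = 0 then 0 else ?N (h - 1) a) = real h * real (h + a + 1) * F"
  proof (cases "h = 0")
    case False
    then have e: "h - 1 + 2 * a = h + 2 * a - 1" "h - 1 + a + 1 = h + a" by auto
    define q where "q = real (h + a + 1)"
    have q: "q \<noteq> 0" "real h * q = q * real h" by (simp_all add: q_def)
    have F: "F = fact (h + 2 * a - 1) / (q * fact (h + a))" unfolding F_def q_def by simp
    have "?N (h - 1) a = real h * fact (h + 2 * a - 1) / fact (h + a)" unfolding e using False by simp
    also have "\<dots> = real h * q * F" unfolding F q(2) using q(1) by simp
    finally show ?thesis using False by (simp add: q_def)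
  qed simp
  have 3: "?N h a = real (h + 1) * real (h + 2 * a) * F"
    unfolding F_def using ha by (simp add: fact_reduce[of "h + 2 * a"])
  have "real a * real (h + 2) * F + real h * real (h + a + 1) * F = ?N h a"
    unfolding 3 by (simp add: algebra_simps)
  then show ?case using le S1 S2 1 2 unfolding h_def a_def by linarith
qed

lemma card_noncrossing_words:
  assumes "finite U"
  shows "real (card (noncrossing_words [] U)) \<le> fact (2 * card U) / fact (card U + 1)"
  using card_noncrossing_words_stack[of U "[]"] assms by simp

section \<open>Expected fixed points of words in random permutations\<close>

text \<open>The notation \<open>inv\<close> is taken here by HOL-Algebra.\<close>

abbreviation perminv :: "('v \<Rightarrow> 'v) \<Rightarrow> 'v \<Rightarrow> 'v" where
  "perminv p \<equiv> inv_into UNIV p"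

lemma card_le_sum_cover:
  assumes "finite I" "\<And>i. i \<in> I \<Longrightarrow> finite (T i)" "S \<subseteq> (\<Union>i\<in>I. T i)"
  shows "real (card S) \<le> (\<Sum>i\<in>I. real (card (T i)))"
proof -
  have "card S \<le> card (\<Union>i\<in>I. T i)" using assms by (intro card_mono) auto
  also have "\<dots> \<le> (\<Sum>i\<in>I. card (T i))" by (rule card_UN_le[OF assms(1)])
  finally show ?thesis by (simp flip: of_nat_sum)
qed

lemma card_le_card_plus:
  assumes "finite S" "finite T" "R \<subseteq> S \<union> T" "real (card S) \<le> x" "real (card T) \<le> y"
  shows "real (card R) \<le> x + y"
proof -
  have "card R \<le> card (S \<union> T)" using assms by (intro card_mono) auto
  also have "\<dots> \<le> card S + card T" by (rule card_Un_le)
  finally have "real (card R) \<le> real (card S) + real (card T)" by (simp flip: of_nat_add)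
  then show ?thesis using assms by simp
qed

lemma sum_card_swap:
  assumes "finite G" "finite X"
  shows "(\<Sum>g\<in>G. real (card {x \<in> X. P g x})) = (\<Sum>x\<in>X. real (card {g \<in> G. P g x}))"
proof -
  have "(\<Sum>g\<in>G. real (card {x \<in> X. P g x})) = (\<Sum>g\<in>G. \<Sum>x\<in>X. if P g x then 1 else 0)"
    using assms by (simp add: sum.If_cases Int_def conj_commute)
  also have "\<dots> = (\<Sum>x\<in>X. \<Sum>g\<in>G. if P g x then 1 else 0)" by (rule sum.swap)
  also have "\<dots> = (\<Sum>x\<in>X. real (card {g \<in> G. P g x}))"
    using assms by (simp add: sum.If_cases Int_def conj_commute)
  finally show ?thesis .
qed

text \<open>The three counting axioms say that a random \<open>g\<close> maps a linearly independent tuple of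
  at most three vectors to a given tuple with at most the probability found in the general linear
  group over the field with two elements; \<open>X\<close> stands for the set of nonzero vectors.\<close>

locale sampler =
  fixes X :: "'v set" and add :: "'v \<Rightarrow> 'v \<Rightarrow> 'v" and G :: "'g set" and \<pi> :: "'g \<Rightarrow> 'v \<Rightarrow> 'v"
  assumes finX: "finite X" and finG: "finite G" and G_nonempty: "G \<noteq> {}" and cardX: "card X \<ge> 3"
    and perm: "g \<in> G \<Longrightarrow> \<pi> g permutes X"
    and add_closed: "x \<in> X \<Longrightarrow> y \<in> X \<Longrightarrow> x \<noteq> y \<Longrightarrow> add x y \<in> X"
    and add_cancel: "x \<in> X \<Longrightarrow> y \<in> X \<Longrightarrow> x \<noteq> y \<Longrightarrow> add x (add x y) = y"
    and add_hom: "g \<in> G \<Longrightarrow> x \<in> X \<Longrightarrow> y \<in> X \<Longrightarrow> x \<noteq> y \<Longrightarrow> \<pi> g (add x y) = add (\<pi> g x) (\<pi> g y)"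
    and one_point: "a \<in> X \<Longrightarrow> b \<in> X \<Longrightarrow>
      real (card {g \<in> G. \<pi> g a = b}) \<le> real (card G) / real (card X)"
    and two_points: "a \<in> X \<Longrightarrow> a' \<in> X \<Longrightarrow> a \<noteq> a' \<Longrightarrow> b \<in> X \<Longrightarrow> b' \<in> X \<Longrightarrow>
      real (card {g \<in> G. \<pi> g a = b \<and> \<pi> g a' = b'})
        \<le> real (card G) / (real (card X) * (real (card X) - 1))"
    and three_points: "a \<in> X \<Longrightarrow> a' \<in> X \<Longrightarrow> a \<noteq> a' \<Longrightarrow> a'' \<in> X \<Longrightarrow> a'' \<notin> {a, a', add a a'} \<Longrightarrow>
      b \<in> X \<Longrightarrow> b' \<in> X \<Longrightarrow> b'' \<in> X \<Longrightarrow>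
      real (card {g \<in> G. \<pi> g a = b \<and> \<pi> g a' = b' \<and> \<pi> g a'' = b''})
        \<le> real (card G) / (real (card X) * (real (card X) - 1) * (real (card X) - 3))"
begin

abbreviation n :: real where "n \<equiv> real (card X)"
abbreviation N :: real where "N \<equiv> real (card G)"

definition fixc :: "('v \<Rightarrow> 'v) \<Rightarrow> real" where "fixc f = real (card {x \<in> X. f x = x})"

lemma n3: "n \<ge> 3" using cardX by simp

lemma in_X [simp]: "p permutes X \<Longrightarrow> x \<in> X \<Longrightarrow> p x \<in> X"
  by (simp add: permutes_in_image)

lemma inv_perm [simp]: "p permutes X \<Longrightarrow> perminv p permutes X"
  by (rule permutes_inv)

lemma inv_iff: "p permutes X \<Longrightarrow> perminv p x = y \<longleftrightarrow> x = p y"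
  by (metis permutes_inverses)

lemma pi_in [simp]: "g \<in> G \<Longrightarrow> x \<in> X \<Longrightarrow> \<pi> g x \<in> X"
  using perm by simp

lemma pi_inj: "g \<in> G \<Longrightarrow> \<pi> g x = \<pi> g y \<longleftrightarrow> x = y"
  using perm permutes_inj by (metis injD)

lemma pi_inv_iff: "g \<in> G \<Longrightarrow> perminv (\<pi> g) x = y \<longleftrightarrow> \<pi> g y = x"
  using inv_iff[OF perm] by metis

text \<open>That the inverse of g sends a to b means that g sends b to a, so the axioms carry over
  with sources and targets exchanged. The independence required of the sources now holds for the
  targets of g; if the new sources are dependent, the event is empty because g is injective and
  additive.\<close>

lemma sampler_inverse: "sampler X add G (\<lambda>g. perminv (\<pi> g))"
proof unfold_locales
  fix g x y assume g: "g \<in> G" and xy: "x \<in> X" "y \<in> X" "x \<noteq> y"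
  define x' where "x' = perminv (\<pi> g) x"
  define y' where "y' = perminv (\<pi> g) y"
  have "x' \<in> X" "y' \<in> X" "\<pi> g x' = x" "\<pi> g y' = y"
    using xy perm[OF g] by (auto simp: x'_def y'_def permutes_inverses)
  moreover from this have "x' \<noteq> y'" using xy by auto
  ultimately have "\<pi> g (add x' y') = add x y" using add_hom[OF g, of x' y'] by simp
  then show "perminv (\<pi> g) (add x y) = add (perminv (\<pi> g) x) (perminv (\<pi> g) y)"
    using perm[OF g] by (simp add: inv_iff x'_def y'_def)
next
  fix a b assume ab: "a \<in> X" "b \<in> X"
  have "{g \<in> G. perminv (\<pi> g) a = b} = {g \<in> G. \<pi> g b = a}" by (rule Collect_cong) (use pi_inv_iff in blast)
  then show "real (card {g \<in> G. perminv (\<pi> g) a = b}) \<le> N / n" using one_point[of b a] ab by simp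
next
  fix a a' b b' assume *: "a \<in> X" "a' \<in> X" "a \<noteq> a'" "b \<in> X" "b' \<in> X"
  have e: "{g \<in> G. perminv (\<pi> g) a = b \<and> perminv (\<pi> g) a' = b'} = {g \<in> G. \<pi> g b = a \<and> \<pi> g b' = a'}"
    by (rule Collect_cong) (use pi_inv_iff in blast)
  show "real (card {g \<in> G. perminv (\<pi> g) a = b \<and> perminv (\<pi> g) a' = b'}) \<le> N / (n * (n - 1))"
  proof (cases "b = b'")
    case True
    then have "{g \<in> G. \<pi> g b = a \<and> \<pi> g b' = a'} = {}" using * by blast
    then show ?thesis unfolding e using n3 by (simp only: card.empty) simp
  next
    case False
    then show ?thesis unfolding e using * by (intro two_points)
  qed
next
  fix a a' a'' b b' b'' assume *: "a \<in> X" "a' \<in> X" "a \<noteq> a'" "a'' \<in> X" "a'' \<notin> {a, a', add a a'}"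
    "b \<in> X" "b' \<in> X" "b'' \<in> X"
  have e: "{g \<in> G. perminv (\<pi> g) a = b \<and> perminv (\<pi> g) a' = b' \<and> perminv (\<pi> g) a'' = b''}
      = {g \<in> G. \<pi> g b = a \<and> \<pi> g b' = a' \<and> \<pi> g b'' = a''}"
    by (rule Collect_cong) (use pi_inv_iff in blast)
  show "real (card {g \<in> G. perminv (\<pi> g) a = b \<and> perminv (\<pi> g) a' = b' \<and> perminv (\<pi> g) a'' = b''})
    \<le> N / (n * (n - 1) * (n - 3))"
  proof (cases "b = b' \<or> b'' \<in> {b, b', add b b'}")
    case True
    then have "{g \<in> G. \<pi> g b = a \<and> \<pi> g b' = a' \<and> \<pi> g b'' = a''} = {}"
      using * add_hom[of _ b b'] by auto
    then show ?thesis unfolding e using n3 by (simp only: card.empty) simp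
  next
    case False
    then show ?thesis unfolding e using * by (intro three_points) auto
  qed
qed (use finX finG G_nonempty cardX perm add_closed add_cancel in auto)

section \<open>Expected fixed points with one or two random generators and fixed gaps\<close>

lemma sum_fixc_one:
  assumes u: "u permutes X"
  shows "(\<Sum>g\<in>G. fixc (\<pi> g \<circ> u)) \<le> N"
proof -
  have "(\<Sum>g\<in>G. fixc (\<pi> g \<circ> u)) = (\<Sum>x\<in>X. real (card {g \<in> G. \<pi> g (u x) = x}))"
    unfolding fixc_def o_def by (rule sum_card_swap[OF finG finX])
  also have "\<dots> \<le> (\<Sum>x\<in>X. N / n)" by (intro sum_mono one_point) (use u in auto)
  also have "\<dots> = N" using n3 by auto
  finally show ?thesis .
qed

lemma card_remove_X: "x \<in> X \<Longrightarrow> real (card (X - {x})) = n - 1"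
  using finX cardX by (simp add: card_Diff_singleton)

text \<open>The value p of \<open>\<pi> g a\<close> is revealed first. If \<open>u p = a\<close>,
  the second query repeats the first and only the one-point bound N/n is available. Otherwise the
  images of two distinct points are prescribed, and the n - 1 remaining values of p contribute
  N/(n(n-1)) each.\<close>

lemma two_same_bound:
  assumes u: "u permutes X" and a: "a \<in> X" and x: "x \<in> X"
  shows "real (card {g \<in> G. \<pi> g (u (\<pi> g a)) = x}) \<le> 2 * N / n"
proof -
  define p0 where "p0 = perminv u a"
  have p0: "p0 \<in> X" "u p0 = a" using u a by (auto simp: p0_def permutes_inverses)
  define T where "T p = {g \<in> G. \<pi> g a = p \<and> \<pi> g (u p) = x}" for p
  have finT: "finite (T p)" for p unfolding T_def using finG by simp
  have "real (card (\<Union>p\<in>X - {p0}. T p)) \<le> (\<Sum>p\<in>X - {p0}. real (card (T p)))"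
    using finX finT by (intro card_le_sum_cover) auto
  also have "\<dots> \<le> (\<Sum>p\<in>X - {p0}. N / (n * (n - 1)))"
  proof (rule sum_mono)
    fix p assume p: "p \<in> X - {p0}"
    then have "a \<noteq> u p" using u by (auto simp: p0_def permutes_inverses)
    then show "real (card (T p)) \<le> N / (n * (n - 1))"
      unfolding T_def using p u a x by (intro two_points) auto
  qed
  also have "\<dots> = N / n" using p0 n3 by (simp add: card_remove_X)
  finally have 1: "real (card (\<Union>p\<in>X - {p0}. T p)) \<le> N / n" .
  have "real (card {g \<in> G. \<pi> g (u (\<pi> g a)) = x}) \<le> N / n + N / n"
  proof (rule card_le_card_plus[OF _ _ _ one_point[OF a p0(1)] 1])
    show "{g \<in> G. \<pi> g (u (\<pi> g a)) = x} \<subseteq> {g \<in> G. \<pi> g a = p0} \<union> (\<Union>p\<in>X - {p0}. T p)"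
      using a unfolding T_def by auto
  qed (use finG finX finT in auto)
  then show ?thesis by simp
qed

lemma sum_fixc_two_same:
  assumes u: "u permutes X" and v: "v permutes X"
  shows "(\<Sum>g\<in>G. fixc (\<pi> g \<circ> u \<circ> \<pi> g \<circ> v)) \<le> 2 * N"
proof -
  have "(\<Sum>g\<in>G. fixc (\<pi> g \<circ> u \<circ> \<pi> g \<circ> v)) = (\<Sum>x\<in>X. real (card {g \<in> G. \<pi> g (u (\<pi> g (v x))) = x}))"
    unfolding fixc_def o_def by (rule sum_card_swap[OF finG finX])
  also have "\<dots> \<le> (\<Sum>x\<in>X. 2 * N / n)" by (intro sum_mono two_same_bound) (use u v in auto)
  also have "\<dots> = 2 * N" using n3 by auto
  finally show ?thesis .
qed

text \<open>The queries are made in the order a, v p, u q, where p and q are the first two answers.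
  In \<open>S1\<close> the second query repeats the first. In \<open>S2\<close>, \<open>S3\<close>
  and \<open>S4\<close> the third query equals a, v p or their sum, so its answer p, q or
  \<open>add p q\<close> is forced, and equating it with x removes one degree of freedom.
  \<open>S5\<close> is the independent case.\<close>

lemma three_same_bound:
  assumes u: "u permutes X" and v: "v permutes X" and a: "a \<in> X" and x: "x \<in> X" and n6: "n \<ge> 6"
  shows "real (card {g \<in> G. \<pi> g (u (\<pi> g (v (\<pi> g a)))) = x}) \<le> 5 * N / n"
proof -
  define p0 where "p0 = perminv v a"
  have p0: "p0 \<in> X" "v p0 = a" using v a by (auto simp: p0_def permutes_inverses)
  have p0_iff: "v p = a \<longleftrightarrow> p = p0" for p using v by (auto simp: p0_def permutes_inverses)
  define q0 where "q0 = perminv u a"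
  have q0: "q0 \<in> X" "u q0 = a" using u a by (auto simp: q0_def permutes_inverses)
  define r0 where "r0 = perminv v (u x)"
  have r0: "r0 \<in> X" "v r0 = u x" using u v x by (auto simp: r0_def permutes_inverses)
  define S1 where "S1 = {g \<in> G. \<pi> g a = p0}"
  define S2 where "S2 = {g \<in> G. v x \<noteq> a \<and> \<pi> g a = x \<and> \<pi> g (v x) = q0}"
  define S3 where "S3 = {g \<in> G. u x \<noteq> a \<and> \<pi> g a = r0 \<and> \<pi> g (u x) = x}"
  define S4 where "S4 p = {g \<in> G. p \<noteq> x \<and> \<pi> g a = p \<and> \<pi> g (v p) = add p x}" for p
  define S5 where "S5 p q = {g \<in> G. u q \<notin> {a, v p, add a (v p)} \<and> \<pi> g a = p \<and> \<pi> g (v p) = q \<and> \<pi> g (u q) = x}" for p q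
  let ?S4 = "\<Union>p\<in>X - {p0}. S4 p"
  let ?S5 = "\<Union>(p,q)\<in>(X - {p0}) \<times> X. S5 p q"
  have N0: "N \<ge> 0" by simp
  have n0: "n > 0" "n - 1 > 0" "n - 3 > 0" using n6 by auto
  have b1: "real (card S1) \<le> N / n" unfolding S1_def using a p0 by (intro one_point)
  have b2: "real (card S2) \<le> N / (n * (n - 1))"
  proof (cases "v x = a")
    case False
    then show ?thesis unfolding S2_def using two_points[of a "v x" x q0] a x v q0 by simp
  qed (use n0 in \<open>simp add: S2_def\<close>)
  have b3: "real (card S3) \<le> N / (n * (n - 1))"
  proof (cases "u x = a")
    case False
    then show ?thesis unfolding S3_def using two_points[of a "u x" r0 x] a x u r0 by simp
  qed (use n0 in \<open>simp add: S3_def\<close>)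
  have "real (card ?S4) \<le> (\<Sum>p\<in>X - {p0}. real (card (S4 p)))"
    using finX finG by (intro card_le_sum_cover) (auto simp: S4_def)
  also have "\<dots> \<le> (\<Sum>p\<in>X - {p0}. N / (n * (n - 1)))"
  proof (rule sum_mono)
    fix p assume p: "p \<in> X - {p0}"
    show "real (card (S4 p)) \<le> N / (n * (n - 1))"
    proof (cases "p = x")
      case False
      then show ?thesis unfolding S4_def
        using two_points[of a "v p" p "add p x"] p a x v add_closed[of p x] p0_iff[of p] by auto
    qed (use n0 in \<open>simp add: S4_def\<close>)
  qed
  also have "\<dots> = N / n" using p0 n0 by (simp add: card_remove_X)
  finally have b4: "real (card ?S4) \<le> N / n" .
  have "real (card ?S5) \<le> (\<Sum>(p,q)\<in>(X - {p0}) \<times> X. real (card (S5 p q)))"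
    unfolding split_def using finX finG by (intro card_le_sum_cover) (auto simp: S5_def)
  also have "\<dots> \<le> (\<Sum>(p,q)\<in>(X - {p0}) \<times> X. N / (n * (n - 1) * (n - 3)))"
    unfolding split_def
  proof (rule sum_mono)
    fix pq assume pq: "pq \<in> (X - {p0}) \<times> X"
    obtain p q where pq': "pq = (p, q)" by force
    show "real (card (S5 (fst pq) (snd pq))) \<le> N / (n * (n - 1) * (n - 3))"
    proof (cases "u q \<in> {a, v p, add a (v p)}")
      case False
      have "a \<noteq> v p" using pq p0_iff[of p] by (auto simp: pq')
      then show ?thesis unfolding S5_def pq'
        using three_points[of a "v p" "u q" p q x] pq a x v u False by (auto simp: pq')
    qed (use n0 in \<open>simp add: S5_def pq'\<close>)
  qed
  also have "\<dots> = N / (n - 3)" using p0 n0 by (simp add: card_cartesian_product card_remove_X)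
  finally have b5: "real (card ?S5) \<le> N / (n - 3)" .
  have fin: "finite S1" "finite S2" "finite S3" "finite ?S4" "finite ?S5"
    using finG finX by (auto simp: S1_def S2_def S3_def S4_def S5_def)
  have "{g \<in> G. \<pi> g (u (\<pi> g (v (\<pi> g a)))) = x} \<subseteq> S1 \<union> (S2 \<union> (S3 \<union> (?S4 \<union> ?S5)))"
  proof
    fix g assume "g \<in> {g \<in> G. \<pi> g (u (\<pi> g (v (\<pi> g a)))) = x}"
    then have g: "g \<in> G" and gx: "\<pi> g (u (\<pi> g (v (\<pi> g a)))) = x" by auto
    define p where "p = \<pi> g a"
    define q where "q = \<pi> g (v p)"
    have pq: "p \<in> X" "q \<in> X" using g a v by (auto simp: p_def q_def)
    have gx: "\<pi> g (u q) = x" using gx by (simp add: p_def q_def)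
    show "g \<in> S1 \<union> (S2 \<union> (S3 \<union> (?S4 \<union> ?S5)))"
    proof (cases "p = p0")
      case True
      then show ?thesis using g by (simp add: S1_def p_def)
    next
      case False
      then have vp: "v p \<noteq> a" by (simp add: p0_iff)
      consider "u q = a" | "u q = v p" | "u q = add a (v p)" "u q \<noteq> a"
        | "u q \<notin> {a, v p, add a (v p)}" by blast
      then show ?thesis
      proof cases
        case 1
        then have "p = x" "q = q0" using gx u by (auto simp: p_def q0_def permutes_inverses)
        then have "g \<in> S2" using g vp by (simp add: S2_def p_def q_def)
        then show ?thesis by blast
      next
        case 2
        then have "q = x" using gx by (simp add: q_def)
        then have "p = r0" using 2 inv_iff[OF v, of "u x" p] by (simp add: r0_def)
        then have "g \<in> S3" using g vp gx 2 \<open>q = x\<close> by (simp add: S3_def p_def)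
        then show ?thesis by blast
      next
        case 3
        then have "x = add p q"
          using gx add_hom[OF g a, of "v p"] vp pq v by (simp add: p_def q_def)
        moreover have "p \<noteq> q" using vp pi_inj[OF g, of a "v p"] by (simp add: p_def q_def)
        ultimately have "q = add p x" using add_cancel[of p q] pq by simp
        moreover have "p \<noteq> x"
        proof
          assume "p = x"
          then have "u q = a" using gx pi_inj[OF g, of "u q" a] by (simp add: p_def)
          then show False using 3 by simp
        qed
        ultimately have "g \<in> S4 p" using g by (simp add: S4_def p_def q_def)
        then show ?thesis using False pq by blast
      next
        case 4
        then have "g \<in> S5 p q" using g gx by (simp add: S5_def p_def q_def)
        then show ?thesis using False pq by blast
      qed
    qed
  qed
  then have "real (card {g \<in> G. \<pi> g (u (\<pi> g (v (\<pi> g a)))) = x})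
      \<le> N / n + (N / (n * (n - 1)) + (N / (n * (n - 1)) + (N / n + N / (n - 3))))"
    using fin b1 b2 b3 b4 b5
    by (intro card_le_card_plus[of S1 "S2 \<union> (S3 \<union> (?S4 \<union> ?S5))"]
        card_le_card_plus[of S2 "S3 \<union> (?S4 \<union> ?S5)"] card_le_card_plus[of S3 "?S4 \<union> ?S5"]
        card_le_card_plus[of ?S4 ?S5]) simp_all
  also have "\<dots> \<le> 5 * N / n"
  proof -
    \<comment> \<open>In units of N/n the five terms are at most 1, 1/2, 1/2, 1 and 2. The last one
      is n/(n-3), for which n must be at least 6.\<close>
    have "N / (n * (n - 1)) \<le> (N / n) / 2"
      using n6 N0 by (simp add: field_simps mult_left_mono)
    moreover have "N / (n - 3) \<le> 2 * (N / n)"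
      using n6 N0 by (simp add: field_simps mult_left_mono)
    ultimately show ?thesis by simp
  qed
  finally show ?thesis .
qed

text \<open>With the inverse letter moved to the other side, a and v a are the first two queries and
  neither depends on an answer. If v a = a, two distinct queries remain outside one exceptional
  answer, at a cost of 2N/n. Otherwise the third query u q lies in the span of the first two only
  for three values of the answer q, each costing at most N/n; with n/(n-3) at most 2 for the
  independent case the total is again 5N/n.\<close>

lemma three_mixed_bound:
  assumes u: "u permutes X" and v: "v permutes X" and w: "w permutes X" and a: "a \<in> X" and n6: "n \<ge> 6"
  shows "real (card {g \<in> G. \<pi> g (u (\<pi> g (v a))) = w (\<pi> g a)}) \<le> 5 * N / n"
proof -
  have N0: "N \<ge> 0" by simp
  have n0: "n > 0" "n - 1 > 0" "n - 3 > 0" using n6 by auto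
  have inv_u: "perminv u y \<in> X" "u (perminv u y) = y" if "y \<in> X" for y
    using that u by (auto simp: permutes_inverses)
  let ?S = "{g \<in> G. \<pi> g (u (\<pi> g (v a))) = w (\<pi> g a)}"
  show ?thesis
  proof (cases "v a = a")
    case True
    define p0 where "p0 = perminv u a"
    define T where "T p = {g \<in> G. \<pi> g a = p \<and> \<pi> g (u p) = w p}" for p
    have "real (card (\<Union>p\<in>X - {p0}. T p)) \<le> (\<Sum>p\<in>X - {p0}. real (card (T p)))"
      using finX finG by (intro card_le_sum_cover) (auto simp: T_def)
    also have "\<dots> \<le> (\<Sum>p\<in>X - {p0}. N / (n * (n - 1)))"
    proof (rule sum_mono)
      fix p assume p: "p \<in> X - {p0}"
      then have "a \<noteq> u p" using u by (auto simp: p0_def permutes_inverses)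
      then show "real (card (T p)) \<le> N / (n * (n - 1))"
        unfolding T_def using p u w a by (intro two_points) auto
    qed
    also have "\<dots> = N / n" using inv_u[OF a] n0 by (simp add: card_remove_X p0_def)
    finally have 1: "real (card (\<Union>p\<in>X - {p0}. T p)) \<le> N / n" .
    have "real (card ?S) \<le> N / n + N / n"
    proof (rule card_le_card_plus[OF _ _ _ one_point[OF a, of p0] 1])
      show "?S \<subseteq> {g \<in> G. \<pi> g a = p0} \<union> (\<Union>p\<in>X - {p0}. T p)"
        using a True unfolding T_def by auto
    qed (use finG finX inv_u[OF a] in \<open>auto simp: T_def p0_def\<close>)
    also have "\<dots> \<le> 5 * N / n" using N0 n0 by (simp add: field_simps)
    finally show ?thesis .
  next
    case False
    define b where "b = v a"
    have b: "b \<in> X" "a \<noteq> b" using False a v by (auto simp: b_def)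
    define c where "c = add a b"
    have c: "c \<in> X" using add_closed a b by (simp add: c_def)
    define S where "S y = {g \<in> G. \<pi> g b = perminv u y}" for y
    have bS: "finite (S y)" "real (card (S y)) \<le> N / n" if "y \<in> X" for y
      using one_point[of b "perminv u y"] b inv_u that finG by (auto simp: S_def)
    define T where "T p q = {g \<in> G. u q \<notin> {a, b, c} \<and> \<pi> g a = p \<and> \<pi> g b = q \<and> \<pi> g (u q) = w p}" for p q
    let ?I = "SIGMA p:X. X - {p}"
    let ?T = "\<Union>(p,q)\<in>?I. T p q"
    have "real (card ?T) \<le> (\<Sum>(p,q)\<in>?I. real (card (T p q)))"
      unfolding split_def using finX finG by (intro card_le_sum_cover) (auto simp: T_def)
    also have "\<dots> \<le> (\<Sum>(p,q)\<in>?I. N / (n * (n - 1) * (n - 3)))"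
      unfolding split_def
    proof (rule sum_mono)
      fix pq assume pq: "pq \<in> ?I"
      obtain p q where pq': "pq = (p, q)" by force
      show "real (card (T (fst pq) (snd pq))) \<le> N / (n * (n - 1) * (n - 3))"
      proof (cases "u q \<in> {a, b, c}")
        case False
        then show ?thesis unfolding T_def pq'
          using three_points[of a b "u q" p q "w p"] pq a b u w by (auto simp: pq' c_def)
      qed (use n0 in \<open>simp add: T_def pq'\<close>)
    qed
    also have "\<dots> = (\<Sum>p\<in>X. \<Sum>q\<in>X - {p}. N / (n * (n - 1) * (n - 3)))"
      using finX by (subst sum.Sigma) auto
    also have "\<dots> = N / (n - 3)" using n0 by (simp add: card_remove_X)
    finally have bT: "real (card ?T) \<le> N / (n - 3)" .
    have finT: "finite ?T" using finX finG by (auto simp: T_def)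
    have "?S \<subseteq> S a \<union> (S b \<union> (S c \<union> ?T))"
    proof
      fix g assume "g \<in> ?S"
      then have g: "g \<in> G" and gx: "\<pi> g (u (\<pi> g b)) = w (\<pi> g a)" by (auto simp: b_def)
      show "g \<in> S a \<union> (S b \<union> (S c \<union> ?T))"
      proof (cases "u (\<pi> g b) \<in> {a, b, c}")
        case True
        moreover have "\<pi> g b = perminv u (u (\<pi> g b))" using u by (simp add: permutes_inverses)
        ultimately have "g \<in> S a \<or> g \<in> S b \<or> g \<in> S c" using g unfolding S_def by auto
        then show ?thesis by blast
      next
        case False
        then have "g \<in> T (\<pi> g a) (\<pi> g b)" using g gx by (simp add: T_def)
        moreover have "(\<pi> g a, \<pi> g b) \<in> ?I" using g a b pi_inj[OF g, of a b] by auto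
        ultimately show ?thesis by blast
      qed
    qed
    then have "real (card ?S) \<le> N / n + (N / n + (N / n + N / (n - 3)))"
      using bS[OF a] bS[OF b(1)] bS[OF c] bT finT
      by (intro card_le_card_plus[of "S a" "S b \<union> (S c \<union> ?T)"] card_le_card_plus[of "S b" "S c \<union> ?T"]
          card_le_card_plus[of "S c" ?T]) simp_all
    also have "\<dots> \<le> 5 * N / n"
    proof -
      have "N / (n - 3) \<le> 2 * (N / n)"
        using n6 N0 by (simp add: field_simps mult_left_mono)
      then show ?thesis by simp
    qed
    finally show ?thesis .
  qed
qed

lemma fixc_le: "fixc f \<le> n"
  unfolding fixc_def using finX by (auto intro!: card_mono)

text \<open>The number of fixed points is invariant under conjugation, so the composition belonging
  to a word may be rotated until a chosen letter stands leftmost.\<close>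

lemma fixc_comp_commute:
  assumes "f permutes X" "h permutes X"
  shows "fixc (f \<circ> h) = fixc (h \<circ> f)"
proof -
  have "bij_betw h {x \<in> X. f (h x) = x} {x \<in> X. h (f x) = x}"
    by (rule bij_betw_byWitness[where f' = f]) (use assms in auto)
  then show ?thesis unfolding fixc_def by (auto dest: bij_betw_same_card)
qed

text \<open>Covers the small n that the estimates with n at least 6 leave out.\<close>

lemma sum_fixc_small:
  assumes "n \<le> 5"
  shows "(\<Sum>g\<in>G. fixc (f g)) \<le> 5 * N"
proof -
  have "(\<Sum>g\<in>G. fixc (f g)) \<le> (\<Sum>g\<in>G. 5)"
    by (intro sum_mono order_trans[OF fixc_le assms])
  then show ?thesis by simp
qed

lemma sum_fixc_three_same:
  assumes u: "u permutes X" and v: "v permutes X" and w: "w permutes X"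
  shows "(\<Sum>g\<in>G. fixc (\<pi> g \<circ> u \<circ> \<pi> g \<circ> v \<circ> \<pi> g \<circ> w)) \<le> 5 * N"
proof (cases "n \<le> 5")
  case False
  then have n6: "n \<ge> 6" by simp
  have "(\<Sum>g\<in>G. fixc (\<pi> g \<circ> u \<circ> \<pi> g \<circ> v \<circ> \<pi> g \<circ> w))
      = (\<Sum>x\<in>X. real (card {g \<in> G. \<pi> g (u (\<pi> g (v (\<pi> g (w x))))) = x}))"
    unfolding fixc_def o_def by (rule sum_card_swap[OF finG finX])
  also have "\<dots> \<le> (\<Sum>x\<in>X. 5 * N / n)"
    by (intro sum_mono three_same_bound) (use u v w n6 in auto)
  also have "\<dots> = 5 * N" using n3 by auto
  finally show ?thesis .
qed (rule sum_fixc_small)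

lemma sum_fixc_three_mixed:
  assumes u: "u permutes X" and v: "v permutes X" and w: "w permutes X"
  shows "(\<Sum>g\<in>G. fixc (\<pi> g \<circ> u \<circ> \<pi> g \<circ> v \<circ> perminv (\<pi> g) \<circ> w)) \<le> 5 * N"
proof (cases "n \<le> 5")
  case False
  then have n6: "n \<ge> 6" by simp
  have eq: "fixc (\<pi> g \<circ> u \<circ> \<pi> g \<circ> v \<circ> perminv (\<pi> g) \<circ> w)
      = real (card {a \<in> X. \<pi> g (u (\<pi> g (v a))) = perminv w (\<pi> g a)})" if g: "g \<in> G" for g
  proof -
    have "fixc (\<pi> g \<circ> u \<circ> \<pi> g \<circ> v \<circ> (perminv (\<pi> g) \<circ> w)) = fixc (perminv (\<pi> g) \<circ> w \<circ> (\<pi> g \<circ> u \<circ> \<pi> g \<circ> v))"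
      using perm[OF g] u v w by (intro fixc_comp_commute permutes_compose permutes_inv)
    moreover have "perminv (\<pi> g) (w y) = a \<longleftrightarrow> y = perminv w (\<pi> g a)" for y a
      using w pi_inv_iff[OF g, of "w y" a] inv_iff[OF w, of "\<pi> g a" y] by auto
    ultimately show ?thesis by (simp add: fixc_def comp_assoc)
  qed
  have "(\<Sum>g\<in>G. fixc (\<pi> g \<circ> u \<circ> \<pi> g \<circ> v \<circ> perminv (\<pi> g) \<circ> w))
      = (\<Sum>g\<in>G. real (card {a \<in> X. \<pi> g (u (\<pi> g (v a))) = perminv w (\<pi> g a)}))"
    by (intro sum.cong refl eq)
  also have "\<dots> = (\<Sum>a\<in>X. real (card {g \<in> G. \<pi> g (u (\<pi> g (v a))) = perminv w (\<pi> g a)}))"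
    by (rule sum_card_swap[OF finG finX])
  also have "\<dots> \<le> (\<Sum>x\<in>X. 5 * N / n)"
    by (intro sum_mono three_mixed_bound) (use u v w n6 in auto)
  also have "\<dots> = 5 * N" using n3 by auto
  finally show ?thesis .
qed (rule sum_fixc_small)

text \<open>The equation is split by the value b of the preimage of w a under g. The value
  \<open>b0\<close>, for which v b = a, is handled by the one-point bound for g alone. For any other
  b the points a and v b are distinct queries to h, and the total is at most 1/(n(n-1)) of all pairs
  (g, h); as there are n - 1 such b, both parts come to 1/n.\<close>

lemma crossing_bound:
  assumes H: "sampler X add H \<rho>"
    and u: "u permutes X" and v: "v permutes X" and w: "w permutes X" and z: "z permutes X" and a: "a \<in> X"
  shows "real (card {(g,h) \<in> G \<times> H. \<pi> g (u (\<rho> h (v (perminv (\<pi> g) (w a))))) = perminv z (\<rho> h a)})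
    \<le> 2 * N * real (card H) / n"
proof -
  interpret H: sampler X add H \<rho> by (rule H)
  let ?M = "real (card H)"
  have n0: "n > 0" "n - 1 > 0" using n3 by auto
  define b0 where "b0 = perminv v a"
  have b0: "b0 \<in> X" "v b = a \<longleftrightarrow> b = b0" for b
    using v a by (auto simp: b0_def permutes_inverses)
  define p0 where "p0 = z (w a)"
  have p0: "p0 \<in> X" using z w a by (simp add: p0_def)
  define Q where "Q b = {(g,h) \<in> G \<times> H. \<pi> g b = w a \<and> \<pi> g (u (\<rho> h (v b))) = perminv z (\<rho> h a)}" for b
  have finQ: "finite (Q b)" for b
    unfolding Q_def by (rule finite_subset[of _ "G \<times> H"]) (use finG H.finG in auto)
  have Q0: "real (card (Q b0)) \<le> N * ?M / n"
  proof -
    have "card (Q b0) \<le> card ({g \<in> G. \<pi> g b0 = w a} \<times> H)"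
      unfolding Q_def using finG H.finG by (intro card_mono) auto
    then have "real (card (Q b0)) \<le> real (card {g \<in> G. \<pi> g b0 = w a}) * ?M"
      by (simp add: card_cartesian_product flip: of_nat_mult)
    also have "\<dots> \<le> N / n * ?M"
      using one_point[of b0 "w a"] b0 w a by (intro mult_right_mono) auto
    finally show ?thesis by simp
  qed
  have Q1: "real (card (Q b)) \<le> N * ?M / (n * (n - 1))" if b: "b \<in> X - {b0}" for b
  proof -
    have vb: "v b \<in> X" "a \<noteq> v b" using b v b0 by auto
    \<comment> \<open>\<open>A\<close> covers the pairs for which the second query
      \<open>u (\<rho> h (v b))\<close> to g repeats the query b. The two answers then agree, which
      forces \<open>\<rho> h a = p0\<close>. In the complementary case injectivity of g forces
      \<open>\<rho> h a \<noteq> p0\<close>, the condition in \<open>K\<close>. The factor (n-1)/n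
      gained from \<open>K\<close> lets the two bounds, 1/n and (n-1)/n times the same number, add
      up without loss.\<close>
    define A where "A = {g \<in> G. \<pi> g b = w a} \<times> {h \<in> H. \<rho> h a = p0 \<and> \<rho> h (v b) = perminv u b}"
    define K where "K = {h \<in> H. \<rho> h a \<noteq> p0}"
    define C where "C h = {g \<in> G. u (\<rho> h (v b)) \<noteq> b \<and> \<pi> g b = w a \<and> \<pi> g (u (\<rho> h (v b))) = perminv z (\<rho> h a)}" for h
    let ?B = "\<Union>h\<in>K. C h \<times> {h}"
    have "real (card A) = real (card {g \<in> G. \<pi> g b = w a}) * real (card {h \<in> H. \<rho> h a = p0 \<and> \<rho> h (v b) = perminv u b})"
      unfolding A_def by (simp add: card_cartesian_product)
    also have "\<dots> \<le> N / n * (?M / (n * (n - 1)))"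
      using one_point[of b "w a"] H.two_points[of a "v b" p0 "perminv u b"] b w a u p0 vb n0
      by (intro mult_mono) auto
    finally have bA: "real (card A) \<le> N / n * (?M / (n * (n - 1)))" .
    have "real (card K) \<le> (\<Sum>p\<in>X - {p0}. real (card {h \<in> H. \<rho> h a = p}))"
      using finX H.finG a by (intro card_le_sum_cover) (auto simp: K_def)
    also have "\<dots> \<le> (\<Sum>p\<in>X - {p0}. ?M / n)" by (intro sum_mono H.one_point) (use a in auto)
    also have "\<dots> = (n - 1) * ?M / n" unfolding sum_constant card_remove_X[OF p0] by simp
    finally have bK: "real (card K) \<le> (n - 1) * ?M / n" .
    have bC: "real (card (C h)) \<le> N / (n * (n - 1))" if h: "h \<in> K" for h
    proof (cases "u (\<rho> h (v b)) = b")
      case False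
      then show ?thesis unfolding C_def
        using two_points[of b "u (\<rho> h (v b))" "w a" "perminv z (\<rho> h a)"] h b vb a u w z
        by (simp add: K_def)
    qed (use n0 in \<open>simp add: C_def\<close>)
    have finC: "finite (C h)" for h unfolding C_def using finG by simp
    have finK: "finite K" unfolding K_def using H.finG by simp
    have "real (card ?B) \<le> (\<Sum>h\<in>K. real (card (C h \<times> {h})))"
      using finC finK by (intro card_le_sum_cover) auto
    also have "\<dots> \<le> (\<Sum>h\<in>K. N / (n * (n - 1)))"
      using bC by (intro sum_mono) (simp add: card_cartesian_product)
    also have "\<dots> = real (card K) * (N / (n * (n - 1)))" by simp
    also have "\<dots> \<le> (n - 1) * ?M / n * (N / (n * (n - 1)))"
      using bK n0 by (intro mult_right_mono) auto
    finally have bB: "real (card ?B) \<le> (n - 1) * ?M / n * (N / (n * (n - 1)))" .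
    have "Q b \<subseteq> A \<union> ?B"
    proof
      fix gh assume gh: "gh \<in> Q b"
      obtain g h where gh': "gh = (g, h)" by force
      have g: "g \<in> G" and h: "h \<in> H" and gb: "\<pi> g b = w a"
        and gx: "\<pi> g (u (\<rho> h (v b))) = perminv z (\<rho> h a)" using gh by (auto simp: Q_def gh')
      have zi: "perminv z (\<rho> h a) = w a \<longleftrightarrow> \<rho> h a = p0"
        using inv_iff[OF z, of "\<rho> h a" "w a"] by (simp add: p0_def)
      show "gh \<in> A \<union> ?B"
      proof (cases "u (\<rho> h (v b)) = b")
        case True
        then have "perminv u b = \<rho> h (v b)" using inv_iff[OF u, of b "\<rho> h (v b)"] by simp
        then have "gh \<in> A" using g h gb gx zi True by (simp add: A_def gh')
        then show ?thesis by blast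
      next
        case False
        then have "perminv z (\<rho> h a) \<noteq> w a" using gx gb pi_inj[OF g, of "u (\<rho> h (v b))" b] by auto
        then have "h \<in> K" using zi h by (simp add: K_def)
        moreover have "g \<in> C h" using g gb gx False by (simp add: C_def)
        ultimately show ?thesis by (auto simp: gh')
      qed
    qed
    then have "real (card (Q b)) \<le> N / n * (?M / (n * (n - 1))) + (n - 1) * ?M / n * (N / (n * (n - 1)))"
      using bA bB finC finK finG H.finG by (intro card_le_card_plus) (auto simp: A_def)
    also have "\<dots> = N * ?M / (n * (n - 1)) / n + N * ?M / (n * (n - 1)) * ((n - 1) / n)"
      by (simp add: mult_ac)
    also have "\<dots> = N * ?M / (n * (n - 1)) * (1 / n + (n - 1) / n)"
      by (simp only: distrib_left) simp
    also have "1 / n + (n - 1) / n = 1"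
      using n0 by (simp add: field_simps)
    also have "N * ?M / (n * (n - 1)) * 1 = N * ?M / (n * (n - 1))" by simp
    finally show ?thesis .
  qed
  have "real (card {(g,h) \<in> G \<times> H. \<pi> g (u (\<rho> h (v (perminv (\<pi> g) (w a))))) = perminv z (\<rho> h a)})
      \<le> (\<Sum>b\<in>X. real (card (Q b)))"
  proof (rule card_le_sum_cover[OF finX finQ], rule subsetI)
    fix gh assume gh: "gh \<in> {(g,h) \<in> G \<times> H. \<pi> g (u (\<rho> h (v (perminv (\<pi> g) (w a))))) = perminv z (\<rho> h a)}"
    obtain g h where gh': "gh = (g, h)" by force
    have "g \<in> G" using gh gh' by auto
    then have "gh \<in> Q (perminv (\<pi> g) (w a))" "perminv (\<pi> g) (w a) \<in> X"
      using gh perm[of g] w a by (auto simp: Q_def gh' permutes_inverses)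
    then show "gh \<in> (\<Union>b\<in>X. Q b)" by blast
  qed
  also have "\<dots> = real (card (Q b0)) + (\<Sum>b\<in>X - {b0}. real (card (Q b)))"
    using finX b0 by (simp add: sum.remove)
  also have "\<dots> \<le> N * ?M / n + (\<Sum>b\<in>X - {b0}. N * ?M / (n * (n - 1)))"
    using Q0 Q1 by (intro add_mono sum_mono)
  also have "\<dots> = 2 * N * ?M / n"
    unfolding sum_constant card_remove_X[OF b0(1)] using n0 by simp
  finally show ?thesis .
qed

lemma sum_fixc_crossing:
  assumes H: "sampler X add H \<rho>"
    and u: "u permutes X" and v: "v permutes X" and w: "w permutes X" and z: "z permutes X"
  shows "(\<Sum>g\<in>G. \<Sum>h\<in>H. fixc (\<pi> g \<circ> u \<circ> \<rho> h \<circ> v \<circ> perminv (\<pi> g) \<circ> w \<circ> perminv (\<rho> h) \<circ> z)) \<le> 2 * N * real (card H)"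
proof -
  interpret H: sampler X add H \<rho> by (rule H)
  let ?P = "\<lambda>g h a. \<pi> g (u (\<rho> h (v (perminv (\<pi> g) (w a))))) = perminv z (\<rho> h a)"
  have eq: "fixc (\<pi> g \<circ> u \<circ> \<rho> h \<circ> v \<circ> perminv (\<pi> g) \<circ> w \<circ> perminv (\<rho> h) \<circ> z)
      = real (card {a \<in> X. ?P g h a})" if g: "g \<in> G" and h: "h \<in> H" for g h
  proof -
    have "fixc (\<pi> g \<circ> u \<circ> \<rho> h \<circ> v \<circ> perminv (\<pi> g) \<circ> w \<circ> (perminv (\<rho> h) \<circ> z))
        = fixc (perminv (\<rho> h) \<circ> z \<circ> (\<pi> g \<circ> u \<circ> \<rho> h \<circ> v \<circ> perminv (\<pi> g) \<circ> w))"
      using perm[OF g] H.perm[OF h] u v w z by (intro fixc_comp_commute permutes_compose permutes_inv)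
    moreover have "perminv (\<rho> h) (z y) = a \<longleftrightarrow> y = perminv z (\<rho> h a)" for y a
      using z H.pi_inv_iff[OF h, of "z y" a] inv_iff[OF z, of "\<rho> h a" y] by auto
    ultimately show ?thesis by (simp add: fixc_def comp_assoc)
  qed
  have "(\<Sum>g\<in>G. \<Sum>h\<in>H. fixc (\<pi> g \<circ> u \<circ> \<rho> h \<circ> v \<circ> perminv (\<pi> g) \<circ> w \<circ> perminv (\<rho> h) \<circ> z))
      = (\<Sum>g\<in>G. \<Sum>h\<in>H. real (card {a \<in> X. ?P g h a}))"
    by (intro sum.cong refl eq)
  also have "\<dots> = (\<Sum>gh\<in>G \<times> H. real (card {a \<in> X. ?P (fst gh) (snd gh) a}))"
    by (simp add: sum.cartesian_product split_def)
  also have "\<dots> = (\<Sum>a\<in>X. real (card {gh \<in> G \<times> H. ?P (fst gh) (snd gh) a}))"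
    using finG H.finG finX by (intro sum_card_swap) auto
  also have "\<dots> \<le> (\<Sum>a\<in>X. 2 * N * real (card H) / n)"
  proof (rule sum_mono)
    fix a assume a: "a \<in> X"
    have "{gh \<in> G \<times> H. ?P (fst gh) (snd gh) a} = {(g,h) \<in> G \<times> H. ?P g h a}" by auto
    then show "real (card {gh \<in> G \<times> H. ?P (fst gh) (snd gh) a}) \<le> 2 * N * real (card H) / n"
      using crossing_bound[OF H u v w z a] by simp
  qed
  also have "\<dots> = 2 * N * real (card H)" using n3 by auto
  finally show ?thesis .
qed

end

section \<open>Alternating words evaluated at random generators\<close>

definition signed :: "bool \<Rightarrow> ('v \<Rightarrow> 'v) \<Rightarrow> 'v \<Rightarrow> 'v" where
  "signed e p = (if e then p else perminv p)"

text \<open>The flag is the sign of the first letter, and the first letter acts first. Signs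
  alternate because a walk in a bipartite graph uses edges from left to right, by a generator, and
  from right to left, by an inverse, in turn.\<close>

primrec walk :: "(nat \<Rightarrow> 'v \<Rightarrow> 'v) \<Rightarrow> bool \<Rightarrow> nat list \<Rightarrow> 'v \<Rightarrow> 'v" where
  "walk \<sigma> e [] = id"
| "walk \<sigma> e (j # w) = walk \<sigma> (\<not> e) w \<circ> signed e (\<sigma> j)"

lemma walk_append: "walk \<sigma> e (u @ v) = walk \<sigma> (e = even (length u)) v \<circ> walk \<sigma> e u"
proof (induction u arbitrary: e)
  case (Cons j u)
  have "((\<not> e) = even (length u)) = (e = even (length (j # u)))" by auto
  then show ?case using Cons[of "\<not> e"] by (simp only: append_Cons walk.simps comp_assoc)
qed simp

lemma walk_split:
  "walk \<sigma> e (u @ j # v) = walk \<sigma> (e \<noteq> even (length u)) v \<circ> signed (e = even (length u)) (\<sigma> j) \<circ> walk \<sigma> e u"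
  by (simp add: walk_append)

lemma walk_cong: "(\<And>j. j \<in> set w \<Longrightarrow> \<sigma> j = \<tau> j) \<Longrightarrow> walk \<sigma> e w = walk \<tau> e w"
  by (induction w arbitrary: e) auto

lemma signed_permutes: "p permutes X \<Longrightarrow> signed e p permutes X"
  by (simp add: signed_def permutes_inv)

lemma walk_permutes: "(\<And>j. j \<in> set w \<Longrightarrow> \<sigma> j permutes X) \<Longrightarrow> walk \<sigma> e w permutes X"
  by (induction w arbitrary: e) (auto intro!: permutes_compose signed_permutes permutes_id)

text \<open>Sending \<open>(s, g)\<close> to \<open>(s(j := g), s j)\<close> is an involution on
  pairs, so replacing one coordinate by a fresh independent element leaves the distribution of the
  sample unchanged.\<close>

lemma sum_PiE_resample:
  fixes F :: "(nat \<Rightarrow> 'g) \<Rightarrow> real"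
  assumes "j < d"
  shows "(\<Sum>s\<in>PiE {..<d} (\<lambda>_. G). \<Sum>g\<in>G. F (s(j := g)))
    = real (card G) * (\<Sum>s\<in>PiE {..<d} (\<lambda>_. G). F s)"
proof -
  let ?\<Omega> = "PiE {..<d} (\<lambda>_. G)"
  have upd: "s(j := g) \<in> ?\<Omega>" if "s \<in> ?\<Omega>" "g \<in> G" for s g
    using that assms by (auto simp: PiE_iff extensional_def)
  have "(\<Sum>s\<in>?\<Omega>. \<Sum>g\<in>G. F (s(j := g))) = (\<Sum>(s,g)\<in>?\<Omega> \<times> G. F (s(j := g)))"
    by (rule sum.cartesian_product)
  also have "\<dots> = (\<Sum>(s,g)\<in>?\<Omega> \<times> G. F s)"
    by (rule sum.reindex_bij_witness[where i = "\<lambda>(s,g). (s(j := g), s j)" and j = "\<lambda>(s,g). (s(j := g), s j)"])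
      (use assms upd in \<open>auto dest: PiE_mem intro: upd\<close>)
  also have "\<dots> = (\<Sum>s\<in>?\<Omega>. \<Sum>g\<in>G. F s)"
    by (rule sum.cartesian_product[symmetric])
  finally show ?thesis by (simp add: sum_distrib_left)
qed

lemma filter_two_ConsE:
  assumes "filter (\<lambda>c. c = a \<or> c = b) w = x # r"
  obtains u v where "w = u @ x # v" "a \<notin> set u" "b \<notin> set u" "filter (\<lambda>c. c = a \<or> c = b) v = r"
  using assms unfolding filter_eq_Cons_iff by blast

lemma filter_one_ConsE:
  assumes "filter (\<lambda>c. c = a) w = x # r"
  obtains u v where "w = u @ x # v" "a \<notin> set u" "filter (\<lambda>c. c = a) v = r"
  using assms unfolding filter_eq_Cons_iff by blast

lemma filter_eq_replicate_count: "filter (\<lambda>c. c = a) w = replicate (count_list w a) a"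
  by (induction w) auto

context sampler
begin

lemma sampler_signed: "sampler X add G (\<lambda>g. signed e (\<pi> g))"
  using sampler_axioms sampler_inverse by (cases e) (auto simp: signed_def)

lemma signed_Not: "g \<in> G \<Longrightarrow> signed (\<not> e) (\<pi> g) = perminv (signed e (\<pi> g))"
  using permutes_inv_inv[OF perm] by (auto simp: signed_def)

lemma signed_pi_permutes: "g \<in> G \<Longrightarrow> signed e (\<pi> g) permutes X"
  using perm by (simp add: signed_permutes)

lemma sum_fixc_signed_one:
  assumes "u permutes X"
  shows "(\<Sum>g\<in>G. fixc (signed e (\<pi> g) \<circ> u)) \<le> N"
  using sampler.sum_fixc_one[OF sampler_signed assms] .

lemma sum_fixc_signed_two_same:
  assumes "u permutes X" "v permutes X"
  shows "(\<Sum>g\<in>G. fixc (signed e (\<pi> g) \<circ> u \<circ> signed e (\<pi> g) \<circ> v)) \<le> 2 * N"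
  using sampler.sum_fixc_two_same[OF sampler_signed assms] .

lemma sum_fixc_signed_crossing:
  assumes H: "sampler X add H \<rho>"
    and "u permutes X" "v permutes X" "w permutes X" "z permutes X"
  shows "(\<Sum>g\<in>G. \<Sum>h\<in>H. fixc (signed e (\<pi> g) \<circ> u \<circ> signed f (\<rho> h) \<circ> v
    \<circ> signed (\<not> e) (\<pi> g) \<circ> w \<circ> signed (\<not> f) (\<rho> h) \<circ> z)) \<le> 2 * N * real (card H)"
proof -
  interpret H: sampler X add H \<rho> by (rule H)
  show ?thesis
    using sampler.sum_fixc_crossing[OF sampler_signed[of e] H.sampler_signed[of f] assms(2-)]
    by (simp add: signed_Not H.signed_Not)
qed

text \<open>Of the eight sign patterns, \<open>sampler_signed\<close> absorbs a global sign and
  rotation moves the odd sign out to the third place. What remains is three equal signs, or two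
  equal signs followed by the opposite one.\<close>

lemma sum_fixc_signed_three:
  assumes u: "u permutes X" and v: "v permutes X" and w: "w permutes X"
  shows "(\<Sum>g\<in>G. fixc (signed e (\<pi> g) \<circ> u \<circ> signed f (\<pi> g) \<circ> v \<circ> signed c (\<pi> g) \<circ> w)) \<le> 5 * N"
proof -
  have mixed: "(\<Sum>g\<in>G. fixc (signed e (\<pi> g) \<circ> u \<circ> signed e (\<pi> g) \<circ> v \<circ> signed (\<not> e) (\<pi> g) \<circ> w)) \<le> 5 * N"
    if "u permutes X" "v permutes X" "w permutes X" for e u v w
    using sampler.sum_fixc_three_mixed[OF sampler_signed[of e] that] by (simp add: signed_Not)
  consider "f = e" "c = e" | "f = e" "c = (\<not> e)" | "f = (\<not> e)" "c = e" | "f = (\<not> e)" "c = (\<not> e)"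
    by auto
  then show ?thesis
  proof cases
    case 1
    then show ?thesis
      using sampler.sum_fixc_three_same[OF sampler_signed[of e] u v w] by simp
  next
    case 2
    then show ?thesis using mixed[OF u v w, of e] by simp
  next
    case 3
    have "fixc (signed e (\<pi> g) \<circ> u \<circ> signed f (\<pi> g) \<circ> v \<circ> signed c (\<pi> g) \<circ> w)
        = fixc (signed e (\<pi> g) \<circ> w \<circ> signed e (\<pi> g) \<circ> u \<circ> signed (\<not> e) (\<pi> g) \<circ> v)" if g: "g \<in> G" for g
      using fixc_comp_commute[of "signed e (\<pi> g) \<circ> u \<circ> signed (\<not> e) (\<pi> g) \<circ> v" "signed e (\<pi> g) \<circ> w"]
        signed_pi_permutes[OF g] u v w 3
      by (simp add: comp_assoc permutes_compose)
    then show ?thesis using mixed[OF w u v, of e] by simp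
  next
    case 4
    have "fixc (signed e (\<pi> g) \<circ> u \<circ> signed f (\<pi> g) \<circ> v \<circ> signed c (\<pi> g) \<circ> w)
        = fixc (signed (\<not> e) (\<pi> g) \<circ> v \<circ> signed (\<not> e) (\<pi> g) \<circ> w \<circ> signed (\<not> (\<not> e)) (\<pi> g) \<circ> u)" if g: "g \<in> G" for g
      using fixc_comp_commute[of "signed e (\<pi> g) \<circ> u" "signed (\<not> e) (\<pi> g) \<circ> v \<circ> signed (\<not> e) (\<pi> g) \<circ> w"]
        signed_pi_permutes[OF g] u v w 4
      by (simp add: comp_assoc permutes_compose)
    then show ?thesis using mixed[OF v w u, of "\<not> e"] by simp
  qed
qed

abbreviation samples :: "nat \<Rightarrow> (nat \<Rightarrow> 'g) set" where
  "samples d \<equiv> PiE {..<d} (\<lambda>_. G)"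

lemma N_pos: "N > 0" using finG G_nonempty by (simp add: card_gt_0_iff)

text \<open>The form in which conditioning is used: a bound on the sum over one resampled
  coordinate, uniform in the other coordinates, passes to the sum over all samples.\<close>

lemma sum_samples_le:
  assumes "j < d" and "\<And>s. s \<in> samples d \<Longrightarrow> (\<Sum>g\<in>G. F (s(j := g))) \<le> B * N"
  shows "(\<Sum>s\<in>samples d. F s) \<le> B * real (card (samples d))"
proof -
  have "N * (\<Sum>s\<in>samples d. F s) \<le> (\<Sum>s\<in>samples d. B * N)"
    unfolding sum_PiE_resample[OF assms(1), symmetric] by (rule sum_mono) (rule assms(2))
  then have "N * (\<Sum>s\<in>samples d. F s) \<le> N * (B * real (card (samples d)))"
    by (simp add: mult_ac)
  then show ?thesis using N_pos by simp
qed

lemma sample_mem: "s \<in> samples d \<Longrightarrow> j < d \<Longrightarrow> s j \<in> G"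
  by auto

lemma sample_walk_permutes:
  assumes "s \<in> samples d" "set w \<subseteq> {..<d}"
  shows "walk (\<lambda>i. \<pi> (s i)) e w permutes X"
  using assms by (intro walk_permutes perm sample_mem) auto

lemma walk_update: "j \<notin> set w \<Longrightarrow> walk (\<lambda>i. \<pi> ((s(j := g)) i)) e w = walk (\<lambda>i. \<pi> (s i)) e w"
  by (rule walk_cong) auto

lemma sum_fixc_walk_trivial: "(\<Sum>s\<in>samples d. fixc (walk (\<lambda>i. \<pi> (s i)) e w)) \<le> n * real (card (samples d))"
proof -
  have "(\<Sum>s\<in>samples d. fixc (walk (\<lambda>i. \<pi> (s i)) e w)) \<le> (\<Sum>s\<in>samples d. n)"
    by (intro sum_mono fixc_le)
  then show ?thesis by (simp add: mult.commute)
qed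

lemma sum_fixc_walk_one:
  assumes w: "set w \<subseteq> {..<d}" and c: "count_list w j = 1"
  shows "(\<Sum>s\<in>samples d. fixc (walk (\<lambda>i. \<pi> (s i)) e w)) \<le> 1 * real (card (samples d))"
proof -
  have "filter (\<lambda>x. x = j) w = [j]" using filter_eq_replicate_count[of j w] c by simp
  then obtain w1 w2 where w12: "w = w1 @ j # w2" "j \<notin> set w1" "filter (\<lambda>x. x = j) w2 = []"
    by (rule filter_one_ConsE)
  then have nj: "j \<notin> set w1" "j \<notin> set w2" by (auto simp: filter_empty_conv)
  have sub: "j < d" "set w1 \<subseteq> {..<d}" "set w2 \<subseteq> {..<d}" using w w12 by auto
  show ?thesis
  proof (rule sum_samples_le[OF sub(1)])
    fix s assume s: "s \<in> samples d"
    let ?W = "walk (\<lambda>i. \<pi> (s i))"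
    define e1 where "e1 = (e = even (length w1))"
    have "fixc (walk (\<lambda>i. \<pi> ((s(j := g)) i)) e w) = fixc (signed e1 (\<pi> g) \<circ> (?W e w1 \<circ> ?W (\<not> e1) w2))"
      if g: "g \<in> G" for g
      using fixc_comp_commute[of "?W (\<not> e1) w2" "signed e1 (\<pi> g) \<circ> ?W e w1"]
        signed_pi_permutes[OF g] sample_walk_permutes[OF s sub(2)] sample_walk_permutes[OF s sub(3)]
      unfolding w12(1) walk_split walk_update[OF nj(1)] walk_update[OF nj(2)]
      by (simp add: e1_def comp_assoc permutes_compose)
    then have "(\<Sum>g\<in>G. fixc (walk (\<lambda>i. \<pi> ((s(j := g)) i)) e w))
        = (\<Sum>g\<in>G. fixc (signed e1 (\<pi> g) \<circ> (?W e w1 \<circ> ?W (\<not> e1) w2)))"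
      by (intro sum.cong) auto
    also have "\<dots> \<le> N"
      by (intro sum_fixc_signed_one permutes_compose sample_walk_permutes[OF s] sub)
    finally show "(\<Sum>g\<in>G. fixc (walk (\<lambda>i. \<pi> ((s(j := g)) i)) e w)) \<le> 1 * N" by simp
  qed
qed

lemma sum_fixc_walk_three:
  assumes w: "set w \<subseteq> {..<d}" and c: "count_list w j = 3"
  shows "(\<Sum>s\<in>samples d. fixc (walk (\<lambda>i. \<pi> (s i)) e w)) \<le> 5 * real (card (samples d))"
proof -
  have "filter (\<lambda>x. x = j) w = [j, j, j]"
    using filter_eq_replicate_count[of j w] c by (simp add: numeral_3_eq_3)
  then obtain w1 r1 where 1: "w = w1 @ j # r1" "j \<notin> set w1" "filter (\<lambda>x. x = j) r1 = [j, j]"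
    by (rule filter_one_ConsE)
  from 1(3) obtain w2 r2 where 2: "r1 = w2 @ j # r2" "j \<notin> set w2" "filter (\<lambda>x. x = j) r2 = [j]"
    by (rule filter_one_ConsE)
  from 2(3) obtain w3 w4 where 3: "r2 = w3 @ j # w4" "j \<notin> set w3" "filter (\<lambda>x. x = j) w4 = []"
    by (rule filter_one_ConsE)
  then have 4: "j \<notin> set w4" by (auto simp: filter_empty_conv)
  have w1234: "w = w1 @ j # w2 @ j # w3 @ j # w4" using 1 2 3 by simp
  have sub: "j < d" "set w1 \<subseteq> {..<d}" "set w2 \<subseteq> {..<d}" "set w3 \<subseteq> {..<d}" "set w4 \<subseteq> {..<d}"
    using w w1234 by auto
  define e1 where "e1 = (e = even (length w1))"
  define e2 where "e2 = ((\<not> e1) = even (length w2))"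
  define e3 where "e3 = ((\<not> e2) = even (length w3))"
  show ?thesis
  proof (rule sum_samples_le[OF sub(1)])
    fix s assume s: "s \<in> samples d"
    let ?W = "walk (\<lambda>i. \<pi> (s i))"
    note permW = sub(2-)[THEN sample_walk_permutes[OF s]]
    have "fixc (walk (\<lambda>i. \<pi> ((s(j := g)) i)) e w)
        = fixc (signed e3 (\<pi> g) \<circ> ?W (\<not> e2) w3 \<circ> signed e2 (\<pi> g) \<circ> ?W (\<not> e1) w2
          \<circ> signed e1 (\<pi> g) \<circ> (?W e w1 \<circ> ?W (\<not> e3) w4))"
      if g: "g \<in> G" for g
      using fixc_comp_commute[of "?W (\<not> e3) w4" "signed e3 (\<pi> g) \<circ> ?W (\<not> e2) w3 \<circ> signed e2 (\<pi> g) \<circ> ?W (\<not> e1) w2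
          \<circ> signed e1 (\<pi> g) \<circ> ?W e w1"]
        signed_pi_permutes[OF g] permW
      unfolding w1234 walk_split walk_update[OF 1(2)] walk_update[OF 2(2)] walk_update[OF 3(2)] walk_update[OF 4]
      by (simp add: e1_def e2_def e3_def comp_assoc permutes_compose)
    then have "(\<Sum>g\<in>G. fixc (walk (\<lambda>i. \<pi> ((s(j := g)) i)) e w))
        = (\<Sum>g\<in>G. fixc (signed e3 (\<pi> g) \<circ> ?W (\<not> e2) w3 \<circ> signed e2 (\<pi> g) \<circ> ?W (\<not> e1) w2
          \<circ> signed e1 (\<pi> g) \<circ> (?W e w1 \<circ> ?W (\<not> e3) w4)))"
      by (intro sum.cong) auto
    also have "\<dots> \<le> 5 * N"
      by (intro sum_fixc_signed_three permutes_compose permW)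
    finally show "(\<Sum>g\<in>G. fixc (walk (\<lambda>i. \<pi> ((s(j := g)) i)) e w)) \<le> 5 * N" .
  qed
qed

text \<open>Signs alternate along the word, so a gap of odd length between the two copies of
  \<open>j\<close> means that they carry equal signs.\<close>

lemma sum_fixc_walk_two_same:
  assumes w: "set w \<subseteq> {..<d}" and w123: "w = w1 @ j # w2 @ j # w3"
    and nj: "j \<notin> set w1" "j \<notin> set w2" "j \<notin> set w3" and odd: "odd (length w2)"
  shows "(\<Sum>s\<in>samples d. fixc (walk (\<lambda>i. \<pi> (s i)) e w)) \<le> 2 * real (card (samples d))"
proof -
  have sub: "j < d" "set w1 \<subseteq> {..<d}" "set w2 \<subseteq> {..<d}" "set w3 \<subseteq> {..<d}"
    using w w123 by auto
  define e1 where "e1 = (e = even (length w1))"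
  show ?thesis
  proof (rule sum_samples_le[OF sub(1)])
    fix s assume s: "s \<in> samples d"
    let ?W = "walk (\<lambda>i. \<pi> (s i))"
    note permW = sub(2-)[THEN sample_walk_permutes[OF s]]
    have "fixc (walk (\<lambda>i. \<pi> ((s(j := g)) i)) e w)
        = fixc (signed e1 (\<pi> g) \<circ> ?W (\<not> e1) w2 \<circ> signed e1 (\<pi> g) \<circ> (?W e w1 \<circ> ?W (\<not> e1) w3))"
      if g: "g \<in> G" for g
      using fixc_comp_commute[of "?W (\<not> e1) w3" "signed e1 (\<pi> g) \<circ> ?W (\<not> e1) w2 \<circ> signed e1 (\<pi> g) \<circ> ?W e w1"]
        signed_pi_permutes[OF g] permW odd
      unfolding w123 walk_split walk_update[OF nj(1)] walk_update[OF nj(2)] walk_update[OF nj(3)]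
      by (simp add: e1_def comp_assoc permutes_compose)
    then have "(\<Sum>g\<in>G. fixc (walk (\<lambda>i. \<pi> ((s(j := g)) i)) e w))
        = (\<Sum>g\<in>G. fixc (signed e1 (\<pi> g) \<circ> ?W (\<not> e1) w2 \<circ> signed e1 (\<pi> g) \<circ> (?W e w1 \<circ> ?W (\<not> e1) w3)))"
      by (intro sum.cong) auto
    also have "\<dots> \<le> 2 * N"
      by (intro sum_fixc_signed_two_same permutes_compose permW)
    finally show "(\<Sum>g\<in>G. fixc (walk (\<lambda>i. \<pi> ((s(j := g)) i)) e w)) \<le> 2 * N" .
  qed
qed

text \<open>If the two copies of a, or the two copies of b, have equal signs, that letter alone
  already gives the bound. There remain two crossing letters with opposite signs each, a commutator
  with gaps, for which both generators have to be resampled together.\<close>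

lemma sum_fixc_walk_crossing:
  assumes w: "set w \<subseteq> {..<d}" and cross: "crossing w a b"
  shows "(\<Sum>s\<in>samples d. fixc (walk (\<lambda>i. \<pi> (s i)) e w)) \<le> 2 * real (card (samples d))"
proof -
  have ab: "a \<noteq> b" and fw: "filter (\<lambda>c. c = a \<or> c = b) w = [a, b, a, b]"
    using cross by (auto simp: crossing_def)
  from fw obtain w1 r1 where 1: "w = w1 @ a # r1" "a \<notin> set w1" "b \<notin> set w1"
      "filter (\<lambda>c. c = a \<or> c = b) r1 = [b, a, b]"
    by (rule filter_two_ConsE)
  from 1(4) obtain w2 r2 where 2: "r1 = w2 @ b # r2" "a \<notin> set w2" "b \<notin> set w2"
      "filter (\<lambda>c. c = a \<or> c = b) r2 = [a, b]"
    by (rule filter_two_ConsE)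
  from 2(4) obtain w3 r3 where 3: "r2 = w3 @ a # r3" "a \<notin> set w3" "b \<notin> set w3"
      "filter (\<lambda>c. c = a \<or> c = b) r3 = [b]"
    by (rule filter_two_ConsE)
  from 3(4) obtain w4 w5 where 4: "r3 = w4 @ b # w5" "a \<notin> set w4" "b \<notin> set w4"
      "filter (\<lambda>c. c = a \<or> c = b) w5 = []"
    by (rule filter_two_ConsE)
  then have 5: "a \<notin> set w5" "b \<notin> set w5" by (auto simp: filter_empty_conv)
  have w_eq: "w = w1 @ a # w2 @ b # w3 @ a # w4 @ b # w5" using 1 2 3 4 by simp
  have sub: "a < d" "b < d" "set w1 \<subseteq> {..<d}" "set w2 \<subseteq> {..<d}" "set w3 \<subseteq> {..<d}"
    "set w4 \<subseteq> {..<d}" "set w5 \<subseteq> {..<d}"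
    using w w_eq by auto
  define e1 where "e1 = (e = even (length w1))"
  define e2 where "e2 = ((\<not> e1) = even (length w2))"
  consider "odd (length (w2 @ b # w3))" | "odd (length (w3 @ a # w4))"
    | "odd (length w2 + length w3)" "odd (length w3 + length w4)"
    by fastforce
  then show ?thesis
  proof cases
    case 1
    then show ?thesis
      using sum_fixc_walk_two_same[OF w, of w1 a "w2 @ b # w3" "w4 @ b # w5"]
        \<open>a \<notin> set w1\<close> 2 3 4 5 ab w_eq by simp
  next
    case 2
    then show ?thesis
      using sum_fixc_walk_two_same[OF w, of "w1 @ a # w2" b "w3 @ a # w4" w5]
        \<open>b \<notin> set w1\<close> \<open>b \<notin> set w2\<close> 3 4 5 ab w_eq by simp
  next
    case odd: 3
    \<comment> \<open>The second copies of a and b carry the signs opposite to \<open>e1\<close> and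
      \<open>e2\<close>, the signs of the first copies.\<close>
    have e3: "((\<not> e2) = even (length w3)) = (\<not> e1)" and e4: "(e1 = even (length w4)) = (\<not> e2)"
      using odd by (auto simp: e2_def)
    define F where "F s = fixc (walk (\<lambda>i. \<pi> (s i)) e w)" for s
    \<comment> \<open>Later letters stand further left in the composition. After rotation the second
      copy of \<open>b\<close> is the leading factor, so \<open>b\<close> takes the role of the
      outer random element and \<open>a\<close> that of the inner one.\<close>
    have inner: "(\<Sum>g\<in>G. \<Sum>h\<in>G. F (s(b := g, a := h))) \<le> 2 * N * N" if s: "s \<in> samples d" for s
    proof -
      let ?W = "walk (\<lambda>i. \<pi> (s i))"
      note permW = sub(3-)[THEN sample_walk_permutes[OF s]]
      have upd: "walk (\<lambda>i. \<pi> ((s(b := g, a := h)) i)) f v = ?W f v"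
        if "a \<notin> set v" "b \<notin> set v" for f v g h
        using that by (intro walk_cong) auto
      have "F (s(b := g, a := h)) = fixc (signed (\<not> e2) (\<pi> g) \<circ> ?W e1 w4 \<circ> signed (\<not> e1) (\<pi> h)
          \<circ> ?W (\<not> e2) w3 \<circ> signed (\<not> (\<not> e2)) (\<pi> g) \<circ> ?W (\<not> e1) w2 \<circ> signed (\<not> (\<not> e1)) (\<pi> h)
          \<circ> (?W e w1 \<circ> ?W e2 w5))"
        if g: "g \<in> G" and h: "h \<in> G" for g h
      proof -
        have "walk (\<lambda>i. \<pi> ((s(b := g, a := h)) i)) e w = ?W e2 w5 \<circ> (signed (\<not> e2) (\<pi> g) \<circ> ?W e1 w4 \<circ> signed (\<not> e1) (\<pi> h)
          \<circ> ?W (\<not> e2) w3 \<circ> signed e2 (\<pi> g) \<circ> ?W (\<not> e1) w2 \<circ> signed e1 (\<pi> h) \<circ> ?W e w1)"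
          unfolding w_eq walk_split upd[OF \<open>a \<notin> set w1\<close> \<open>b \<notin> set w1\<close>] upd[OF 2(2,3)] upd[OF 3(2,3)]
            upd[OF 4(2,3)] upd[OF 5] e1_def[symmetric]
          using ab e3 e4 unfolding e2_def
          by (auto simp: comp_assoc e1_def)
        then show ?thesis
          unfolding F_def
          using fixc_comp_commute[of "?W e2 w5" "signed (\<not> e2) (\<pi> g) \<circ> ?W e1 w4 \<circ> signed (\<not> e1) (\<pi> h)
            \<circ> ?W (\<not> e2) w3 \<circ> signed e2 (\<pi> g) \<circ> ?W (\<not> e1) w2 \<circ> signed e1 (\<pi> h) \<circ> ?W e w1"]
            signed_pi_permutes[OF g] signed_pi_permutes[OF h] permW
          by (simp add: comp_assoc permutes_compose)
      qed
      then have "(\<Sum>g\<in>G. \<Sum>h\<in>G. F (s(b := g, a := h))) = (\<Sum>g\<in>G. \<Sum>h\<in>G. fixc (signed (\<not> e2) (\<pi> g) \<circ> ?W e1 w4 \<circ> signed (\<not> e1) (\<pi> h)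
          \<circ> ?W (\<not> e2) w3 \<circ> signed (\<not> (\<not> e2)) (\<pi> g) \<circ> ?W (\<not> e1) w2 \<circ> signed (\<not> (\<not> e1)) (\<pi> h)
          \<circ> (?W e w1 \<circ> ?W e2 w5)))"
        by (intro sum.cong refl) blast
      also have "\<dots> \<le> 2 * N * N"
        by (intro sum_fixc_signed_crossing[OF sampler_axioms] permutes_compose permW)
      finally show ?thesis .
    qed
    have "(\<Sum>s\<in>samples d. \<Sum>h\<in>G. F (s(a := h))) \<le> 2 * N * real (card (samples d))"
    proof (rule sum_samples_le[OF sub(2)])
      fix s assume "s \<in> samples d"
      from inner[OF this] show "(\<Sum>g\<in>G. \<Sum>h\<in>G. F (s(b := g, a := h))) \<le> 2 * N * N" .
    qed
    then have "N * (\<Sum>s\<in>samples d. F s) \<le> N * (2 * real (card (samples d)))"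
      unfolding sum_PiE_resample[OF sub(1)] by (simp add: mult_ac)
    then show ?thesis using N_pos unfolding F_def by simp
  qed
qed

end

section \<open>The action of the general linear group\<close>

lemma bit_double [simp]: "(x :: bit) + x = 0"
  by (cases x) simp_all

lemma bit_vec_double: "v \<in> carrier_vec k \<Longrightarrow> v + v = (0\<^sub>v k :: bit vec)"
  by (intro eq_vecI) auto

lemma bit_vec_add_cancel: "u \<in> carrier_vec k \<Longrightarrow> v \<in> carrier_vec k \<Longrightarrow> u + (u + v) = (v :: bit vec)"
  by (intro eq_vecI) (auto simp: add.assoc[symmetric])

lemma bit_vec_add_eq_zero_iff:
  assumes "u \<in> carrier_vec k" "v \<in> carrier_vec k"
  shows "u + v = 0\<^sub>v k \<longleftrightarrow> u = (v :: bit vec)"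
  using bit_vec_add_cancel[OF assms] bit_vec_double[OF assms(1)] assms by (metis right_zero_vec)

lemma vec_of_nat_carrier [simp]: "vec_of_nat k a \<in> carrier_vec k"
  by (simp add: vec_of_nat_def)

lemma vec_of_nat_0: "vec_of_nat k 0 = 0\<^sub>v k"
  by (auto simp: vec_of_nat_def)

lemma bij_betw_vec_of_nat: "bij_betw (vec_of_nat k) {..<2 ^ k} (carrier_vec k)"
proof (rule bij_betwI')
  fix a b :: nat assume ab: "a \<in> {..<2 ^ k}" "b \<in> {..<2 ^ k}"
  have "a = b" if e: "vec_of_nat k a = vec_of_nat k b"
  proof -
    have "bit a i = bit b i" if "i < k" for i
    proof -
      have "vec_of_nat k a $ i = vec_of_nat k b $ i" using e by simp
      then show ?thesis using that by (simp add: vec_of_nat_def split: if_splits)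
    qed
    then have "take_bit k a = take_bit k b" by (auto intro!: bit_eqI simp: bit_take_bit_iff)
    then show "a = b" using ab by (simp add: take_bit_nat_eq_self)
  qed
  then show "(vec_of_nat k a = vec_of_nat k b) = (a = b)" by blast
next
  fix v :: "bit vec" assume v: "v \<in> carrier_vec k"
  define bs where "bs = map (\<lambda>i. v $ i = 1) [0..<k]"
  define a :: nat where "a = horner_sum of_bool 2 bs"
  have "a < 2 ^ k" unfolding a_def using horner_sum_of_bool_2_less[of bs] by (simp add: bs_def)
  moreover have "vec_of_nat k a = v"
    using v by (intro eq_vecI) (auto simp: vec_of_nat_def a_def bit_horner_sum_bit_iff bs_def)
  ultimately show "\<exists>x\<in>{..<2 ^ k}. v = vec_of_nat k x" by blast
qed simp

lemma finite_bit_carrier_vec: "finite (carrier_vec k :: bit vec set)"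
  using bij_betw_finite[OF bij_betw_vec_of_nat[of k]] by simp

lemma card_bit_carrier_vec: "card (carrier_vec k :: bit vec set) = 2 ^ k"
  using bij_betw_same_card[OF bij_betw_vec_of_nat[of k]] by simp

lemma finite_UNIV_bit: "finite (UNIV :: bit set)"
proof -
  have "(UNIV :: bit set) = {0, 1}" by (auto intro: bit.exhaust)
  then show ?thesis by (metis finite.emptyI finite_insert)
qed

lemma finite_GL2: "finite (GL2 k)"
proof -
  let ?F = "PiE ({..<k} \<times> {..<k}) (\<lambda>_. UNIV :: bit set)"
  have "A \<in> mat k k ` ?F" if "A \<in> GL2 k" for A
  proof -
    have A: "A \<in> carrier_mat k k" using that by (simp add: GL2_def)
    have "A = mat k k (restrict (\<lambda>ij. A $$ ij) ({..<k} \<times> {..<k}))"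
      using A by (intro eq_matI) auto
    moreover have "restrict (\<lambda>ij. A $$ ij) ({..<k} \<times> {..<k}) \<in> ?F" by simp
    ultimately show ?thesis by (rule image_eqI)
  qed
  then have "GL2 k \<subseteq> mat k k ` ?F" by blast
  moreover have "finite ?F" using finite_UNIV_bit by (intro finite_PiE) auto
  ultimately show ?thesis using finite_surj by blast
qed

lemma GL2_carrier: "A \<in> GL2 k \<Longrightarrow> A \<in> carrier_mat k k"
  by (simp add: GL2_def)

lemma GL2_I:
  assumes "A \<in> carrier_mat k k" "B \<in> carrier_mat k k" "A * B = 1\<^sub>m k" "B * A = 1\<^sub>m k"
  shows "A \<in> GL2 k"
  using assms unfolding GL2_def invertible_mat_def inverts_mat_def by auto

lemma GL2_inverse:
  assumes "A \<in> GL2 k"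
  obtains B where "B \<in> carrier_mat k k" "A * B = 1\<^sub>m k" "B * A = 1\<^sub>m k"
proof -
  have A: "A \<in> carrier_mat k k" using assms by (rule GL2_carrier)
  obtain B where B: "A * B = 1\<^sub>m k" "B * A = 1\<^sub>m (dim_row B)"
    using assms A unfolding GL2_def invertible_mat_def inverts_mat_def by auto
  have "dim_col B = k" using arg_cong[OF B(1), of dim_col] by simp
  moreover have "dim_row B = k" using arg_cong[OF B(2), of dim_col] A by simp
  ultimately show ?thesis using that[of B] B by auto
qed

lemma GL2_one: "1\<^sub>m k \<in> GL2 k"
  by (rule GL2_I[of _ _ "1\<^sub>m k"]) auto

lemma GL2_mult:
  assumes "A \<in> GL2 k" "B \<in> GL2 k"
  shows "A * B \<in> GL2 k"
proof -
  obtain A' B' where A': "A' \<in> carrier_mat k k" "A * A' = 1\<^sub>m k" "A' * A = 1\<^sub>m k"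
    and B': "B' \<in> carrier_mat k k" "B * B' = 1\<^sub>m k" "B' * B = 1\<^sub>m k"
    using assms GL2_inverse by metis
  note carr = GL2_carrier[OF assms(1)] GL2_carrier[OF assms(2)] A'(1) B'(1)
  have "(A * B) * (B' * A') = A * (B * B') * A'"
    using carr by (simp add: assoc_mult_mat[of _ k k _ k _ k])
  moreover have "(B' * A') * (A * B) = B' * (A' * A) * B"
    using carr by (simp add: assoc_mult_mat[of _ k k _ k _ k])
  ultimately show ?thesis using A' B' carr by (intro GL2_I[of _ _ "B' * A'"]) auto
qed

lemma GL2_mult_vec_inj:
  assumes "A \<in> GL2 k" "x \<in> carrier_vec k" "y \<in> carrier_vec k" "A *\<^sub>v x = A *\<^sub>v y"
  shows "x = y"
proof -
  obtain B where B: "B \<in> carrier_mat k k" "B * A = 1\<^sub>m k" using GL2_inverse[OF assms(1)] by metis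
  note A = GL2_carrier[OF assms(1)]
  have "B *\<^sub>v (A *\<^sub>v z) = z" if "z \<in> carrier_vec k" for z
    using assoc_mult_mat_vec[OF B(1) A that] B(2) that by simp
  then show ?thesis using assms by metis
qed

lemma mult_mat_zero_vec: "A \<in> carrier_mat k k \<Longrightarrow> A *\<^sub>v 0\<^sub>v k = (0\<^sub>v k :: 'a :: semiring_0 vec)"
  by (intro eq_vecI) auto

text \<open>A subgroup maximal among those avoiding \<open>y\<close> and \<open>y'\<close> has index two, so the indicator of
  its complement is a linear functional; it takes the value one at both \<open>y\<close> and \<open>y'\<close>.\<close>

lemma separating_additive_map:
  fixes S :: "bit vec set"
  assumes S: "S \<subseteq> carrier_vec k" "0\<^sub>v k \<in> S" "\<And>u v. u \<in> S \<Longrightarrow> v \<in> S \<Longrightarrow> u + v \<in> S"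
    and y: "y \<in> carrier_vec k" "y \<notin> S" and y': "y' \<in> carrier_vec k" "y' \<notin> S"
  shows "\<exists>\<phi> :: bit vec \<Rightarrow> bit. (\<forall>u\<in>carrier_vec k. \<forall>v\<in>carrier_vec k. \<phi> (u + v) = \<phi> u + \<phi> v)
    \<and> (\<forall>u\<in>S. \<phi> u = 0) \<and> \<phi> y = 1 \<and> \<phi> y' = 1"
proof -
  define \<S> where "\<S> = {T. S \<subseteq> T \<and> T \<subseteq> carrier_vec k \<and> (\<forall>u\<in>T. \<forall>v\<in>T. u + v \<in> T) \<and> y \<notin> T \<and> y' \<notin> T}"
  have "finite \<S>" unfolding \<S>_def
    by (rule finite_subset[of _ "Pow (carrier_vec k)"]) (auto simp: finite_bit_carrier_vec)
  moreover have "S \<in> \<S>" using S y y' by (simp add: \<S>_def)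
  ultimately obtain T where T: "T \<in> \<S>" and max: "\<And>T'. T' \<in> \<S> \<Longrightarrow> T \<subseteq> T' \<Longrightarrow> T = T'"
    using finite_has_maximal2 by metis
  have T': "S \<subseteq> T" "T \<subseteq> carrier_vec k" "\<And>u v. u \<in> T \<Longrightarrow> v \<in> T \<Longrightarrow> u + v \<in> T" "y \<notin> T" "y' \<notin> T"
    using T unfolding \<S>_def by auto
  have T0: "0\<^sub>v k \<in> T" using S T' by auto
  have comm: "u + v = v + u" if "u \<in> carrier_vec k" "v \<in> carrier_vec k" for u v :: "bit vec"
    using that by (rule comm_add_vec)
  have cosets: "x + y \<in> T \<or> x + y' \<in> T" if x: "x \<in> carrier_vec k" "x \<notin> T" for x
  proof -
    \<comment> \<open>In characteristic two this is the subgroup generated by \<open>T\<close> and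
      \<open>x\<close>. By maximality of \<open>T\<close> it must contain \<open>y\<close> or
      \<open>y'\<close>.\<close>
    define T2 where "T2 = T \<union> (\<lambda>t. x + t) ` T"
    have closed: "u + v \<in> T2" if "u \<in> T2" "v \<in> T2" for u v
    proof -
      have 1: "x + s + t = x + (s + t)" "s + (x + t) = x + (s + t)" "x + s + (x + t) = s + t"
        if "s \<in> T" "t \<in> T" for s t
      proof -
        have c: "s \<in> carrier_vec k" "t \<in> carrier_vec k" using that T'(2) by auto
        show "x + s + t = x + (s + t)" using x c by simp
        show "s + (x + t) = x + (s + t)" using x c by (intro eq_vecI) (auto simp: add_ac)
        have "x + s + (x + t) = (x + x) + (s + t)" using x c by (intro eq_vecI) (auto simp: add_ac)
        then show "x + s + (x + t) = s + t" using x c by (simp add: bit_vec_double)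
      qed
      show ?thesis using that 1 T'(3) unfolding T2_def by (auto simp: image_iff) 
    qed
    have "x + 0\<^sub>v k \<in> T2" using T0 unfolding T2_def by blast
    then have "x \<in> T2" using x by simp
    then have "T2 \<noteq> T" using x by blast
    then have "T2 \<notin> \<S>" using max[of T2] by (auto simp: T2_def)
    moreover have "S \<subseteq> T2" "T2 \<subseteq> carrier_vec k" using T' x by (auto simp: T2_def)
    ultimately have "y \<in> T2 \<or> y' \<in> T2" using closed unfolding \<S>_def by blast
    then obtain t where "t \<in> T" "y = x + t \<or> y' = x + t" using T' by (auto simp: T2_def)
    then show ?thesis using bit_vec_add_cancel[OF x(1), of t] T'(2) by auto
  qed
  \<comment> \<open>Otherwise the previous step, applied to \<open>y + y'\<close>, would put
    \<open>y\<close> or \<open>y'\<close> itself into \<open>T\<close>. With this the two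
    alternatives of \<open>cosets\<close> coincide, so \<open>T\<close> has a single other
    coset.\<close>
  have yy': "y + y' \<in> T"
  proof (rule ccontr)
    assume "y + y' \<notin> T"
    then have "y + y' + y \<in> T \<or> y + y' + y' \<in> T" using cosets[of "y + y'"] y y' by simp
    moreover have "y + y' + y = y + (y + y')" using y y' by (intro eq_vecI) (auto simp: add_ac)
    moreover have "y + y' + y' = y' + (y' + y)" using y y' by (intro eq_vecI) (auto simp: add_ac)
    ultimately show False using T' y y' by (simp add: bit_vec_add_cancel)
  qed
  have coset: "x + y \<in> T" if x: "x \<in> carrier_vec k" "x \<notin> T" for x
  proof (cases "x + y \<in> T")
    case False
    then have "(x + y') + (y + y') \<in> T" using cosets[OF x] yy' T'(3) by blast
    moreover have "(x + y') + (y + y') = (x + y) + (y' + y')"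
      using x y y' by (intro eq_vecI) (auto simp: add_ac)
    ultimately show ?thesis using x y y' by (simp add: bit_vec_double)
  qed
  define \<phi> :: "bit vec \<Rightarrow> bit" where "\<phi> u = (if u \<in> T then 0 else 1)" for u
  have T_add_iff: "u + v \<in> T \<longleftrightarrow> (u \<in> T \<longleftrightarrow> v \<in> T)" if u: "u \<in> carrier_vec k" and v: "v \<in> carrier_vec k" for u v
  proof -
    have a: "v \<in> T" if "u \<in> T" "u + v \<in> T" "u \<in> carrier_vec k" "v \<in> carrier_vec k" for u v
      using T'(3)[OF that(1,2)] bit_vec_add_cancel[OF that(3,4)] by simp
    show ?thesis
    proof (cases "u \<in> T \<or> v \<in> T")
      case True
      then show ?thesis using a[of u v] a[of v u] u v T'(3)[of u v] comm[OF u v] by auto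
    next
      case False
      then have "(u + y) + (v + y) \<in> T" using coset u v T'(3) by blast
      moreover have "(u + y) + (v + y) = (u + v) + (y + y)"
        using u v y by (intro eq_vecI) (auto simp: add_ac)
      ultimately show ?thesis using False u v y by (simp add: bit_vec_double)
    qed
  qed
  have "\<phi> (u + v) = \<phi> u + \<phi> v" if "u \<in> carrier_vec k" "v \<in> carrier_vec k" for u v
    using T_add_iff[OF that] by (auto simp: \<phi>_def)
  then show ?thesis using T' by (intro exI[of _ \<phi>]) (auto simp: \<phi>_def)
qed

text \<open>Over the field with two elements an additive map is linear, the only scalars being 0 and
  1. The proof restores the coordinates of \<open>x\<close> one at a time.\<close>

lemma additive_eq_scalar_prod:
  fixes \<phi> :: "bit vec \<Rightarrow> bit"
  assumes add: "\<And>u v. u \<in> carrier_vec k \<Longrightarrow> v \<in> carrier_vec k \<Longrightarrow> \<phi> (u + v) = \<phi> u + \<phi> v"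
    and x: "x \<in> carrier_vec k"
  shows "\<phi> x = (\<Sum>i<k. \<phi> (unit_vec k i) * x $ i)"
proof -
  have zero: "\<phi> (0\<^sub>v k) = 0" using add[of "0\<^sub>v k" "0\<^sub>v k"] by simp
  define t where "t r = vec k (\<lambda>i. if i < r then x $ i else 0)" for r
  have "\<phi> (t r) = (\<Sum>i<r. \<phi> (unit_vec k i) * x $ i)" if "r \<le> k" for r
    using that
  proof (induction r)
    case 0
    have "t 0 = 0\<^sub>v k" by (auto simp: t_def)
    then show ?case using zero by simp
  next
    case (Suc r)
    have "t (Suc r) = t r + x $ r \<cdot>\<^sub>v unit_vec k r"
      using Suc by (intro eq_vecI) (auto simp: t_def less_Suc_eq)
    then have "\<phi> (t (Suc r)) = \<phi> (t r) + \<phi> (x $ r \<cdot>\<^sub>v unit_vec k r)"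
      by (simp add: add t_def)
    also have "\<phi> (x $ r \<cdot>\<^sub>v unit_vec k r) = \<phi> (unit_vec k r) * x $ r"
    proof (cases "x $ r = 0")
      case True
      have "(0 :: bit) \<cdot>\<^sub>v unit_vec k r = 0\<^sub>v k" by (intro eq_vecI) auto
      then show ?thesis using True zero by simp
    next
      case False
      have "(1 :: bit) \<cdot>\<^sub>v unit_vec k r = unit_vec k r" by (intro eq_vecI) auto
      then show ?thesis using False by simp
    qed
    finally show ?case using Suc by simp
  qed
  moreover have "t k = x" using x by (auto simp: t_def)
  ultimately show ?thesis by (metis order_refl)
qed

text \<open>The witness is the transvection sending x to x + \<phi>(x) (y + y'), where \<phi>
  vanishes on \<open>S\<close> and equals one at \<open>y\<close> and \<open>y'\<close>. Since
  \<phi>(y + y') = 1 + 1 = 0, it is an involution and so its own inverse.\<close>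

lemma GL2_fixing_transitive:
  fixes S :: "bit vec set"
  assumes S: "S \<subseteq> carrier_vec k" "0\<^sub>v k \<in> S" "\<And>u v. u \<in> S \<Longrightarrow> v \<in> S \<Longrightarrow> u + v \<in> S"
    and y: "y \<in> carrier_vec k" "y \<notin> S" and y': "y' \<in> carrier_vec k" "y' \<notin> S"
  obtains A where "A \<in> GL2 k" "A *\<^sub>v y = y'" "\<And>x. x \<in> S \<Longrightarrow> A *\<^sub>v x = x"
proof -
  obtain \<phi> :: "bit vec \<Rightarrow> bit" where add: "\<And>u v. u \<in> carrier_vec k \<Longrightarrow> v \<in> carrier_vec k \<Longrightarrow> \<phi> (u + v) = \<phi> u + \<phi> v"
    and \<phi>: "\<And>u. u \<in> S \<Longrightarrow> \<phi> u = 0" "\<phi> y = 1" "\<phi> y' = 1"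
    using separating_additive_map[OF S y y'] by metis
  define f where "f i = \<phi> (unit_vec k i)" for i
  define u where "u = y + y'"
  have u: "u \<in> carrier_vec k" using y y' by (simp add: u_def)
  have fu: "(\<Sum>i<k. f i * u $ i) = 0"
    using additive_eq_scalar_prod[OF add u] add[OF y(1) y'(1)] \<phi> by (simp add: f_def u_def)
  define U where "U = mat k k (\<lambda>(i,j). u $ i * f j)"
  have U: "U \<in> carrier_mat k k" by (simp add: U_def)
  have Ux: "U *\<^sub>v x = \<phi> x \<cdot>\<^sub>v u" if x: "x \<in> carrier_vec k" for x
  proof (rule eq_vecI)
    fix i assume "i < dim_vec (\<phi> x \<cdot>\<^sub>v u)"
    then have i: "i < k" using u by simp
    have "(U *\<^sub>v x) $ i = (\<Sum>j<k. u $ i * (f j * x $ j))"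
      using i x by (simp add: U_def scalar_prod_def lessThan_atLeast0 mult.assoc)
    also have "\<dots> = u $ i * (\<Sum>j<k. f j * x $ j)"
      by (simp only: sum_distrib_left)
    also have "(\<Sum>j<k. f j * x $ j) = \<phi> x"
      unfolding f_def by (rule additive_eq_scalar_prod[OF add x, symmetric])
    finally show "(U *\<^sub>v x) $ i = (\<phi> x \<cdot>\<^sub>v u) $ i" using i u by (simp add: mult.commute)
  qed (use u U in auto)
  have UU: "U * U = 0\<^sub>m k k"
  proof (rule eq_matI)
    fix i j assume "i < dim_row (0\<^sub>m k k :: bit mat)" "j < dim_col (0\<^sub>m k k :: bit mat)"
    then have ij: "i < k" "j < k" by auto
    have "(U * U) $$ (i,j) = row U i \<bullet> col U j" using ij U by simp
    also have "\<dots> = (\<Sum>l<k. u $ i * f l * (u $ l * f j))"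
      unfolding scalar_prod_def using ij by (intro sum.cong) (auto simp: U_def)
    also have "\<dots> = (\<Sum>l<k. u $ i * f j * (f l * u $ l))"
      by (simp only: mult_ac)
    also have "\<dots> = u $ i * f j * (\<Sum>l<k. f l * u $ l)" by (simp only: sum_distrib_left)
    finally show "(U * U) $$ (i,j) = 0\<^sub>m k k $$ (i,j)" using ij fu by simp
  qed (use U in auto)
  define A where "A = 1\<^sub>m k + U"
  have A: "A \<in> carrier_mat k k" using U by (simp add: A_def)
  have "A * A = (1\<^sub>m k + U) + (U + U * U)"
    unfolding A_def
    using U add_mult_distrib_mat[of "1\<^sub>m k" k k U "1\<^sub>m k + U" k] mult_add_distrib_mat[of U k k "1\<^sub>m k" k U]
    by simp
  also have "\<dots> = 1\<^sub>m k"
    unfolding UU using U by (intro eq_matI) (auto simp: add.assoc)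
  finally have GL: "A \<in> GL2 k" using A by (intro GL2_I[of A k A])
  have Ax: "A *\<^sub>v x = x + \<phi> x \<cdot>\<^sub>v u" if "x \<in> carrier_vec k" for x
    unfolding A_def using U Ux[OF that] that by (simp add: add_mult_distrib_mat_vec[of _ k k])
  have Ay: "y + \<phi> y \<cdot>\<^sub>v u = y'"
    using \<phi> u y y' bit_vec_add_cancel[OF y(1) y'(1)] by (simp add: u_def)
  have "A *\<^sub>v x = x" if x: "x \<in> S" for x
  proof -
    have xc: "x \<in> carrier_vec k" using x S(1) by blast
    have "(0 :: bit) \<cdot>\<^sub>v u = 0\<^sub>v k" using u by (intro eq_vecI) auto
    then show ?thesis using Ax[OF xc] \<phi>(1)[OF x] xc by simp
  qed
  then show ?thesis using that[OF GL] Ax[OF y(1)] Ay by simp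
qed

text \<open>Left multiplication by the matrix of the preceding lemma matches up the elements of
  \<open>F\<close> with the various images of \<open>c\<close> outside \<open>S\<close>.\<close>

lemma card_GL2_extend:
  fixes S :: "bit vec set"
  assumes S: "S \<subseteq> carrier_vec k" "0\<^sub>v k \<in> S" "\<And>u v. u \<in> S \<Longrightarrow> v \<in> S \<Longrightarrow> u + v \<in> S"
    and y: "y \<in> carrier_vec k" "y \<notin> S" and c: "c \<in> carrier_vec k"
    and F: "F \<subseteq> GL2 k" "\<And>A H. A \<in> F \<Longrightarrow> H \<in> GL2 k \<Longrightarrow> (\<And>x. x \<in> S \<Longrightarrow> H *\<^sub>v x = x) \<Longrightarrow> H * A \<in> F"
  shows "real (card {A \<in> F. A *\<^sub>v c = y}) * (2 ^ k - real (card S)) \<le> real (card F)"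
proof -
  have finF: "finite F" using F(1) finite_GL2 finite_subset by blast
  define B where "B = carrier_vec k - S"
  have finB: "finite B" using finite_bit_carrier_vec by (simp add: B_def)
  have finS: "finite S" using S(1) finite_bit_carrier_vec finite_subset by blast
  have cardB: "real (card B) = 2 ^ k - real (card S)"
    unfolding B_def using S(1) finS card_mono[OF finite_bit_carrier_vec S(1)]
    by (simp add: card_Diff_subset card_bit_carrier_vec of_nat_diff)
  define T where "T z = {A \<in> F. A *\<^sub>v c = z}" for z
  have le: "card (T y) \<le> card (T z)" if z: "z \<in> B" for z
  proof -
    obtain H where H: "H \<in> GL2 k" "H *\<^sub>v y = z" "\<And>x. x \<in> S \<Longrightarrow> H *\<^sub>v x = x"
      using GL2_fixing_transitive[OF S y, of z] z unfolding B_def by auto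
    obtain H' where H': "H' \<in> carrier_mat k k" "H' * H = 1\<^sub>m k" using GL2_inverse[OF H(1)] by metis
    note Hc = GL2_carrier[OF H(1)]
    have "inj_on (\<lambda>A. H * A) (T y)"
    proof (rule inj_on_inverseI[where g = "\<lambda>A. H' * A"])
      fix A assume "A \<in> T y"
      then have "A \<in> carrier_mat k k" using F(1) GL2_carrier by (auto simp: T_def)
      then show "H' * (H * A) = A" using H' Hc by (simp add: assoc_mult_mat[symmetric, of _ k k _ k _ k])
    qed
    moreover have "(\<lambda>A. H * A) ` T y \<subseteq> T z"
    proof (rule image_subsetI)
      fix A assume A: "A \<in> T y"
      then have "A \<in> carrier_mat k k" using F(1) GL2_carrier by (auto simp: T_def)
      then have "H * A *\<^sub>v c = H *\<^sub>v y"
        using A Hc c by (simp add: T_def assoc_mult_mat_vec[of _ k k _ k])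
      then show "H * A \<in> T z" using F(2)[of A H] A H by (simp add: T_def)
    qed
    moreover have "finite (T z)" using finF by (simp add: T_def)
    ultimately show ?thesis by (rule card_inj_on_le)
  qed
  have "card (T y) * card B = (\<Sum>z\<in>B. card (T y))" by simp
  also have "\<dots> \<le> (\<Sum>z\<in>B. card (T z))" by (intro sum_mono le)
  also have "\<dots> = card (\<Union>z\<in>B. T z)"
    using finB finF by (intro card_UN_disjoint[symmetric]) (auto simp: T_def)
  also have "\<dots> \<le> card F" using finF by (intro card_mono) (auto simp: T_def)
  finally have "real (card (T y)) * real (card B) \<le> real (card F)"
    by (simp flip: of_nat_mult)
  then show ?thesis unfolding T_def cardB .
qed


section \<open>Nonzero vectors indexed by the numbers below 2^k - 1\<close>

definition nonzero_vec :: "nat \<Rightarrow> nat \<Rightarrow> bit vec" where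
  "nonzero_vec k a = vec_of_nat k (a + 1)"

definition vec_index :: "nat \<Rightarrow> bit vec \<Rightarrow> nat" where
  "vec_index k = inv_into {..<2 ^ k - 1} (nonzero_vec k)"

text \<open>Indices out of range are fixed so that this is a permutation of the index set in the
  sense of \<open>permutes\<close>, with a global inverse.\<close>

definition GL2_perm :: "nat \<Rightarrow> bit mat \<Rightarrow> nat \<Rightarrow> nat" where
  "GL2_perm k A a = (if a < 2 ^ k - 1 then vec_index k (A *\<^sub>v nonzero_vec k a) else a)"

text \<open>For equal arguments the sum is the zero vector, which has no index; hence the laws of
  \<open>add\<close> in \<open>sampler\<close> speak of distinct points.\<close>

definition index_add :: "nat \<Rightarrow> nat \<Rightarrow> nat \<Rightarrow> nat" where
  "index_add k a b = vec_index k (nonzero_vec k a + nonzero_vec k b)"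

lemma bij_betw_nonzero_vec: "bij_betw (nonzero_vec k) {..<2 ^ k - 1} (carrier_vec k - {0\<^sub>v k})"
proof -
  have "bij_betw (vec_of_nat k) ({..<2 ^ k} - {0}) (carrier_vec k - {0\<^sub>v k})"
    using bij_betw_DiffI[OF bij_betw_vec_of_nat[of k], of "{0}" "{0\<^sub>v k}"]
    by (simp add: vec_of_nat_0 bij_betw_def)
  moreover have "bij_betw (\<lambda>a. a + 1) {..<2 ^ k - 1} ({..<2 ^ k} - {0 :: nat})"
    by (rule bij_betw_byWitness[where f' = "\<lambda>a. a - 1"]) auto
  ultimately have "bij_betw (vec_of_nat k \<circ> (\<lambda>a. a + 1)) {..<2 ^ k - 1} (carrier_vec k - {0\<^sub>v k})"
    by (metis bij_betw_trans)
  then show ?thesis by (simp add: nonzero_vec_def o_def cong: bij_betw_cong)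
qed

lemma nonzero_vec_mem: "a < 2 ^ k - 1 \<Longrightarrow> nonzero_vec k a \<in> carrier_vec k \<and> nonzero_vec k a \<noteq> 0\<^sub>v k"
  using bij_betw_apply[OF bij_betw_nonzero_vec[of k], of a] by auto

lemma nonzero_vec_eq_iff: "a < 2 ^ k - 1 \<Longrightarrow> b < 2 ^ k - 1 \<Longrightarrow> nonzero_vec k a = nonzero_vec k b \<longleftrightarrow> a = b"
  using bij_betw_nonzero_vec[of k] by (auto simp: bij_betw_def dest: inj_onD)

lemma vec_index_less:
  assumes "v \<in> carrier_vec k" "v \<noteq> 0\<^sub>v k"
  shows "vec_index k v < 2 ^ k - 1" "nonzero_vec k (vec_index k v) = v"
proof -
  have "v \<in> nonzero_vec k ` {..<2 ^ k - 1}"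
    using assms bij_betw_nonzero_vec[of k] by (simp add: bij_betw_def)
  then show "vec_index k v < 2 ^ k - 1" "nonzero_vec k (vec_index k v) = v"
    using inv_into_into[of v "nonzero_vec k" "{..<2 ^ k - 1}"] f_inv_into_f[of v "nonzero_vec k" "{..<2 ^ k - 1}"]
    by (simp_all add: vec_index_def)
qed

lemma GL2_nonzero:
  assumes "A \<in> GL2 k" "x \<in> carrier_vec k" "x \<noteq> 0\<^sub>v k"
  shows "A *\<^sub>v x \<in> carrier_vec k" "A *\<^sub>v x \<noteq> 0\<^sub>v k"
proof -
  show "A *\<^sub>v x \<in> carrier_vec k" using GL2_carrier[OF assms(1)] assms(2) by simp
  show "A *\<^sub>v x \<noteq> 0\<^sub>v k"
    using GL2_mult_vec_inj[OF assms(1,2), of "0\<^sub>v k"] mult_mat_zero_vec[OF GL2_carrier[OF assms(1)]] assms(3)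
    by auto
qed

lemma GL2_perm_vec:
  assumes "A \<in> GL2 k" "a < 2 ^ k - 1"
  shows "GL2_perm k A a < 2 ^ k - 1" "nonzero_vec k (GL2_perm k A a) = A *\<^sub>v nonzero_vec k a"
  using vec_index_less[OF GL2_nonzero[OF assms(1)], of "nonzero_vec k a"] nonzero_vec_mem[OF assms(2)] assms(2)
  by (simp_all add: GL2_perm_def)

lemma GL2_perm_eq_iff:
  assumes "A \<in> GL2 k" "a < 2 ^ k - 1" "b < 2 ^ k - 1"
  shows "GL2_perm k A a = b \<longleftrightarrow> A *\<^sub>v nonzero_vec k a = nonzero_vec k b"
  using GL2_perm_vec[OF assms(1,2)] nonzero_vec_eq_iff[of "GL2_perm k A a" k b] assms(3) by metis

lemma GL2_perm_permutes:
  assumes A: "A \<in> GL2 k"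
  shows "GL2_perm k A permutes {..<2 ^ k - 1}"
proof (rule bij_imp_permutes)
  have inj: "inj_on (GL2_perm k A) {..<2 ^ k - 1}"
  proof (rule inj_onI)
    fix a b assume ab: "a \<in> {..<2 ^ k - 1}" "b \<in> {..<2 ^ k - 1}" "GL2_perm k A a = GL2_perm k A b"
    then have "A *\<^sub>v nonzero_vec k a = A *\<^sub>v nonzero_vec k b"
      using GL2_perm_vec[OF A] by (metis lessThan_iff)
    then show "a = b"
      using GL2_mult_vec_inj[OF A] nonzero_vec_mem nonzero_vec_eq_iff ab by (metis lessThan_iff)
  qed
  moreover have "GL2_perm k A ` {..<2 ^ k - 1} \<subseteq> {..<2 ^ k - 1}" using GL2_perm_vec[OF A] by auto
  ultimately have "GL2_perm k A ` {..<2 ^ k - 1} = {..<2 ^ k - 1}"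
    by (intro endo_inj_surj) auto
  then show "bij_betw (GL2_perm k A) {..<2 ^ k - 1} {..<2 ^ k - 1}" using inj by (simp add: bij_betw_def)
qed (simp add: GL2_perm_def)

lemma index_add:
  assumes "a < 2 ^ k - 1" "b < 2 ^ k - 1" "a \<noteq> b"
  shows "index_add k a b < 2 ^ k - 1" "nonzero_vec k (index_add k a b) = nonzero_vec k a + nonzero_vec k b"
proof -
  have "nonzero_vec k a + nonzero_vec k b \<noteq> 0\<^sub>v k"
    using assms nonzero_vec_mem bit_vec_add_eq_zero_iff nonzero_vec_eq_iff by metis
  then show "index_add k a b < 2 ^ k - 1" "nonzero_vec k (index_add k a b) = nonzero_vec k a + nonzero_vec k b"
    using vec_index_less[of "nonzero_vec k a + nonzero_vec k b" k] nonzero_vec_mem assms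
    by (simp_all add: index_add_def)
qed

lemma card_GL2_one_point:
  assumes "c \<in> carrier_vec k" "y \<in> carrier_vec k" "y \<noteq> 0\<^sub>v k"
  shows "real (card {A \<in> GL2 k. A *\<^sub>v c = y}) * (2 ^ k - 1) \<le> real (card (GL2 k))"
  using card_GL2_extend[of "{0\<^sub>v k}" k y c "GL2 k"] assms GL2_mult by auto

text \<open>The matrices with A c = y are stable under left multiplication by matrices that fix y,
  so the extension count applies with \<open>S\<close> the span of y. The factors 2^k - 1, 2^k - 2
  and 2^k - 4, as in the order formula of the group, count the vectors outside the span of the
  images already prescribed.\<close>

lemma card_GL2_two_points:
  assumes c: "c \<in> carrier_vec k" "c' \<in> carrier_vec k" "c \<noteq> c'"
    and y: "y \<in> carrier_vec k" "y \<noteq> 0\<^sub>v k" "y' \<in> carrier_vec k" "y' \<noteq> 0\<^sub>v k"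
  shows "real (card {A \<in> GL2 k. A *\<^sub>v c = y \<and> A *\<^sub>v c' = y'}) * (2 ^ k - 2)
    \<le> real (card {A \<in> GL2 k. A *\<^sub>v c = y})"
proof (cases "y = y'")
  case True
  then have "{A \<in> GL2 k. A *\<^sub>v c = y \<and> A *\<^sub>v c' = y'} = {}"
    using GL2_mult_vec_inj c by blast
  then show ?thesis by (simp only: card.empty)
next
  case False
  let ?F = "{A \<in> GL2 k. A *\<^sub>v c = y}"
  have "real (card {A \<in> ?F. A *\<^sub>v c' = y'}) * (2 ^ k - real (card {0\<^sub>v k, y})) \<le> real (card ?F)"
  proof (rule card_GL2_extend)
    fix A H assume AH: "A \<in> ?F" "H \<in> GL2 k" "\<And>x. x \<in> {0\<^sub>v k, y} \<Longrightarrow> H *\<^sub>v x = x"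
    then have "H * A *\<^sub>v c = H *\<^sub>v (A *\<^sub>v c)"
      using c GL2_carrier by (intro assoc_mult_mat_vec[of _ k k _ k]) auto
    then show "H * A \<in> ?F" using AH GL2_mult by auto
  qed (use c y False in \<open>auto simp: bit_vec_double\<close>)
  then show ?thesis using y by (simp add: conj_assoc)
qed

lemma card_GL2_three_points:
  assumes c: "c \<in> carrier_vec k" "c' \<in> carrier_vec k" "c \<noteq> c'" "c'' \<in> carrier_vec k" "c'' \<notin> {c, c', c + c'}"
    and y: "y \<in> carrier_vec k" "y \<noteq> 0\<^sub>v k" "y' \<in> carrier_vec k" "y' \<noteq> 0\<^sub>v k" "y'' \<in> carrier_vec k" "y'' \<noteq> 0\<^sub>v k"
  shows "real (card {A \<in> GL2 k. A *\<^sub>v c = y \<and> A *\<^sub>v c' = y' \<and> A *\<^sub>v c'' = y''}) * (2 ^ k - 4)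
    \<le> real (card {A \<in> GL2 k. A *\<^sub>v c = y \<and> A *\<^sub>v c' = y'})"
proof (cases "y = y' \<or> y'' \<in> {y, y', y + y'}")
  case True
  have "False" if A: "A \<in> GL2 k" "A *\<^sub>v c = y" "A *\<^sub>v c' = y'" "A *\<^sub>v c'' = y''" for A
  proof -
    note Ac = GL2_carrier[OF A(1)]
    have "A *\<^sub>v (c + c') = y + y'" using A Ac c by (simp add: mult_add_distrib_mat_vec[of _ k k])
    then consider "A *\<^sub>v c = A *\<^sub>v c'" | "A *\<^sub>v c'' = A *\<^sub>v c" | "A *\<^sub>v c'' = A *\<^sub>v c'"
      | "A *\<^sub>v c'' = A *\<^sub>v (c + c')"
      using True A by auto
    then show False
      using GL2_mult_vec_inj[OF A(1)] c by cases (metis add_carrier_vec insertCI)+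
  qed
  then have "{A \<in> GL2 k. A *\<^sub>v c = y \<and> A *\<^sub>v c' = y' \<and> A *\<^sub>v c'' = y''} = {}" by blast
  then show ?thesis by (simp only: card.empty)
next
  case False
  let ?F = "{A \<in> GL2 k. A *\<^sub>v c = y \<and> A *\<^sub>v c' = y'}"
  let ?S = "{0\<^sub>v k, y, y', y + y'}"
  have cancel: "y' + (y + y') = y" "y + y' + y = y'" "y + y' + y' = y" "y' + y = y + y'"
    using y by (auto intro!: eq_vecI simp: add_ac)
  have "real (card {A \<in> ?F. A *\<^sub>v c'' = y''}) * (2 ^ k - real (card ?S)) \<le> real (card ?F)"
  proof (rule card_GL2_extend)
    fix u v assume "u \<in> ?S" "v \<in> ?S"
    then show "u + v \<in> ?S"
      using y cancel bit_vec_double[of y k] bit_vec_double[of y' k] bit_vec_double[of "y + y'" k]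
        bit_vec_add_cancel[of y k y'] by auto
  next
    fix A H assume AH: "A \<in> ?F" "H \<in> GL2 k" "\<And>x. x \<in> ?S \<Longrightarrow> H *\<^sub>v x = x"
    then have "H * A *\<^sub>v z = H *\<^sub>v (A *\<^sub>v z)" if "z \<in> carrier_vec k" for z
      using that GL2_carrier by (intro assoc_mult_mat_vec[of _ k k _ k]) auto
    then show "H * A \<in> ?F" using AH GL2_mult c by auto
  qed (use c y False in auto)
  moreover have "card ?S = 4"
  proof -
    have "y + y' \<noteq> 0\<^sub>v k" using False y bit_vec_add_eq_zero_iff by blast
    moreover have "y + y' \<noteq> y" using cancel y by (metis bit_vec_double)
    moreover have "y + y' \<noteq> y'" using cancel y by (metis bit_vec_double)
    ultimately show ?thesis using y False by auto
  qed
  ultimately show ?thesis by (simp add: conj_assoc)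
qed

text \<open>Turns a bound relative to fewer prescribed points into one relative to the whole group.
  Division by zero yields 0, hence the last premise.\<close>

lemma le_divide_mult:
  fixes a b c x y :: real
  assumes "a * y \<le> b" "b \<le> c / x" "y \<ge> 0" "x > 0" "y = 0 \<Longrightarrow> a \<le> 0"
  shows "a \<le> c / (x * y)"
proof (cases "y = 0")
  case False
  then have "y > 0" "a * y \<le> c / x" using assms by auto
  then have "a \<le> (c / x) / y" by (simp only: pos_le_divide_eq)
  then show ?thesis by simp
qed (use assms in auto)

lemma sampler_GL2:
  assumes k: "k \<ge> 2"
  shows "sampler {..<2 ^ k - 1} (index_add k) (GL2 k) (GL2_perm k)"
proof
  have "(2 :: nat) ^ 2 \<le> 2 ^ k" using k by (intro power_increasing) auto
  then have k4: "(4 :: nat) \<le> 2 ^ k" by simp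
  then show "3 \<le> card {..<(2 :: nat) ^ k - 1}" by simp
  have "real 4 \<le> real (2 ^ k)" using k4 of_nat_le_iff by blast
  then have k4': "(4 :: real) \<le> 2 ^ k" by simp
  have n: "real (card {..<(2 :: nat) ^ k - 1}) = 2 ^ k - 1" using k4 by (simp add: of_nat_diff)
  show "finite (GL2 k)" by (rule finite_GL2)
  show "GL2 k \<noteq> {}" using GL2_one by blast
  show "GL2_perm k g permutes {..<2 ^ k - 1}" if "g \<in> GL2 k" for g
    by (rule GL2_perm_permutes[OF that])
  show "index_add k x y \<in> {..<2 ^ k - 1}" if "x \<in> {..<2 ^ k - 1}" "y \<in> {..<2 ^ k - 1}" "x \<noteq> y" for x y
    using index_add that by simp
  show "index_add k x (index_add k x y) = y"
    if "x \<in> {..<2 ^ k - 1}" "y \<in> {..<2 ^ k - 1}" "x \<noteq> y" for x y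
  proof -
    have xy: "x < 2 ^ k - 1" "y < 2 ^ k - 1" using that by auto
    have "nonzero_vec k x + nonzero_vec k (index_add k x y) = nonzero_vec k y"
      using index_add[OF xy that(3)] nonzero_vec_mem[OF xy(1)] nonzero_vec_mem[OF xy(2)]
        bit_vec_add_cancel[of "nonzero_vec k x" k "nonzero_vec k y"]
      by simp
    moreover have "vec_index k (nonzero_vec k y) = y"
      using vec_index_less[of "nonzero_vec k y" k] nonzero_vec_mem[OF xy(2)] nonzero_vec_eq_iff[OF _ xy(2)] by metis
    ultimately show ?thesis by (simp add: index_add_def[of k x "index_add k x y"])
  qed
  show "GL2_perm k g (index_add k x y) = index_add k (GL2_perm k g x) (GL2_perm k g y)"
    if g: "g \<in> GL2 k" and "x \<in> {..<2 ^ k - 1}" "y \<in> {..<2 ^ k - 1}" and ne: "x \<noteq> y" for g x y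
  proof -
    have xy: "x < 2 ^ k - 1" "y < 2 ^ k - 1" using that by auto
    have ne': "GL2_perm k g x \<noteq> GL2_perm k g y"
      using permutes_inj[OF GL2_perm_permutes[OF g]] ne by (auto dest: injD)
    note px = GL2_perm_vec[OF g xy(1)] and py = GL2_perm_vec[OF g xy(2)]
    have "g *\<^sub>v nonzero_vec k (index_add k x y) = nonzero_vec k (index_add k (GL2_perm k g x) (GL2_perm k g y))"
      using index_add[OF xy ne] index_add[OF px(1) py(1) ne'] px(2) py(2) GL2_carrier[OF g]
        nonzero_vec_mem[OF xy(1)] nonzero_vec_mem[OF xy(2)]
      by (simp add: mult_add_distrib_mat_vec[of _ k k])
    then show ?thesis
      using GL2_perm_eq_iff[OF g index_add(1)[OF xy ne] index_add(1)[OF px(1) py(1) ne']] by blast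
  qed
  have one: "real (card {A \<in> GL2 k. A *\<^sub>v c = y}) \<le> real (card (GL2 k)) / (2 ^ k - 1)"
    if "c \<in> carrier_vec k" "y \<in> carrier_vec k" "y \<noteq> 0\<^sub>v k" for c y
    using card_GL2_one_point[OF that] k4' by (simp add: pos_le_divide_eq)
  show "real (card {g \<in> GL2 k. GL2_perm k g a = b}) \<le> real (card (GL2 k)) / real (card {..<(2 :: nat) ^ k - 1})"
    if "a \<in> {..<2 ^ k - 1}" "b \<in> {..<2 ^ k - 1}" for a b
  proof -
    have "{g \<in> GL2 k. GL2_perm k g a = b} = {A \<in> GL2 k. A *\<^sub>v nonzero_vec k a = nonzero_vec k b}"
      using GL2_perm_eq_iff that by auto
    then show ?thesis unfolding n using one nonzero_vec_mem that by simp
  qed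
  have two: "real (card {A \<in> GL2 k. A *\<^sub>v c = y \<and> A *\<^sub>v c' = y'}) \<le> real (card (GL2 k)) / ((2 ^ k - 1) * (2 ^ k - 2))"
    if "c \<in> carrier_vec k" "c' \<in> carrier_vec k" "c \<noteq> c'" "y \<in> carrier_vec k" "y \<noteq> 0\<^sub>v k" "y' \<in> carrier_vec k" "y' \<noteq> 0\<^sub>v k" for c y c' y'
    by (rule le_divide_mult[OF card_GL2_two_points[OF that] one]) (use that k4' in auto)
  show "real (card {g \<in> GL2 k. GL2_perm k g a = b \<and> GL2_perm k g a' = b'})
      \<le> real (card (GL2 k)) / (real (card {..<(2 :: nat) ^ k - 1}) * (real (card {..<(2 :: nat) ^ k - 1}) - 1))"
    if ab: "a \<in> {..<2 ^ k - 1}" "a' \<in> {..<2 ^ k - 1}" "a \<noteq> a'" "b \<in> {..<2 ^ k - 1}" "b' \<in> {..<2 ^ k - 1}" for a a' b b'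
  proof -
    have e: "{g \<in> GL2 k. GL2_perm k g a = b \<and> GL2_perm k g a' = b'}
        = {A \<in> GL2 k. A *\<^sub>v nonzero_vec k a = nonzero_vec k b \<and> A *\<^sub>v nonzero_vec k a' = nonzero_vec k b'}"
      using GL2_perm_eq_iff that by auto
    have n1: "real (card {..<(2 :: nat) ^ k - 1}) - 1 = 2 ^ k - 2" unfolding n by simp
    show ?thesis unfolding e n1 unfolding n
      using ab nonzero_vec_mem nonzero_vec_eq_iff by (intro two) auto
  qed
  show "real (card {g \<in> GL2 k. GL2_perm k g a = b \<and> GL2_perm k g a' = b' \<and> GL2_perm k g a'' = b''})
      \<le> real (card (GL2 k)) / (real (card {..<(2 :: nat) ^ k - 1}) * (real (card {..<(2 :: nat) ^ k - 1}) - 1)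
        * (real (card {..<(2 :: nat) ^ k - 1}) - 3))"
    if "a \<in> {..<2 ^ k - 1}" "a' \<in> {..<2 ^ k - 1}" and ne: "a \<noteq> a'" and "a'' \<in> {..<2 ^ k - 1}"
      and nin: "a'' \<notin> {a, a', index_add k a a'}"
      and "b \<in> {..<2 ^ k - 1}" "b' \<in> {..<2 ^ k - 1}" "b'' \<in> {..<2 ^ k - 1}" for a a' a'' b b' b''
  proof -
    have ab: "a < 2 ^ k - 1" "a' < 2 ^ k - 1" "a'' < 2 ^ k - 1" "b < 2 ^ k - 1" "b' < 2 ^ k - 1" "b'' < 2 ^ k - 1"
      using that by auto
    let ?c = "nonzero_vec k a" and ?c' = "nonzero_vec k a'" and ?c'' = "nonzero_vec k a''"
    let ?y = "nonzero_vec k b" and ?y' = "nonzero_vec k b'" and ?y'' = "nonzero_vec k b''"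
    have e: "{g \<in> GL2 k. GL2_perm k g a = b \<and> GL2_perm k g a' = b' \<and> GL2_perm k g a'' = b''}
        = {A \<in> GL2 k. A *\<^sub>v ?c = ?y \<and> A *\<^sub>v ?c' = ?y' \<and> A *\<^sub>v ?c'' = ?y''}"
      using GL2_perm_eq_iff ab by auto
    have n1: "real (card {..<(2 :: nat) ^ k - 1}) - 1 = 2 ^ k - 2" "real (card {..<(2 :: nat) ^ k - 1}) - 3 = 2 ^ k - 4"
      unfolding n by simp_all
    have cne: "?c \<noteq> ?c'" using ne nonzero_vec_eq_iff ab by simp
    have cnin: "?c'' \<notin> {?c, ?c', ?c + ?c'}"
      using nin ab nonzero_vec_eq_iff index_add[OF ab(1,2) ne] by (metis insert_iff singletonD)
    have carr: "?c \<in> carrier_vec k" "?c' \<in> carrier_vec k" "?c'' \<in> carrier_vec k" "?y \<in> carrier_vec k" "?y \<noteq> 0\<^sub>v k"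
      "?y' \<in> carrier_vec k" "?y' \<noteq> 0\<^sub>v k" "?y'' \<in> carrier_vec k" "?y'' \<noteq> 0\<^sub>v k"
      using nonzero_vec_mem ab by auto
    \<comment> \<open>The indices of two vectors, of their sum and of a third vector outside their
      span are distinct, so there are at least four nonzero vectors and the divisor 2^k - 4 is
      positive. For k = 2 the premises are contradictory, in accordance with the value 0 that the
      bound takes when n - 3 = 0.\<close>
    have "card {index_add k a a', a, a', a''} \<le> card {..<(2 :: nat) ^ k - 1}"
      using ab index_add[OF ab(1,2) ne] by (intro card_mono) auto
    moreover have "index_add k a a' \<noteq> a" "index_add k a a' \<noteq> a'"
    proof -
      show "index_add k a a' \<noteq> a"
      proof
        assume "index_add k a a' = a"
        then have "?c + ?c' = ?c" using index_add(2)[OF ab(1,2) ne] by simp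
        then have "?c + (?c + ?c') = 0\<^sub>v k" using bit_vec_double carr(1) by simp
        then show False using bit_vec_add_cancel[OF carr(1,2)] nonzero_vec_mem[OF ab(2)] by simp
      qed
      show "index_add k a a' \<noteq> a'"
      proof
        assume "index_add k a a' = a'"
        then have "?c + ?c' = ?c'" using index_add(2)[OF ab(1,2) ne] by simp
        moreover have "?c + ?c' = ?c' + ?c" using carr comm_add_vec by blast
        ultimately have "?c' + (?c' + ?c) = 0\<^sub>v k" using bit_vec_double carr(2) by simp
        then show False using bit_vec_add_cancel[OF carr(2,1)] nonzero_vec_mem[OF ab(1)] by simp
      qed
    qed
    ultimately have "4 \<le> (2 :: nat) ^ k - 1" using ne nin by auto
    then have "(5 :: nat) \<le> 2 ^ k" by simp
    then have "real 5 \<le> real (2 ^ k)" using of_nat_le_iff by blast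
    then have k5: "(5 :: real) \<le> 2 ^ k" by simp
    show ?thesis unfolding e n1 unfolding n
      by (rule le_divide_mult[OF card_GL2_three_points[OF carr(1,2) cne carr(3) cnin carr(4-)] two])
        (use carr cne k5 in auto)
  qed
qed (use k in auto)

section \<open>Spectra of bipartite symmetric matrices\<close>

text \<open>The Hermitian form of \<open>A\<close> at an eigenvector equals the eigenvalue times the
  positive squared norm, and it is its own conjugate because \<open>A\<close> is real and
  symmetric.\<close>

lemma real_symmetric_eigenvalue_real:
  fixes A :: "real mat"
  assumes A: "A \<in> carrier_mat N N" and sym: "transpose_mat A = A"
    and ev: "eigenvalue (map_mat complex_of_real A) a"
  shows "a \<in> \<real>"
proof -
  let ?C = "map_mat complex_of_real A"
  obtain v where v: "v \<in> carrier_vec N" "v \<noteq> 0\<^sub>v N" "?C *\<^sub>v v = a \<cdot>\<^sub>v v"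
    using ev A unfolding eigenvalue_def eigenvector_def by auto
  have row: "(\<Sum>j<N. complex_of_real (A $$ (i,j)) * v $ j) = a * v $ i" if "i < N" for i
  proof -
    have "(?C *\<^sub>v v) $ i = (\<Sum>j<N. complex_of_real (A $$ (i,j)) * v $ j)"
      using that A v(1) by (simp add: scalar_prod_def lessThan_atLeast0)
    then show ?thesis using v that by simp
  qed
  have A_sym: "A $$ (i,j) = A $$ (j,i)" if "i < N" "j < N" for i j
    using that A sym by (metis carrier_matD index_transpose_mat(1))
  define q where "q = (\<Sum>i<N. \<Sum>j<N. cnj (v $ i) * complex_of_real (A $$ (i,j)) * v $ j)"
  define r where "r = (\<Sum>i<N. (cmod (v $ i))\<^sup>2)"
  have "q = (\<Sum>i<N. cnj (v $ i) * (a * v $ i))"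
    unfolding q_def by (intro sum.cong) (auto simp: row[symmetric] sum_distrib_left mult.assoc)
  also have "\<dots> = a * of_real r"
    unfolding r_def of_real_sum sum_distrib_left
    by (intro sum.cong refl) (metis complex_norm_square mult.commute mult.left_commute)
  finally have q: "q = a * of_real r" .
  have "cnj q = (\<Sum>i<N. \<Sum>j<N. v $ i * complex_of_real (A $$ (i,j)) * cnj (v $ j))"
    unfolding q_def by simp
  also have "\<dots> = (\<Sum>j<N. \<Sum>i<N. v $ i * complex_of_real (A $$ (i,j)) * cnj (v $ j))"
    by (rule sum.swap)
  also have "\<dots> = q"
    unfolding q_def by (intro sum.cong refl) (auto simp: A_sym mult_ac)
  finally have cq: "cnj q = q" .
  obtain i where i: "i < N" "v $ i \<noteq> 0"
    using v by (metis carrier_vecD eq_vecI index_zero_vec)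
  have "r > 0" unfolding r_def
    by (rule sum_pos2[of _ i]) (use i in auto)
  moreover have "cnj a * of_real r = a * of_real r" using cq q by simp
  ultimately have "cnj a = a" by simp
  then show ?thesis by (simp add: Reals_cnj_iff)
qed

text \<open>The characteristic polynomial splits over the complex numbers, its roots are real, and
  the factorization descends because the embedding of real into complex polynomials is
  injective.\<close>

lemma real_symmetric_char_poly_splits:
  fixes A :: "real mat"
  assumes A: "A \<in> carrier_mat N N" and sym: "transpose_mat A = A"
  obtains es where "char_poly A = (\<Prod>e\<leftarrow>es. [:- e, 1:])" "length es = N"
proof -
  let ?C = "map_mat complex_of_real A"
  have C: "?C \<in> carrier_mat N N" using A by simp
  obtain as where as: "char_poly ?C = (\<Prod>a\<leftarrow>as. [:- a, 1:])" "length as = N"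
    using char_poly_factorized[OF C] by blast
  have real: "a \<in> \<real>" if "a \<in> set as" for a
  proof (rule real_symmetric_eigenvalue_real[OF A sym])
    have "poly (char_poly ?C) a = 0" unfolding as(1) using that
      by (auto simp: poly_prod_list prod_list_zero_iff image_iff)
    then show "eigenvalue ?C a" using eigenvalue_root_char_poly[OF C] by blast
  qed
  define es where "es = map Re as"
  have as_es: "as = map complex_of_real es"
    unfolding es_def using real by (auto intro!: nth_equalityI simp: complex_is_Real_iff complex_eq_iff)
  interpret hom: map_poly_inj_idom_hom complex_of_real ..
  have "map_poly complex_of_real (char_poly A) = char_poly ?C"
    by (simp add: of_real_hom.char_poly_hom[OF A])
  also have "\<dots> = map_poly complex_of_real (\<Prod>e\<leftarrow>es. [:- e, 1:])"
    unfolding as(1) as_es by (simp add: hom.hom_prod_list o_def)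
  finally have "char_poly A = (\<Prod>e\<leftarrow>es. [:- e, 1:])"
    by simp
  then show ?thesis using that[of es] as(2) unfolding es_def by simp
qed

lemma upper_triangular_pow:
  fixes B :: "'a :: comm_semiring_1 mat"
  assumes B: "B \<in> carrier_mat N N" and ut: "upper_triangular B"
  shows "upper_triangular (B ^\<^sub>m t) \<and> (\<forall>i<N. (B ^\<^sub>m t) $$ (i,i) = (B $$ (i,i)) ^ t)"
proof (induction t)
  case 0
  then show ?case using B by auto
next
  case (Suc t)
  have P: "B ^\<^sub>m t \<in> carrier_mat N N" using B by simp
  have entry: "(B ^\<^sub>m Suc t) $$ (i,j) = (\<Sum>l<N. (B ^\<^sub>m t) $$ (i,l) * B $$ (l,j))"
    if "i < N" "j < N" for i j
    using that B P by (simp add: scalar_prod_def lessThan_atLeast0)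
  \<comment> \<open>A nonzero term needs i \<le> l \<le> j, which on and below the diagonal leaves
    only l = i = j.\<close>
  have zero: "(B ^\<^sub>m t) $$ (i,l) * B $$ (l,j) = 0"
    if "i < N" "j < N" "l < N" "j \<le> i" "l \<noteq> i \<or> j \<noteq> i" for i j l
  proof (cases "l < i")
    case True
    then have "(B ^\<^sub>m t) $$ (i,l) = 0"
      using Suc P B that upper_triangularD[of "B ^\<^sub>m t" l i] by simp
    then show ?thesis by simp
  next
    case False
    then have "j < l" using that by auto
    then show ?thesis using upper_triangularD[OF ut, of j l] B that by simp
  qed
  have "upper_triangular (B ^\<^sub>m Suc t)"
  proof (rule upper_triangularI)
    fix i j assume "j < i" "i < dim_row (B ^\<^sub>m Suc t)"
    then show "(B ^\<^sub>m Suc t) $$ (i,j) = 0"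
      using B by (subst entry) (auto intro!: sum.neutral zero)
  qed
  moreover have "(B ^\<^sub>m Suc t) $$ (i,i) = (B $$ (i,i)) ^ Suc t" if "i < N" for i
  proof -
    have "(B ^\<^sub>m Suc t) $$ (i,i) = (\<Sum>l\<in>{i}. (B ^\<^sub>m t) $$ (i,l) * B $$ (l,i))"
      unfolding entry[OF that that]
      by (rule sum.mono_neutral_right) (use that zero in auto)
    then show ?thesis using Suc that by (simp add: mult.commute)
  qed
  ultimately show ?case by blast
qed

lemma trace_mult_commute:
  fixes A B :: "'a :: comm_semiring_0 mat"
  assumes "A \<in> carrier_mat N N" "B \<in> carrier_mat N N"
  shows "(\<Sum>i<N. (A * B) $$ (i,i)) = (\<Sum>i<N. (B * A) $$ (i,i))"
proof -
  have "(\<Sum>i<N. (A * B) $$ (i,i)) = (\<Sum>i<N. \<Sum>j<N. A $$ (i,j) * B $$ (j,i))"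
    using assms by (simp add: scalar_prod_def lessThan_atLeast0)
  also have "\<dots> = (\<Sum>j<N. \<Sum>i<N. B $$ (j,i) * A $$ (i,j))"
    by (subst sum.swap) (simp add: mult.commute)
  also have "\<dots> = (\<Sum>i<N. (B * A) $$ (i,i))"
    using assms by (simp add: scalar_prod_def lessThan_atLeast0)
  finally show ?thesis .
qed

text \<open>By Schur decomposition \<open>A\<close> is similar to a triangular matrix with the roots
  on its diagonal. Its powers have the powers of the roots there, and similarity preserves the
  trace.\<close>

lemma trace_pow_eq_sum_roots:
  fixes A :: "real mat"
  assumes A: "A \<in> carrier_mat N N" and split: "char_poly A = (\<Prod>e\<leftarrow>es. [:- e, 1:])"
  shows "(\<Sum>i<N. (A ^\<^sub>m t) $$ (i,i)) = (\<Sum>e\<leftarrow>es. e ^ t)"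
proof -
  obtain B P Q where "schur_decomposition A es = (B, P, Q)" by (metis prod_cases3)
  from schur_decomposition[OF A split this]
  have wit: "similar_mat_wit A B P Q" and ut: "upper_triangular B" and diag: "diag_mat B = es"
    by auto
  from similar_mat_witD2[OF A wit] have carr: "B \<in> carrier_mat N N" "P \<in> carrier_mat N N"
    "Q \<in> carrier_mat N N" and QP: "Q * P = 1\<^sub>m N" by auto
  have Bt: "B ^\<^sub>m t \<in> carrier_mat N N" using carr by simp
  have "(\<Sum>i<N. (A ^\<^sub>m t) $$ (i,i)) = (\<Sum>i<N. (P * B ^\<^sub>m t * Q) $$ (i,i))"
    by (simp add: similar_mat_wit_pow_id[OF wit])
  also have "\<dots> = (\<Sum>i<N. (Q * (P * B ^\<^sub>m t)) $$ (i,i))"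
    using carr Bt by (intro trace_mult_commute) auto
  also have "Q * (P * B ^\<^sub>m t) = B ^\<^sub>m t"
    using carr Bt QP by (simp add: assoc_mult_mat[symmetric, of _ N N _ N _ N])
  also have "(\<Sum>i<N. (B ^\<^sub>m t) $$ (i,i)) = (\<Sum>i<N. (B $$ (i,i)) ^ t)"
    using upper_triangular_pow[OF carr(1) ut] by simp
  also have "\<dots> = (\<Sum>e\<leftarrow>es. e ^ t)"
    using carr unfolding diag[symmetric] diag_mat_def
    by (simp add: sum_list_distinct_conv_sum_set lessThan_atLeast0 o_def)
  finally show ?thesis .
qed

lemma char_poly_uminus_roots:
  fixes A :: "real mat"
  assumes A: "A \<in> carrier_mat N N" and split: "char_poly A = (\<Prod>e\<leftarrow>es. [:- e, 1:])"
  shows "char_poly (- A) = (\<Prod>e\<leftarrow>map uminus es. [:- e, 1:])"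
proof -
  obtain B P Q where "schur_decomposition A es = (B, P, Q)" by (metis prod_cases3)
  from schur_decomposition[OF A split this]
  have wit: "similar_mat_wit A B P Q" and ut: "upper_triangular B" and diag: "diag_mat B = es"
    by auto
  from similar_mat_witD2[OF A wit] have carr: "B \<in> carrier_mat N N" "P \<in> carrier_mat N N"
    "Q \<in> carrier_mat N N" and PQ: "P * Q = 1\<^sub>m N" and QP: "Q * P = 1\<^sub>m N"
    and AB: "A = P * B * Q" by auto
  have "- A = P * (- B) * Q"
    unfolding AB using carr by simp
  then have "similar_mat (- A) (- B)"
    using carr PQ QP A unfolding similar_mat_def similar_mat_wit_def Let_def
    by (intro exI[of _ P] exI[of _ Q]) auto
  then have "char_poly (- A) = char_poly (- B)" by (rule char_poly_similar)
  also have "\<dots> = (\<Prod>a\<leftarrow>diag_mat (- B). [:- a, 1:])"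
    by (rule char_poly_upper_triangular[of _ N]) (use carr upper_triangularD[OF ut] in \<open>auto intro!: upper_triangularI\<close>)
  also have "diag_mat (- B) = map uminus es"
    using carr unfolding diag[symmetric] diag_mat_def by auto
  finally show ?thesis .
qed

lemma proots_linear_factors: "proots (\<Prod>e\<leftarrow>es. [:- e, 1:]) = mset (es :: real list)"
proof (induction es)
  case (Cons e es)
  have "(\<Prod>e\<leftarrow>es. [:- e, 1:]) \<noteq> (0 :: real poly)"
    by (auto simp: prod_list_zero_iff)
  then show ?case using Cons by (simp add: proots_mult del: mult_pCons_left)
qed simp


text \<open>Conjugation by the diagonal matrix with entry 1 on one side and -1 on the other negates
  every entry between the sides, so \<open>A\<close> is similar to its negative.\<close>

lemma bipartite_eigenvalues_symmetric:
  fixes A :: "real mat"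
  assumes A: "A \<in> carrier_mat N N" and sym: "transpose_mat A = A"
    and bip: "\<And>i j. i < N \<Longrightarrow> j < N \<Longrightarrow> (i < n) = (j < n) \<Longrightarrow> A $$ (i,j) = 0"
  shows "image_mset uminus (eigenvalues_mset A) = eigenvalues_mset A"
proof -
  define \<delta> where "\<delta> i = (if i < n then 1 else - 1 :: real)" for i
  define D where "D = mat N N (\<lambda>(i,j). if i = j then \<delta> i else 0)"
  have D: "D \<in> carrier_mat N N" unfolding D_def by simp
  have left: "(D * X) $$ (i,j) = \<delta> i * X $$ (i,j)"
    if "X \<in> carrier_mat N N" "i < N" "j < N" for X i j
  proof -
    have "(D * X) $$ (i,j) = (\<Sum>l<N. (if i = l then \<delta> i else 0) * X $$ (l,j))"
      using that by (simp add: D_def scalar_prod_def lessThan_atLeast0)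
    also have "\<dots> = (\<Sum>l<N. if l = i then \<delta> i * X $$ (l,j) else 0)"
      by (intro sum.cong) auto
    finally show ?thesis using that by simp
  qed
  have right: "(X * D) $$ (i,j) = X $$ (i,j) * \<delta> j"
    if "X \<in> carrier_mat N N" "i < N" "j < N" for X i j
  proof -
    have "(X * D) $$ (i,j) = (\<Sum>l<N. X $$ (i,l) * (if l = j then \<delta> l else 0))"
      using that by (simp add: D_def scalar_prod_def lessThan_atLeast0)
    also have "\<dots> = (\<Sum>l<N. if l = j then X $$ (i,l) * \<delta> l else 0)"
      by (intro sum.cong) auto
    finally show ?thesis using that by simp
  qed
  have "D * D = 1\<^sub>m N"
  proof (rule eq_matI)
    fix i j assume "i < dim_row (1\<^sub>m N :: real mat)" "j < dim_col (1\<^sub>m N :: real mat)"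
    then have ij: "i < N" "j < N" by auto
    show "(D * D) $$ (i,j) = 1\<^sub>m N $$ (i,j)"
      unfolding left[OF D ij] using ij by (simp add: D_def \<delta>_def)
  qed (use D in auto)
  moreover have "A = D * (- A) * D"
  proof (rule eq_matI)
    fix i j assume "i < dim_row (D * (- A) * D)" "j < dim_col (D * (- A) * D)"
    then have ij: "i < N" "j < N" using D by auto
    have "(D * (- A) * D) $$ (i,j) = \<delta> i * (- A) $$ (i,j) * \<delta> j"
      using A D ij by (subst right) (simp_all only: left uminus_carrier_mat mult_carrier_mat)
    then show "A $$ (i,j) = (D * (- A) * D) $$ (i,j)"
      using A ij bip[OF ij] by (cases "i < n"; cases "j < n") (auto simp: \<delta>_def)
  qed (use A D in auto)
  ultimately have "similar_mat A (- A)"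
    using A D unfolding similar_mat_def similar_mat_wit_def Let_def
    by (intro exI[of _ D]) auto
  then have "char_poly A = char_poly (- A)" by (rule char_poly_similar)
  moreover obtain es where es: "char_poly A = (\<Prod>e\<leftarrow>es. [:- e, 1:])"
    using real_symmetric_char_poly_splits[OF A sym] by metis
  ultimately have "mset es = mset (map uminus es)"
    using char_poly_uminus_roots[OF A es] proots_linear_factors by metis
  then show ?thesis
    unfolding eigenvalues_mset_def es proots_linear_factors by simp
qed

lemma sum_mset_even_power_nonneg: "(\<Sum>e\<in>#R. e ^ (2 * m)) \<ge> (0 :: real)"
  by (induction R) auto

text \<open>The eigenvalue 1 brings -1 along by symmetry. Removing both leaves a multiset that is
  still symmetric, so an element of largest modulus occurs with its negative and accounts for twice
  its even power in the trace; 1 and -1 account for the subtracted 2.\<close>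

lemma bipartite_second_eigenvalue_power_le_trace:
  fixes A :: "real mat"
  assumes A: "A \<in> carrier_mat N N" and sym: "transpose_mat A = A" and N: "N \<ge> 3"
    and bip: "\<And>i j. i < N \<Longrightarrow> j < N \<Longrightarrow> (i < n) = (j < n) \<Longrightarrow> A $$ (i,j) = 0"
    and one: "eigenvalue A 1" and m: "m \<ge> 1"
  shows "2 * Max (abs ` set_mset (eigenvalues_mset A - {#1, -1#})) ^ (2 * m)
    \<le> (\<Sum>i<N. (A ^\<^sub>m (2 * m)) $$ (i,i)) - 2"
proof -
  obtain es where es: "char_poly A = (\<Prod>e\<leftarrow>es. [:- e, 1:])" "length es = N"
    using real_symmetric_char_poly_splits[OF A sym] by metis
  define M where "M = eigenvalues_mset A"
  have M: "M = mset es" unfolding M_def eigenvalues_mset_def es proots_linear_factors ..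
  have neg: "image_mset uminus M = M"
    unfolding M_def by (rule bipartite_eigenvalues_symmetric[OF A sym bip])
  have "poly (char_poly A) 1 = 0"
    using one eigenvalue_root_char_poly[OF A] by simp
  then have mem1: "1 \<in># M"
    unfolding M es by (auto simp: poly_prod_list prod_list_zero_iff image_iff)
  then have mem2: "- 1 \<in># M" using neg by (metis imageI in_image_mset)
  have sub: "{#1, -1#} \<subseteq># M"
    using mem1 mem2 by (simp add: insert_subset_eq_iff in_diff_count)
  define R where "R = M - {#1, -1#}"
  have MR: "M = R + {#1, -1#}" unfolding R_def by (rule subset_mset.diff_add[OF sub, symmetric])
  \<comment> \<open>At least three eigenvalues ensure that the maximum is taken over a nonempty
    set.\<close>
  have "size R > 0" using N es(2) M arg_cong[OF MR, of size] by simp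
  then have fin: "finite (abs ` set_mset R)" "abs ` set_mset R \<noteq> {}" by auto
  obtain l where l: "l \<in># R" "\<bar>l\<bar> = Max (abs ` set_mset R)"
    using Max_in[OF fin] by auto
  have negR: "image_mset uminus R = R"
    using neg unfolding MR by (simp add: add_mset_commute)
  \<comment> \<open>For l = 0 the elements l and -l coincide and cannot be counted as two; there the
    left side vanishes because m is positive.\<close>
  have sumR: "2 * l ^ (2 * m) \<le> (\<Sum>e\<in>#R. e ^ (2 * m))"
  proof (cases "l = 0")
    case True
    then show ?thesis using m sum_mset_even_power_nonneg[of m R] by (simp add: power_0_left)
  next
    case False
    have "- l \<in># R" using l negR by (metis imageI in_image_mset)
    then have "{#l, -l#} \<subseteq># R" using l False by (simp add: insert_subset_eq_iff in_diff_count)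
    then obtain S where S: "R = {#l, -l#} + S" by (metis subset_mset.le_iff_add)
    have "(\<Sum>e\<in>#S. e ^ (2 * m)) \<ge> 0" by (rule sum_mset_even_power_nonneg)
    then show ?thesis unfolding S by simp
  qed
  have "(\<Sum>i<N. (A ^\<^sub>m (2 * m)) $$ (i,i)) = (\<Sum>e\<in>#M. e ^ (2 * m))"
    unfolding trace_pow_eq_sum_roots[OF A es(1)] M by (simp flip: sum_mset_sum_list)
  also have "\<dots> = (\<Sum>e\<in>#R. e ^ (2 * m)) + 2" unfolding MR by simp
  finally show ?thesis
    using sumR l(2) power_even_abs[of "2 * m" l] unfolding R_def M_def by simp
qed

section \<open>Summation over words\<close>

lemma words_next_exact:
  assumes "w \<in> words p 0 A l" "\<not> (\<exists>j\<in>set w. count_list w j = p)"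
  shows "w \<in> words (Suc p) 0 A l"
  using assms unfolding words_def by (auto simp: Suc_le_eq order.strict_iff_order) 

lemma words_exact:
  assumes "w \<in> words p 0 A l" "j \<in> set w" "count_list w j = p"
  shows "w \<in> words p 1 A l"
  using assms unfolding words_def by (auto simp: Suc_le_eq card_gt_0_iff)

definition double_letters :: "'a list \<Rightarrow> 'a set" where
  "double_letters w = {a \<in> set w. count_list w a = 2}"

text \<open>Crossings are excluded among the double letters alone, after deletion of all other
  letters. How the two restrictions interleave is left free, so that they can be counted
  independently.\<close>

definition noncrossing_double_words :: "nat \<Rightarrow> nat \<Rightarrow> 'a set \<Rightarrow> nat \<Rightarrow> nat \<Rightarrow> 'a list set" where
  "noncrossing_double_words p c A l i = {w \<in> words 2 1 A l. card (double_letters w) = i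
     \<and> filter (\<lambda>a. a \<in> double_letters w) w \<in> noncrossing_words [] (double_letters w)
     \<and> filter (\<lambda>a. a \<notin> double_letters w) w \<in> words p c (A - double_letters w) (l - 2 * i)}"

text \<open>Without the noncrossing condition i double letters can be arranged in (2i)!/2^i ways,
  which is where (1/2)^i comes from; 2^i/(i+1)! is the proportion of noncrossing arrangements among
  them. The positions contribute binomial(l, 2i), which turns (2i)! into l!/(l-2i)!.\<close>

lemma card_noncrossing_double_words:
  assumes A: "finite A" and p: "p \<ge> 1" and i: "2 * i \<le> l"
  shows "real (card (noncrossing_double_words p c A l i)) \<le>
    real (card A choose i) * (1 / 2) ^ i * (fact l / fact (l - 2 * i)) * (2 ^ i / fact (i + 1))
      * Y p c (l - 2 * i) (card A - i)"
proof -
  have "real (card (noncrossing_double_words p c A l i)) \<le> real (card A choose i)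
    * real ((2 * i + (l - 2 * i)) choose (2 * i)) * (fact (2 * i) / fact (i + 1)) * Y p c (l - 2 * i) (card A - i)"
  proof (rule card_split_words_le[where E = "noncrossing_words []" and F = "\<lambda>I. words p c (A - I) (l - 2 * i)"])
    fix w assume w: "w \<in> noncrossing_double_words p c A l i"
    then have "double_letters w \<subseteq> A"
      by (auto simp: noncrossing_double_words_def words_def double_letters_def)
    then show "\<exists>I\<subseteq>A. card I = i \<and> filter (\<lambda>a. a \<in> I) w \<in> noncrossing_words [] I
        \<and> filter (\<lambda>a. a \<notin> I) w \<in> words p c (A - I) (l - 2 * i)"
      using w unfolding noncrossing_double_words_def by blast
  next
    fix I assume I: "I \<subseteq> A" "card I = i"
    then have finI: "finite I" using A finite_subset by blast
    have "finite (noncrossing_words [] I)"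
      using finI by (intro finite_noncrossing_words) auto
    moreover have "real (card (noncrossing_words [] I)) \<le> fact (2 * i) / fact (i + 1)"
      using card_noncrossing_words[OF finI] I by simp
    moreover have "length w = 2 * i" if "w \<in> noncrossing_words [] I" for w
      using length_noncrossing_words[of I "[]" w] finI that I by simp
    moreover have "set w \<subseteq> I" if "w \<in> noncrossing_words [] I" for w
      using that by (simp add: noncrossing_words_def)
    ultimately show "finite (noncrossing_words [] I) \<and> real (card (noncrossing_words [] I)) \<le> fact (2 * i) / fact (i + 1)
        \<and> (\<forall>w\<in>noncrossing_words [] I. set w \<subseteq> I \<and> length w = 2 * i)" by blast
    have "card (A - I) = card A - i" using I finI by (simp add: card_Diff_subset)
    then show "finite (words p c (A - I) (l - 2 * i))
        \<and> real (card (words p c (A - I) (l - 2 * i))) \<le> Y p c (l - 2 * i) (card A - i)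
        \<and> (\<forall>w\<in>words p c (A - I) (l - 2 * i). set w \<inter> I = {} \<and> length w = l - 2 * i)"
      using card_words_le_Y[of "A - I" p c "l - 2 * i"] finite_words[of "A - I"] A p
        words_disjoint[of _ p c A I "l - 2 * i"] by auto
  qed (use A in auto)
  also have "\<dots> = real (card A choose i) * (1 / 2) ^ i * (fact l / fact (l - 2 * i)) * (2 ^ i / fact (i + 1))
      * Y p c (l - 2 * i) (card A - i)"
    using i by (simp add: binomial_fact power_one_over)
  finally show ?thesis .
qed

text \<open>A decision tree on multiplicities. A single letter settles the matter at once. With
  double letters present, a crossing among them is sought, and failing that a triple letter in the
  rest of the word. Without single and double letters, either there is a triple letter or all
  multiplicities are at least four.\<close>

lemma word_classification:
  assumes w: "set w \<subseteq> A" "length w = 2 * m"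
  obtains (one) j where "count_list w j = 1" "w \<in> words 1 1 A (2 * m)"
    | (crossing) a b where "crossing w a b" "w \<in> words 2 1 A (2 * m)"
    | (noncrossing_three) i j where "i \<in> {1..m}" "count_list w j = 3"
        "w \<in> noncrossing_double_words 3 1 A (2 * m) i"
    | (noncrossing) i where "i \<in> {1..m}" "w \<in> noncrossing_double_words 4 0 A (2 * m) i"
    | (three) j where "count_list w j = 3" "w \<in> words 3 1 A (2 * m)"
    | (four) "w \<in> words 4 0 A (2 * m)"
proof -
  have w1: "w \<in> words 1 0 A (2 * m)"
    using w count_list_0_iff[of w] by (auto simp: words_def Suc_le_eq)
  consider (1) j where "j \<in> set w" "count_list w j = 1" | (2) "w \<in> words 2 0 A (2 * m)"
    using words_next_exact[OF w1] by (auto simp: numeral_2_eq_2)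
  then show thesis
  proof cases
    case 1
    then show ?thesis using one words_exact[OF w1] by blast
  next
    case w2: 2
    consider (1) j where "j \<in> set w" "count_list w j = 2" | (2) "w \<in> words 3 0 A (2 * m)"
      using words_next_exact[OF w2] by (auto simp: numeral_3_eq_3 numeral_2_eq_2)
    then show ?thesis
    proof cases
      case 1
      then have w21: "w \<in> words 2 1 A (2 * m)" using words_exact[OF w2] by blast
      let ?I = "double_letters w"
      show ?thesis
      proof (cases "\<exists>a b. crossing (filter (\<lambda>a. a \<in> ?I) w) a b")
        case True
        then obtain a b where ab: "crossing (filter (\<lambda>a. a \<in> ?I) w) a b" by blast
        then have f: "filter (\<lambda>c. c \<in> ?I \<and> (c = a \<or> c = b)) w = [a, b, a, b]" and "a \<noteq> b"
          by (auto simp: crossing_def conj_commute)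
        have "a \<in> set (filter (\<lambda>c. c \<in> ?I \<and> (c = a \<or> c = b)) w)"
          "b \<in> set (filter (\<lambda>c. c \<in> ?I \<and> (c = a \<or> c = b)) w)"
          unfolding f by auto
        then have "filter (\<lambda>c. c \<in> ?I \<and> (c = a \<or> c = b)) w = filter (\<lambda>c. c = a \<or> c = b) w"
          by (intro filter_cong) auto
        then have "crossing w a b" using f \<open>a \<noteq> b\<close> by (simp add: crossing_def)
        then show ?thesis using crossing w21 by blast
      next
        case False
        define i where "i = card ?I"
        define v where "v = filter (\<lambda>a. a \<notin> ?I) w"
        have split: "2 * i \<le> 2 * m" "filter (\<lambda>a. a \<in> ?I) w \<in> {u. set u \<subseteq> ?I \<and> (\<forall>a\<in>?I. count_list u a = 2)}"
          "v \<in> words 3 0 (set w - ?I) (2 * m - 2 * i)"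
          using split_exact_count[of w 2 1 "set w" "2 * m"] w21
          unfolding double_letters_def i_def v_def by (auto simp: words_def)
        have v3: "v \<in> words 3 0 (A - ?I) (2 * m - 2 * i)"
          using split(3) w by (auto simp: words_def)
        have nc: "filter (\<lambda>a. a \<in> ?I) w \<in> noncrossing_words [] ?I"
          using split(2) False by (auto simp: noncrossing_words_def)
        have "i \<ge> 1" using w21 unfolding i_def double_letters_def words_def by simp
        then have i: "i \<in> {1..m}" using split(1) by simp
        show ?thesis
        proof (cases "\<exists>j\<in>set v. count_list v j = 3")
          case True
          then obtain j where j: "j \<in> set v" "count_list v j = 3" by blast
          then have "v \<in> words 3 1 (A - ?I) (2 * m - 2 * i)" using words_exact[OF v3] by blast
          moreover have "count_list w j = 3"
            using j unfolding v_def by (simp add: count_list_filter split: if_splits)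
          ultimately show ?thesis using noncrossing_three[OF i, of j] w21 nc
            unfolding noncrossing_double_words_def v_def i_def by blast
        next
          case False
          then have "v \<in> words 4 0 (A - ?I) (2 * m - 2 * i)"
            using words_next_exact[OF v3] by (simp add: eval_nat_numeral)
          then show ?thesis using noncrossing[OF i] w21 nc
            unfolding noncrossing_double_words_def v_def i_def by blast
        qed
      qed
    next
      case w3: 2
      show ?thesis
      proof (cases "\<exists>j\<in>set w. count_list w j = 3")
        case True
        then show ?thesis using three words_exact[OF w3] by blast
      next
        case False
        then show ?thesis using four words_next_exact[OF w3] by (simp add: eval_nat_numeral)
      qed
    qed
  qed
qed

text \<open>Each weight \<open>q w\<close> is dominated by a sum of weighted indicators of the
  classes. All of these are nonnegative, so the classes may overlap: a word only has to lie in one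
  class of sufficient weight. The abstract \<open>q\<close> reduces the probabilistic input to four
  bounds.\<close>

lemma sum_word_weights_le:
  fixes q :: "nat list \<Rightarrow> real" and n :: real
  assumes n: "n \<ge> 0"
    and one: "\<And>w j. set w \<subseteq> {..<d} \<Longrightarrow> count_list w j = 1 \<Longrightarrow> q w \<le> 1"
    and cross: "\<And>w a b. set w \<subseteq> {..<d} \<Longrightarrow> crossing w a b \<Longrightarrow> q w \<le> 2"
    and three: "\<And>w j. set w \<subseteq> {..<d} \<Longrightarrow> count_list w j = 3 \<Longrightarrow> q w \<le> 5"
    and trivial: "\<And>w. set w \<subseteq> {..<d} \<Longrightarrow> q w \<le> n"
  shows "(\<Sum>w | set w \<subseteq> {..<d} \<and> length w = 2 * m. q w) \<le>
    (\<Sum>i = 1..m. real (d choose i) * (1 / 2) ^ i * (fact (2 * m) / fact (2 * m - 2 * i))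
            * (2 ^ i / fact (i + 1))
            * (Y 3 1 (2 * m - 2 * i) (d - i) * 5 + Y 4 0 (2 * m - 2 * i) (d - i) * n))
      + Y 1 1 (2 * m) d * 1 + Y 2 1 (2 * m) d * 2 + Y 3 1 (2 * m) d * 5 + Y 4 0 (2 * m) d * n"
proof -
  let ?A = "{..<d}"
  define L where "L = {w. set w \<subseteq> ?A \<and> length w = 2 * m}"
  have finL: "finite L" unfolding L_def by (rule finite_lists_length_eq) simp
  define W where "W p c = words p c ?A (2 * m)" for p c
  define D where "D p c i = noncrossing_double_words p c ?A (2 * m) i" for p c i
  define \<chi> where "\<chi> S w = (if w \<in> S then 1 else 0 :: real)" for S :: "nat list set" and w
  have WL: "W p c \<subseteq> L" for p c unfolding W_def L_def words_def by auto
  have DL: "D p c i \<subseteq> L" for p c i unfolding D_def L_def words_def noncrossing_double_words_def by auto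
  have sum\<chi>: "(\<Sum>w\<in>L. \<chi> S w) = real (card S)" if "S \<subseteq> L" for S
    unfolding \<chi>_def using finL that by (simp add: sum.If_cases Int_absorb1)
  have \<chi>0: "\<chi> S w \<ge> 0" for S w by (simp add: \<chi>_def)
  define f where "f w = \<chi> (W 1 1) w * 1 + \<chi> (W 2 1) w * 2 + \<chi> (W 3 1) w * 5 + \<chi> (W 4 0) w * n" for w
  define g where "g w i = \<chi> (D 3 1 i) w * 5 + \<chi> (D 4 0 i) w * n" for w i
  have f0: "f w \<ge> 0" for w unfolding f_def using \<chi>0 n by simp
  have g0: "g w i \<ge> 0" for w i unfolding g_def using \<chi>0 n by simp
  have q: "q w \<le> (\<Sum>i=1..m. g w i) + f w" if w: "w \<in> L" for w
  proof -
    have sg: "(\<Sum>i=1..m. g w i) \<ge> 0" using g0 by (simp add: sum_nonneg)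
    have g_le: "g w i \<le> (\<Sum>i=1..m. g w i)" if "i \<in> {1..m}" for i
      using that g0 by (intro member_le_sum) auto
    have wA: "set w \<subseteq> ?A" "length w = 2 * m" using w by (auto simp: L_def)
    show ?thesis
      using wA
    proof (cases rule: word_classification)
      case (one j)
      then have "f w \<ge> 1" unfolding f_def W_def using n by (auto simp: \<chi>_def)
      then show ?thesis using assms(2)[OF wA(1) one(1)] sg by simp
    next
      case (crossing a b)
      then have "f w \<ge> 2" unfolding f_def W_def using n by (auto simp: \<chi>_def)
      then show ?thesis using cross[OF wA(1) crossing(1)] sg by simp
    next
      case (noncrossing_three i j)
      then have "g w i \<ge> 5" unfolding g_def D_def using n by (auto simp: \<chi>_def)
      then show ?thesis using assms(4)[OF wA(1) noncrossing_three(2)] g_le[OF noncrossing_three(1)] f0[of w] by simp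
    next
      case (noncrossing i)
      then have "g w i \<ge> n" unfolding g_def D_def using n by (auto simp: \<chi>_def)
      then show ?thesis using trivial[OF wA(1)] g_le[OF noncrossing(1)] f0[of w] by simp
    next
      case (three j)
      then have "f w \<ge> 5" unfolding f_def W_def using n by (auto simp: \<chi>_def)
      then show ?thesis using assms(4)[OF wA(1) three(1)] sg by simp
    next
      case four
      then have "f w \<ge> n" unfolding f_def W_def using n by (auto simp: \<chi>_def)
      then show ?thesis using trivial[OF wA(1)] sg by simp
    qed
  qed
  have cW: "real (card (W p c)) \<le> Y p c (2 * m) d" if "p \<ge> 1" for p c
    using card_words_le_Y[of ?A p c "2 * m"] that unfolding W_def by simp
  have cD: "real (card (D p c i)) \<le> real (d choose i) * (1 / 2) ^ i * (fact (2 * m) / fact (2 * m - 2 * i))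
            * (2 ^ i / fact (i + 1)) * Y p c (2 * m - 2 * i) (d - i)" if "p \<ge> 1" "i \<in> {1..m}" for p c i
    using card_noncrossing_double_words[of ?A p i "2 * m" c] that unfolding D_def by simp
  have "(\<Sum>w\<in>L. q w) \<le> (\<Sum>w\<in>L. (\<Sum>i=1..m. g w i) + f w)" by (intro sum_mono q)
  also have "\<dots> = (\<Sum>i=1..m. \<Sum>w\<in>L. g w i) + (\<Sum>w\<in>L. f w)"
    unfolding sum.distrib by (subst sum.swap) simp
  also have "(\<Sum>w\<in>L. f w) = real (card (W 1 1)) * 1 + real (card (W 2 1)) * 2 + real (card (W 3 1)) * 5
      + real (card (W 4 0)) * n"
    unfolding f_def sum.distrib sum_distrib_right[symmetric] sum\<chi>[OF WL] ..
  also have "\<dots> \<le> Y 1 1 (2 * m) d * 1 + Y 2 1 (2 * m) d * 2 + Y 3 1 (2 * m) d * 5 + Y 4 0 (2 * m) d * n"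
    using n by (intro add_mono mult_right_mono cW) auto
  also have "(\<Sum>i=1..m. \<Sum>w\<in>L. g w i) = (\<Sum>i=1..m. real (card (D 3 1 i)) * 5 + real (card (D 4 0 i)) * n)"
    unfolding g_def sum.distrib sum_distrib_right[symmetric] sum\<chi>[OF DL] ..
  also have "\<dots> \<le> (\<Sum>i = 1..m. real (d choose i) * (1 / 2) ^ i * (fact (2 * m) / fact (2 * m - 2 * i))
            * (2 ^ i / fact (i + 1))
            * (Y 3 1 (2 * m - 2 * i) (d - i) * 5 + Y 4 0 (2 * m - 2 * i) (d - i) * n))"
    unfolding distrib_left mult.assoc[symmetric]
    using n by (intro sum_mono add_mono mult_right_mono cD) auto
  finally show ?thesis unfolding L_def by simp
qed

section \<open>Closed walks and the second eigenvalue\<close>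

text \<open>The flag is the sign with which an alternating walk leaves the vertex, hence \<open>True\<close> on the left.\<close>

definition vertex :: "nat \<Rightarrow> bool \<Rightarrow> nat \<Rightarrow> nat" where
  "vertex n e a = (if e then a else n + a)"

text \<open>A generator acts on the 2n vertices as a fixed-point-free involution, a perfect matching
  between the sides. The adjacency matrix is thus a sum of d permutation matrices, and one map
  serves both directions of an edge.\<close>

definition edge_map :: "nat \<Rightarrow> (nat \<Rightarrow> nat) \<Rightarrow> nat \<Rightarrow> nat" where
  "edge_map n p a = (if a < n then n + p a else perminv p (a - n))"

lemma vertex_inject: "vertex n e a = vertex n e b \<longleftrightarrow> a = b"
  by (simp add: vertex_def)

lemma edge_map_vertex:
  assumes "p permutes {..<n}" "a < n"
  shows "edge_map n p (vertex n e a) = vertex n (\<not> e) (signed e p a)" "signed e p a < n"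
  using assms permutes_in_image[OF assms(1)] permutes_in_image[OF permutes_inv[OF assms(1)]]
  by (auto simp: edge_map_def vertex_def signed_def)

lemma fold_edge_map:
  assumes "\<And>j. j \<in> set w \<Longrightarrow> p j permutes {..<n}" "a < n"
  shows "fold (\<lambda>j. edge_map n (p j)) w (vertex n e a) = vertex n (e = even (length w)) (walk p e w a)"
  using assms
proof (induction w arbitrary: e a)
  case (Cons j w)
  have "fold (\<lambda>j. edge_map n (p j)) w (vertex n (\<not> e) (signed e (p j) a))
      = vertex n ((\<not> e) = even (length w)) (walk p (\<not> e) w (signed e (p j) a))"
    using Cons.prems edge_map_vertex(2)[of "p j" n a e] by (intro Cons.IH) auto
  moreover have "((\<not> e) = even (length w)) = (e = even (length (j # w)))" by auto
  ultimately show ?case using edge_map_vertex(1)[of "p j" n a e] Cons.prems by (simp only: fold_Cons o_apply walk.simps) auto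
qed simp

lemma edge_map_less:
  assumes "p permutes {..<n}" "a < 2 * n"
  shows "edge_map n p a < 2 * n"
  using assms permutes_in_image[OF assms(1), of a] permutes_in_image[OF permutes_inv[OF assms(1)], of "a - n"]
  by (auto simp: edge_map_def)

lemma edge_map_edge_map:
  assumes p: "p permutes {..<n}" and a: "a < 2 * n"
  shows "edge_map n p (edge_map n p a) = a"
proof (cases "a < n")
  case True
  then show ?thesis using permutes_inverses(2)[OF p] by (simp add: edge_map_def)
next
  case False
  then have "perminv p (a - n) < n"
    using a permutes_in_image[OF permutes_inv[OF p], of "a - n"] by simp
  then show ?thesis using False permutes_inverses(1)[OF p] by (simp add: edge_map_def)
qed

lemma edge_map_sym:
  assumes "p permutes {..<n}" "a < 2 * n" "b < 2 * n"
  shows "edge_map n p a = b \<longleftrightarrow> edge_map n p b = a"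
  using assms edge_map_edge_map by metis

section \<open>Powers of the adjacency matrix as counts of words\<close>

lemma sum_lists_Suc:
  "(\<Sum>w | set w \<subseteq> {..<d} \<and> length w = Suc t. f w)
    = (\<Sum>w | set w \<subseteq> {..<d :: nat} \<and> length w = t. \<Sum>j<d. f (w @ [j]))"
proof -
  let ?L = "\<lambda>t. {w. set w \<subseteq> {..<d} \<and> length w = t}"
  have "(\<Sum>w\<in>?L t. \<Sum>j<d. f (w @ [j])) = (\<Sum>(w,j)\<in>?L t \<times> {..<d}. f (w @ [j]))"
    by (rule sum.cartesian_product)
  also have "\<dots> = (\<Sum>w\<in>?L (Suc t). f w)"
  proof (rule sum.reindex_bij_witness[where j = "\<lambda>(w,j). w @ [j]" and i = "\<lambda>w. (butlast w, last w)"])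
    fix w assume "w \<in> ?L (Suc t)"
    then have w: "w \<noteq> []" "set w \<subseteq> {..<d}" "length w = Suc t" by auto
    then have "set (butlast w) \<subseteq> {..<d}" by (meson in_set_butlastD subset_iff)
    moreover have "last w \<in> {..<d}" using w last_in_set by blast
    ultimately show "(butlast w, last w) \<in> ?L t \<times> {..<d}" using w by simp
    show "(case (butlast w, last w) of (w, j) \<Rightarrow> w @ [j]) = w" using w by simp
  qed auto
  finally show ?thesis by simp
qed

text \<open>The new letter is appended at the end, in agreement with \<open>fold\<close> and with
  multiplying the power by \<open>A\<close> from the right. Each word has exactly one endpoint,
  which collapses the sum over the intermediate vertex.\<close>

lemma pow_mat_entry_walks:
  fixes A :: "real mat" and \<tau> :: "nat \<Rightarrow> nat \<Rightarrow> nat"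
  assumes A: "A \<in> carrier_mat N N"
    and entry: "\<And>a b. a < N \<Longrightarrow> b < N \<Longrightarrow> A $$ (a,b) = c * (\<Sum>j<d. if \<tau> j a = b then 1 else 0)"
    and closed: "\<And>j a. j < d \<Longrightarrow> a < N \<Longrightarrow> \<tau> j a < N"
    and ab: "a < N" "b < N"
  shows "(A ^\<^sub>m t) $$ (a,b) = c ^ t * (\<Sum>w | set w \<subseteq> {..<d} \<and> length w = t. if fold \<tau> w a = b then 1 else 0)"
  using ab(2)
proof (induction t arbitrary: b)
  case 0
  have "{w. set w \<subseteq> {..<d} \<and> length w = 0} = {[]}" by auto
  then show ?case using A ab 0 by auto
next
  case (Suc t)
  let ?L = "\<lambda>t. {w. set w \<subseteq> {..<d} \<and> length w = t}"
  have P: "A ^\<^sub>m t \<in> carrier_mat N N" using A by simp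
  have fold_less: "fold \<tau> w x < N" if "set w \<subseteq> {..<d}" "x < N" for w x
    using that closed by (induction w arbitrary: x) auto
  have pull: "(c ^ t * (\<Sum>w\<in>?L t. if P w then 1 else 0)) * (c * R) = c ^ Suc t * (\<Sum>w\<in>?L t. if P w then R else 0)"
    for P and R :: real
  proof -
    have "(\<Sum>w\<in>?L t. if P w then 1 else 0) * R = (\<Sum>w\<in>?L t. if P w then R else 0)"
      unfolding sum_distrib_right by (intro sum.cong) auto
    then show ?thesis by (simp add: mult_ac flip: sum_distrib_left)
  qed
  have "(A ^\<^sub>m Suc t) $$ (a,b) = (\<Sum>x<N. (A ^\<^sub>m t) $$ (a,x) * A $$ (x,b))"
    using ab Suc.prems A P by (simp add: scalar_prod_def lessThan_atLeast0)
  also have "\<dots> = (\<Sum>x<N. (c ^ t * (\<Sum>w\<in>?L t. if fold \<tau> w a = x then 1 else 0))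
      * (c * (\<Sum>j<d. if \<tau> j x = b then 1 else 0)))"
    by (intro sum.cong refl) (simp only: Suc.IH entry Suc.prems lessThan_iff)
  also have "\<dots> = c ^ Suc t * (\<Sum>x<N. \<Sum>w\<in>?L t. if fold \<tau> w a = x then (\<Sum>j<d. if \<tau> j x = b then 1 else 0) else 0)"
    unfolding sum_distrib_left[of "c ^ Suc t" _ "{..<N}"] by (intro sum.cong refl pull)
  also have "(\<Sum>x<N. \<Sum>w\<in>?L t. if fold \<tau> w a = x then (\<Sum>j<d. if \<tau> j x = b then 1 else 0) else 0)
      = (\<Sum>w\<in>?L t. \<Sum>x<N. if fold \<tau> w a = x then (\<Sum>j<d. if \<tau> j x = b then 1 else 0) else 0 :: real)"
    by (rule sum.swap)
  also have "\<dots> = (\<Sum>w\<in>?L t. \<Sum>j<d. if \<tau> j (fold \<tau> w a) = b then 1 else 0)"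
    by (rule sum.cong[OF refl]) (simp add: fold_less ab)
  also have "\<dots> = (\<Sum>w\<in>?L (Suc t). if fold \<tau> w a = b then 1 else 0)"
    unfolding sum_lists_Suc by simp
  finally show ?case .
qed

context
  fixes k d :: nat and s :: "nat \<Rightarrow> bit mat"
  assumes k: "k \<ge> 2" and d: "d \<ge> 1" and s: "\<And>j. j < d \<Longrightarrow> s j \<in> GL2 k"
begin

interpretation GL: sampler "{..<2 ^ k - 1}" "index_add k" "GL2 k" "GL2_perm k"
  by (rule sampler_GL2[OF k])

lemma normalized_adj_carrier: "normalized_adj k d s \<in> carrier_mat (2 * (2 ^ k - 1)) (2 * (2 ^ k - 1))"
  by (simp add: normalized_adj_def schreier_adj_def Let_def)

lemma normalized_adj_entry:
  assumes "a < 2 * (2 ^ k - 1)" "b < 2 * (2 ^ k - 1)"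
  shows "normalized_adj k d s $$ (a,b)
    = (1 / real d) * (\<Sum>j<d. if edge_map (2 ^ k - 1) (GL2_perm k (s j)) a = b then 1 else 0)"
proof -
  let ?n = "2 ^ k - 1 :: nat"
  let ?\<tau> = "\<lambda>j. edge_map ?n (GL2_perm k (s j))"
  have count: "(\<Sum>j<d. if P j then 1 else 0) = real (card {j \<in> {..<d}. P j})" for P
    by (simp add: sum.If_cases Int_def)
  have perm: "GL2_perm k (s j) permutes {..<?n}" if "j < d" for j
    by (rule GL2_perm_permutes[OF s[OF that]])
  consider "a < ?n" "?n \<le> b" | "?n \<le> a" "b < ?n" | "a < ?n" "b < ?n" | "?n \<le> a" "?n \<le> b"
    by linarith
  then have "schreier_adj k d s $$ (a,b) = real (card {j \<in> {..<d}. ?\<tau> j a = b})"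
  proof cases
    case 1
    have "?\<tau> j a = b \<longleftrightarrow> s j *\<^sub>v vec_of_nat k (a + 1) = vec_of_nat k (b - ?n + 1)" if "j < d" for j
      using 1 assms GL2_perm_eq_iff[OF s[OF that], of a "b - ?n"]
      by (auto simp: edge_map_def nonzero_vec_def)
    then have "{j \<in> {..<d}. ?\<tau> j a = b} = {j \<in> {..<d}. s j *\<^sub>v vec_of_nat k (a + 1) = vec_of_nat k (b - ?n + 1)}"
      by auto
    then show ?thesis using 1 assms by (simp add: schreier_adj_def Let_def)
  next
    case 2
    have "?\<tau> j a = b \<longleftrightarrow> s j *\<^sub>v vec_of_nat k (b + 1) = vec_of_nat k (a - ?n + 1)" if "j < d" for j
      using 2 assms GL2_perm_eq_iff[OF s[OF that], of b "a - ?n"] GL.pi_inv_iff[OF s[OF that], of "a - ?n" b]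
      by (auto simp: edge_map_def nonzero_vec_def)
    then have "{j \<in> {..<d}. ?\<tau> j a = b} = {j \<in> {..<d}. s j *\<^sub>v vec_of_nat k (b + 1) = vec_of_nat k (a - ?n + 1)}"
      by auto
    then show ?thesis using 2 assms by (simp add: schreier_adj_def Let_def)
  next
    case 3
    then have "{j \<in> {..<d}. ?\<tau> j a = b} = {}" by (auto simp: edge_map_def)
    then show ?thesis using 3 assms by (simp only: card.empty) (simp add: schreier_adj_def Let_def)
  next
    case 4
    have "perminv (GL2_perm k (s j)) (a - ?n) < ?n" if "j < d" for j
      using permutes_in_image[OF permutes_inv[OF perm[OF that]], of "a - ?n"] 4 assms by simp
    then have "?\<tau> j a \<noteq> b" if "j < d" for j
      using that 4 unfolding edge_map_def by (metis leD)
    then have "{j \<in> {..<d}. ?\<tau> j a = b} = {}" by auto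
    then show ?thesis using 4 assms by (simp only: card.empty) (simp add: schreier_adj_def Let_def)
  qed
  moreover have "schreier_adj k d s \<in> carrier_mat (2 * ?n) (2 * ?n)"
    by (simp add: schreier_adj_def Let_def)
  ultimately show ?thesis unfolding count normalized_adj_def using assms by simp
qed

text \<open>A word of even length returns to the side it started from. The vertices it fixes
  therefore split into the fixed points of two alternating products, one beginning with a generator
  and one beginning with an inverse.\<close>

lemma trace_normalized_adj_pow:
  "(\<Sum>a<2 * (2 ^ k - 1). (normalized_adj k d s ^\<^sub>m (2 * m)) $$ (a,a)) = (1 / real d) ^ (2 * m)
    * (\<Sum>w | set w \<subseteq> {..<d} \<and> length w = 2 * m.
        GL.fixc (walk (\<lambda>j. GL2_perm k (s j)) True w) + GL.fixc (walk (\<lambda>j. GL2_perm k (s j)) False w))"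
proof -
  let ?n = "2 ^ k - 1 :: nat"
  let ?p = "\<lambda>j. GL2_perm k (s j)"
  let ?\<tau> = "\<lambda>j. edge_map ?n (?p j)"
  let ?L = "{w. set w \<subseteq> {..<d} \<and> length w = 2 * m}"
  have perm: "?p j permutes {..<?n}" if "j < d" for j
    by (rule GL2_perm_permutes[OF s[OF that]])
  have diag: "(\<Sum>a<2 * ?n. if fold ?\<tau> w a = a then 1 else 0) = GL.fixc (walk ?p True w) + GL.fixc (walk ?p False w)"
    if w: "w \<in> ?L" for w
  proof -
    have f: "fold ?\<tau> w (vertex ?n e a) = vertex ?n e (walk ?p e w a)" if "a < ?n" for e a
      using fold_edge_map[of w ?p ?n a e] perm w that by auto
    have walk_less: "walk ?p e w a < ?n" if "a < ?n" for e a
      using permutes_in_image[OF walk_permutes[of w ?p "{..<?n}" e], of a] perm w that by auto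
    have half: "(\<Sum>a<?n. if fold ?\<tau> w (vertex ?n e a) = vertex ?n e a then 1 else 0) = GL.fixc (walk ?p e w)" for e
    proof -
      have "(\<Sum>a<?n. if fold ?\<tau> w (vertex ?n e a) = vertex ?n e a then 1 else 0)
          = (\<Sum>a<?n. if walk ?p e w a = a then 1 else 0 :: real)"
        by (intro sum.cong refl) (simp only: f lessThan_iff vertex_inject)
      then show ?thesis unfolding GL.fixc_def by (simp add: sum.If_cases Int_def)
    qed
    have "(\<Sum>a<2 * ?n. if fold ?\<tau> w a = a then 1 else 0 :: real)
        = (\<Sum>a<?n. if fold ?\<tau> w a = a then 1 else 0) + (\<Sum>a=?n..<?n + ?n. if fold ?\<tau> w a = a then 1 else 0)"
      by (simp add: lessThan_atLeast0 mult_2 sum.atLeastLessThan_concat)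
    also have "(\<Sum>a=?n..<?n + ?n. if fold ?\<tau> w a = a then 1 else 0 :: real)
        = (\<Sum>a<?n. if fold ?\<tau> w (?n + a) = ?n + a then 1 else 0)"
      using sum.shift_bounds_nat_ivl[of "\<lambda>a. if fold ?\<tau> w a = a then 1 else 0 :: real" 0 ?n ?n]
      by (simp add: lessThan_atLeast0 add.commute)
    finally show ?thesis using half[of True] half[of False] by (simp add: vertex_def)
  qed
  have "(\<Sum>a<2 * ?n. (normalized_adj k d s ^\<^sub>m (2 * m)) $$ (a,a))
      = (\<Sum>a<2 * ?n. (1 / real d) ^ (2 * m) * (\<Sum>w\<in>?L. if fold ?\<tau> w a = a then 1 else 0))"
    by (intro sum.cong refl pow_mat_entry_walks[OF normalized_adj_carrier normalized_adj_entry] edge_map_less perm) auto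
  also have "\<dots> = (1 / real d) ^ (2 * m) * (\<Sum>w\<in>?L. \<Sum>a<2 * ?n. if fold ?\<tau> w a = a then 1 else 0)"
    unfolding sum_distrib_left[symmetric] by (subst sum.swap) simp
  finally show ?thesis using diag by simp
qed

lemma mu2_power_le:
  assumes m: "m \<ge> 1"
  shows "2 * mu2 k d s ^ (2 * m) \<le> (\<Sum>a<2 * (2 ^ k - 1). (normalized_adj k d s ^\<^sub>m (2 * m)) $$ (a,a)) - 2"
  unfolding mu2_def
proof (rule bipartite_second_eigenvalue_power_le_trace[OF normalized_adj_carrier])
  let ?n = "2 ^ k - 1 :: nat"
  let ?A = "normalized_adj k d s"
  let ?\<tau> = "\<lambda>j. edge_map ?n (GL2_perm k (s j))"
  have perm: "GL2_perm k (s j) permutes {..<?n}" if "j < d" for j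
    by (rule GL2_perm_permutes[OF s[OF that]])
  have n3: "?n \<ge> 3" using GL.cardX by simp
  then show "3 \<le> 2 * ?n" by simp
  show "transpose_mat ?A = ?A"
  proof (rule eq_matI)
    fix a b assume "a < dim_row ?A" "b < dim_col ?A"
    then have ab: "a < 2 * ?n" "b < 2 * ?n" using normalized_adj_carrier by auto
    have "?A $$ (b,a) = ?A $$ (a,b)"
      unfolding normalized_adj_entry[OF ab] normalized_adj_entry[OF ab(2,1)]
      using edge_map_sym[OF perm ab] by (intro arg_cong2[of _ _ _ _ "(*)"] sum.cong refl) auto
    then show "transpose_mat ?A $$ (a,b) = ?A $$ (a,b)" using ab normalized_adj_carrier by simp
  qed (use normalized_adj_carrier in auto)
  show "?A $$ (i,j) = 0" if "i < 2 * ?n" "j < 2 * ?n" "(i < ?n) = (j < ?n)" for i j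
    using that by (auto simp: normalized_adj_def schreier_adj_def Let_def)
  show "eigenvalue ?A 1"
  proof -
    \<comment> \<open>Every vertex has degree d, so after division by d all row sums are 1 and the
      constant vector is an eigenvector.\<close>
    let ?v = "vec (2 * ?n) (\<lambda>_. 1 :: real)"
    have "(?A *\<^sub>v ?v) $ a = ?v $ a" if a: "a < 2 * ?n" for a
    proof -
      have "(?A *\<^sub>v ?v) $ a = (\<Sum>b<2 * ?n. ?A $$ (a,b))"
        using normalized_adj_carrier a by (simp add: scalar_prod_def lessThan_atLeast0)
      also have "\<dots> = (1 / real d) * (\<Sum>b<2 * ?n. \<Sum>j<d. if ?\<tau> j a = b then 1 else 0)"
        unfolding sum_distrib_left[of _ _ "{..<2 * ?n}"] using a
        by (intro sum.cong refl) (simp only: normalized_adj_entry lessThan_iff)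
      also have "(\<Sum>b<2 * ?n. \<Sum>j<d. if ?\<tau> j a = b then 1 else 0 :: real)
          = (\<Sum>j<d. \<Sum>b<2 * ?n. if ?\<tau> j a = b then 1 else 0)"
        by (rule sum.swap)
      also have "\<dots> = (\<Sum>j<d. 1)"
        using edge_map_less[OF perm a] by (intro sum.cong refl) simp
      finally show ?thesis using d a by simp
    qed
    then have "?A *\<^sub>v ?v = 1 \<cdot>\<^sub>v ?v"
      using normalized_adj_carrier by (intro eq_vecI) auto
    moreover have "?v \<noteq> 0\<^sub>v (2 * ?n)"
    proof
      assume "?v = 0\<^sub>v (2 * ?n)"
      then have "?v $ 0 = 0\<^sub>v (2 * ?n) $ 0" by simp
      then show False using n3 by simp
    qed
    ultimately have "eigenvector ?A ?v 1"
      using normalized_adj_carrier unfolding eigenvector_def by auto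
    then show ?thesis unfolding eigenvalue_def by blast
  qed
qed (rule m)

end

lemma mean_power_even_le:
  fixes x :: "'a \<Rightarrow> real"
  assumes S: "finite S" "S \<noteq> {}"
  shows "((\<Sum>s\<in>S. x s) / real (card S)) ^ (2 * m) \<le> (\<Sum>s\<in>S. x s ^ (2 * m)) / real (card S)"
proof -
  have c: "real (card S) > 0" using S by (simp add: card_gt_0_iff)
  have "(\<Sum>s\<in>S. (1 / real (card S)) *\<^sub>R x s) ^ (2 * m) \<le> (\<Sum>s\<in>S. (1 / real (card S)) * x s ^ (2 * m))"
    by (rule convex_on_sum[OF S convex_power_even[of "2 * m"]]) (use c in auto)
  then show ?thesis by (simp add: sum_divide_distrib)
qed

theorem theorem2:
  fixes k d m :: nat
  assumes "k \<ge> 2" and "d \<ge> 1" and "m \<ge> 1"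
  defines "n \<equiv> 2 ^ k - 1"
  shows "expected_abs_mu2 k d \<le>
    root (2 * m)
     ((1 / real d) ^ (2 * m) * real n *
        ((\<Sum>i = 1..m. real (d choose i) * (1 / 2) ^ i * (fact (2 * m) / fact (2 * m - 2 * i))
            * (2 ^ i / fact (i + 1))
            * (Y 3 1 (2 * m - 2 * i) (d - i) * (5 / real n) + Y 4 0 (2 * m - 2 * i) (d - i)))
         + Y 1 1 (2 * m) d * (1 / real n) + Y 2 1 (2 * m) d * (2 / real n)
         + Y 3 1 (2 * m) d * (5 / real n) + Y 4 0 (2 * m) d)
      - 1)"
proof -
  interpret GL: sampler "{..<n}" "index_add k" "GL2 k" "GL2_perm k"
    unfolding n_def by (rule sampler_GL2[OF assms(1)])
  let ?\<Omega> = "PiE {..<d} (\<lambda>_. GL2 k)"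
  let ?L = "{w. set w \<subseteq> {..<d} \<and> length w = 2 * m}"
  let ?W = "\<lambda>s e w. GL.fixc (walk (\<lambda>j. GL2_perm k (s j)) e w)"
  let ?B = "(\<Sum>i = 1..m. real (d choose i) * (1 / 2) ^ i * (fact (2 * m) / fact (2 * m - 2 * i))
            * (2 ^ i / fact (i + 1))
            * (Y 3 1 (2 * m - 2 * i) (d - i) * 5 + Y 4 0 (2 * m - 2 * i) (d - i) * real n))
      + Y 1 1 (2 * m) d * 1 + Y 2 1 (2 * m) d * 2 + Y 3 1 (2 * m) d * 5 + Y 4 0 (2 * m) d * real n"
  define \<Omega> where "\<Omega> = real (card ?\<Omega>)"
  define tr where "tr s = (\<Sum>a<2 * n. (normalized_adj k d s ^\<^sub>m (2 * m)) $$ (a,a))" for s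
  have n0: "real n > 0" using GL.cardX by simp
  have fin: "finite ?\<Omega>" using GL.finG by (intro finite_PiE) auto
  have ne: "?\<Omega> \<noteq> {}" using GL.G_nonempty by (simp add: PiE_eq_empty_iff)
  have \<Omega>: "\<Omega> > 0" unfolding \<Omega>_def using fin ne by (simp add: card_gt_0_iff)
  have mem: "s j \<in> GL2 k" if "s \<in> ?\<Omega>" "j < d" for s j using that by auto
  \<comment> \<open>Both starting signs obey the same bound, so the mean trace is at most twice the
    normalized \<open>?B\<close>. This 2 cancels against the factor 2 on the left of
    \<open>mu2_power_le\<close>.\<close>
  have half: "(\<Sum>w\<in>?L. (\<Sum>s\<in>?\<Omega>. ?W s e w) / \<Omega>) \<le> ?B" for e
  proof (rule sum_word_weights_le)
    show "(\<Sum>s\<in>?\<Omega>. ?W s e w) / \<Omega> \<le> 1" if "set w \<subseteq> {..<d}" "count_list w j = 1" for w j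
      using GL.sum_fixc_walk_one[OF that, where e = e] \<Omega> by (simp add: \<Omega>_def[symmetric] pos_divide_le_eq)
    show "(\<Sum>s\<in>?\<Omega>. ?W s e w) / \<Omega> \<le> 2" if "set w \<subseteq> {..<d}" "crossing w a b" for w a b
      using GL.sum_fixc_walk_crossing[OF that, where e = e] \<Omega> by (simp add: \<Omega>_def[symmetric] pos_divide_le_eq)
    show "(\<Sum>s\<in>?\<Omega>. ?W s e w) / \<Omega> \<le> 5" if "set w \<subseteq> {..<d}" "count_list w j = 3" for w j
      using GL.sum_fixc_walk_three[OF that, where e = e] \<Omega> by (simp add: \<Omega>_def[symmetric] pos_divide_le_eq)
    show "(\<Sum>s\<in>?\<Omega>. ?W s e w) / \<Omega> \<le> real n" if "set w \<subseteq> {..<d}" for w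
      using GL.sum_fixc_walk_trivial[where d = d and e = e and w = w] \<Omega> by (simp add: \<Omega>_def[symmetric] pos_divide_le_eq)
  qed simp
  have trace: "tr s = (1 / real d) ^ (2 * m) * (\<Sum>w\<in>?L. ?W s True w + ?W s False w)" if "s \<in> ?\<Omega>" for s
    unfolding tr_def n_def
    using trace_normalized_adj_pow[OF assms(1,2) mem[OF that], where m = m] .
  have swap: "(\<Sum>s\<in>?\<Omega>. \<Sum>w\<in>?L. ?W s e w) / \<Omega> \<le> ?B" for e
  proof -
    have "(\<Sum>s\<in>?\<Omega>. \<Sum>w\<in>?L. ?W s e w) / \<Omega> = (\<Sum>w\<in>?L. (\<Sum>s\<in>?\<Omega>. ?W s e w) / \<Omega>)"
      by (subst sum.swap) (simp add: sum_divide_distrib)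
    then show ?thesis using half[of e] by simp
  qed
  have "(\<Sum>s\<in>?\<Omega>. tr s) / \<Omega> = (1 / real d) ^ (2 * m)
      * ((\<Sum>s\<in>?\<Omega>. \<Sum>w\<in>?L. ?W s True w) / \<Omega> + (\<Sum>s\<in>?\<Omega>. \<Sum>w\<in>?L. ?W s False w) / \<Omega>)"
    by (simp add: trace sum.distrib sum_distrib_left[symmetric])
      (simp add: distrib_left add_divide_distrib)
  also have "\<dots> \<le> (1 / real d) ^ (2 * m) * (?B + ?B)"
    by (intro mult_left_mono add_mono swap) simp
  finally have mean_tr: "(\<Sum>s\<in>?\<Omega>. tr s) / \<Omega> \<le> 2 * ((1 / real d) ^ (2 * m) * ?B)"
    by (simp only: mult_2 distrib_left)
  have "expected_abs_mu2 k d ^ (2 * m) \<le> (\<Sum>s\<in>?\<Omega>. \<bar>mu2 k d s\<bar> ^ (2 * m)) / \<Omega>"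
    unfolding expected_abs_mu2_def \<Omega>_def by (rule mean_power_even_le[OF fin ne])
  also have "\<dots> \<le> (\<Sum>s\<in>?\<Omega>. tr s / 2 - 1) / \<Omega>"
  proof (intro divide_right_mono sum_mono)
    fix s assume s: "s \<in> ?\<Omega>"
    have "2 * mu2 k d s ^ (2 * m) \<le> tr s - 2"
      unfolding tr_def n_def using mu2_power_le[OF assms(1,2) mem[OF s] assms(3)] .
    then show "\<bar>mu2 k d s\<bar> ^ (2 * m) \<le> tr s / 2 - 1" by (simp add: power_even_abs)
  qed (use \<Omega> in simp)
  also have "\<dots> = ((\<Sum>s\<in>?\<Omega>. tr s) / \<Omega>) / 2 - 1"
    using \<Omega> by (simp add: sum_subtractf sum_divide_distrib[symmetric] \<Omega>_def[symmetric] diff_divide_distrib)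
  also have "\<dots> \<le> (1 / real d) ^ (2 * m) * ?B - 1" using mean_tr by simp
  \<comment> \<open>Pulling out n turns the weights 1, 2, 5 and n of the word classes into the
    factors 1/n, 2/n, 5/n and 1 of the claim.\<close>
  also have "?B = real n * ((\<Sum>i = 1..m. real (d choose i) * (1 / 2) ^ i * (fact (2 * m) / fact (2 * m - 2 * i))
            * (2 ^ i / fact (i + 1))
            * (Y 3 1 (2 * m - 2 * i) (d - i) * (5 / real n) + Y 4 0 (2 * m - 2 * i) (d - i)))
         + Y 1 1 (2 * m) d * (1 / real n) + Y 2 1 (2 * m) d * (2 / real n)
         + Y 3 1 (2 * m) d * (5 / real n) + Y 4 0 (2 * m) d)"
  proof -
    have e: "x * (y * 5 + z * real n) = real n * (x * (y * (5 / real n) + z))" for x y z :: real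
      using n0 by (simp add: field_simps)
    have e2: "real n * (S + a * (1 / real n) + b * (2 / real n) + c * (5 / real n) + u)
        = real n * S + a * 1 + b * 2 + c * 5 + u * real n" for S a b c u :: real
      using n0 by (simp add: field_simps)
    show ?thesis unfolding e sum_distrib_left[symmetric] e2 ..
  qed
  finally have main: "expected_abs_mu2 k d ^ (2 * m) \<le> (1 / real d) ^ (2 * m) * real n *
        ((\<Sum>i = 1..m. real (d choose i) * (1 / 2) ^ i * (fact (2 * m) / fact (2 * m - 2 * i))
            * (2 ^ i / fact (i + 1))
            * (Y 3 1 (2 * m - 2 * i) (d - i) * (5 / real n) + Y 4 0 (2 * m - 2 * i) (d - i)))
         + Y 1 1 (2 * m) d * (1 / real n) + Y 2 1 (2 * m) d * (2 / real n)
         + Y 3 1 (2 * m) d * (5 / real n) + Y 4 0 (2 * m) d) - 1"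
    by (simp only: mult.assoc)
  have "expected_abs_mu2 k d \<ge> 0"
    unfolding expected_abs_mu2_def by (intro divide_nonneg_nonneg sum_nonneg) auto
  then have "expected_abs_mu2 k d = root (2 * m) (expected_abs_mu2 k d ^ (2 * m))"
    using assms(3) by (simp add: real_root_power_cancel)
  also have "\<dots> \<le> root (2 * m) ((1 / real d) ^ (2 * m) * real n *
        ((\<Sum>i = 1..m. real (d choose i) * (1 / 2) ^ i * (fact (2 * m) / fact (2 * m - 2 * i))
            * (2 ^ i / fact (i + 1))
            * (Y 3 1 (2 * m - 2 * i) (d - i) * (5 / real n) + Y 4 0 (2 * m - 2 * i) (d - i)))
         + Y 1 1 (2 * m) d * (1 / real n) + Y 2 1 (2 * m) d * (2 / real n)
         + Y 3 1 (2 * m) d * (5 / real n) + Y 4 0 (2 * m) d) - 1)"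
    using assms(3) main by (intro real_root_le_mono) auto
  finally show ?thesis .
qed

end
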